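(* Let $\Omega=(a,b)$, let $u^\varepsilon$ and $u$ be the solutions of the regularized logarithmic Schrödinger equation and of the logarithmic Schrödinger equation described in the context, with the same initial datum $u_0\in H^2(\Omega)\cap H^1_0(\Omega)$, let $0<T<T_{\max}$ with $T_{\max}$ the maximal existence time of $u^\varepsilon$, and assume (A) $u^\varepsilon\in C([0,T];H^5(\Omega))\cap C^2([0,T];H^4(\Omega))\cap C^3([0,T];H^2(\Omega))$, and there exist $\varepsilon_0>0$ and $C_0>0$ independent of $\varepsilon$ such that $$\|u^\varepsilon\|_{L^\infty(0,T;H^5(\Omega))}+\|\partial_t^2u^\varepsilon\|_{L^\infty(0,T;H^4(\Omega))}+\|\partial_t^3u^\varepsilon\|_{L^\infty(0,T;H^2(\Omega))}\le C_0$$ uniformly in $0\le\varepsilon\le\varepsilon_0$. Then, for all sufficiently small $\varepsilon\in(0,\varepsilon_0]$, there exist $h_0>0$ and $\tau_0>0$ sufficiently small with $h_0\sim\sqrt{\varepsilon}\,e^{-CT|\ln(\varepsilon)|^2}$ and $\tau_0\sim\sqrt{\varepsilon}\,e^{-CT|\ln(\varepsilon)|^2}$ such that, when $0<h\le h_0$ and $0<\tau\le\tau_0$ satisfy the stability condition $$0<\tau\le\frac{1}{2\max\{|\ln\varepsilon|,\ \ln(\varepsilon+\max_{1\le j\le M-1}|u_j^{\varepsilon,k}|)\}},\qquad 0\le k\le\frac T\tau,$$ the error $\widetilde e^{\varepsilon,k}_j:=u(x_j,t_k)-u_j^{\varepsilon,k}$, $0\le j\le M$, between $u$ and the numerical solution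 $u^{\varepsilon,k}$ of the semi-implicit finite difference scheme (see context) satisfies, for $0\le k\le T/\tau$, $$\|\widetilde e^{\varepsilon,k}\|\le C_1\varepsilon+C_1(\varepsilon,T)(h^2+\tau^2),\qquad \|\widetilde e^{\varepsilon,k}\|_{H^1}\le C_2\varepsilon^{1/2}+C_2(\varepsilon,T)(h^2+\tau^2),$$ where $C_1$ depends on $T$, $|\Omega|$; $C_2$ depends on $T$, $|\Omega|$ and $\|u_0\|_{H^2(\Omega)}$; $C_1(\varepsilon,T)\sim e^{CT|\ln(\varepsilon)|^2}$, $C_2(\varepsilon,T)\sim\frac1\varepsilon e^{CT|\ln(\varepsilon)|^2}$; and $C$ depends on $C_0$.
   Context: **Equations.** With $\lambda=1$, $u^\varepsilon$ solves $$i\partial_tu^\varepsilon+\partial_{xx}u^\varepsilon=u^\varepsilon\ln\big((\varepsilon+|u^\varepsilon|)^2\big),\ x\in\Omega=(a,b),\ t>0;\quad u^\varepsilon(x,0)=u_0(x);\quad u^\varepsilon(a,t)=u^\varepsilon(b,t)=0,\ t\ge0,$$ where $0\le\varepsilon\ll1$, and $u$ solves $$i\partial_tu+\partial_{xx}u=u\ln(|u|^2),\ x\in\Omega,\ t>0;\quad u(x,0)=u_0(x);\quad u(a,t)=u(b,t)=0,\ t\ge0$$ (with $z\ln(|z|^2)=0$ at $z=0$; this is the case $\varepsilon=0$ of the first equation). **Grid.** $h=(b-a)/M$ with $M$ a positive integer, time step $\tau>0$, $x_j=a+jh$ ($0\le j\le M$), $t_k=k\tau$ ($k\ge0$); $T/\tau$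 is taken to be an integer. Finite differences: $$\delta_t^cu_j^k=\frac{u_j^{k+1}-u_j^{k-1}}{2\tau},\quad \delta_x^+u_j^k=\frac{u_{j+1}^k-u_j^k}{h},\quad \delta_x^2u_j^k=\frac{u_{j+1}^k-2u_j^k+u_{j-1}^k}{h^2}.$$ **Scheme.** $u^{\varepsilon,k}=(u_0^{\varepsilon,k},\dots,u_M^{\varepsilon,k})^T\in\mathbb{C}^{M+1}$ is defined by $$i\delta_t^cu_j^{\varepsilon,k}=-\tfrac12\delta_x^2\big(u_j^{\varepsilon,k+1}+u_j^{\varepsilon,k-1}\big)+u_j^{\varepsilon,k}\ln\big((\varepsilon+|u_j^{\varepsilon,k}|)^2\big),\quad 1\le j\le M-1,\ k\ge1,$$ with $u_0^{\varepsilon,k}=u_M^{\varepsilon,k}=0$ for $k\ge0$, $u_j^{\varepsilon,0}=u_0(x_j)$, and first step $u_j^{\varepsilon,1}=u_j^{\varepsilon,0}+\tau u_1(x_j)$ for $0\le j\le M$, where $u_1(x):=\partial_tu^\varepsilon(x,0)=i\big[u_0''(x)-u_0(x)\ln\big((\varepsilon+|u_0(x)|)^2\big)\big]$. **Discrete norms.** For $v=(v_0,\dots,v_M)^T\in\mathbb{C}^{M+1}$ with $v_0=v_M=0$: $\|v\|^2=h\sum_{j=1}^{M-1}|v_j|^2$, $|v|_{H^1}^2=h\sum_{j=0}^{M-1}|\delta_x^+v_j|^2$, $\|v\|_{H^1}^2=\|v\|^2+|v|_{H^1}^2$. **Constants.** $C_1,C_2$ are the constants, independent of $\varepsilon$,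 in the bounds $\|u^\varepsilon-u\|_{L^\infty(0,T;L^2(\Omega))}\le C_1\varepsilon$ and $\|u^\varepsilon-u\|_{L^\infty(0,T;H^1(\Omega))}\le C_2\varepsilon^{1/2}$; $C_1(\varepsilon,T),C_2(\varepsilon,T)$ are those in the bounds $\|e^{\varepsilon,k}\|\le C_1(\varepsilon,T)(h^2+\tau^2)$ and $\|e^{\varepsilon,k}\|_{H^1}\le C_2(\varepsilon,T)(h^2+\tau^2)$ for $e^{\varepsilon,k}_j=u^\varepsilon(x_j,t_k)-u^{\varepsilon,k}_j$. $A\sim B$ means that $A$ and $B$ are comparable up to positive multiplicative constants independent of $\varepsilon,h,\tau$. $|\Omega|=b-a$. *)

theory Defs
  imports "HOL-Analysis.Analysis" "HOL-Probability.Essential_Supremum"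
begin

definition vderiv :: "nat \<Rightarrow> (real \<Rightarrow> complex) \<Rightarrow> real \<Rightarrow> complex" where
  "vderiv n f = ((\<lambda>g x. vector_derivative g (at x)) ^^ n) f"

text \<open>Smooth functions with compact support in the open interval.\<close>

definition test_fun :: "real \<Rightarrow> real \<Rightarrow> (real \<Rightarrow> complex) \<Rightarrow> bool" where
  "test_fun a b \<phi> \<longleftrightarrow>
     (\<forall>n. vderiv n \<phi> differentiable_on UNIV) \<and> closure {x. \<phi> x \<noteq> 0} \<subseteq> {a<..<b}"

definition L2 :: "real \<Rightarrow> real \<Rightarrow> (real \<Rightarrow> complex) \<Rightarrow> bool" where
  "L2 a b f \<longleftrightarrow> f \<in> borel_measurable (lebesgue_on {a<..<b}) \<and>
     integrable (lebesgue_on {a<..<b}) (\<lambda>x. (cmod (f x))\<^sup>2)"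

definition L2_norm :: "real \<Rightarrow> real \<Rightarrow> (real \<Rightarrow> complex) \<Rightarrow> real" where
  "L2_norm a b f = sqrt (LINT x|lebesgue_on {a<..<b}. (cmod (f x))\<^sup>2)"

text \<open>\<open>g\<close> is the weak derivative of order \<open>n\<close> of \<open>f\<close>, and lies in $L^2(a,b)$.\<close>

definition weak_deriv :: "real \<Rightarrow> real \<Rightarrow> nat \<Rightarrow> (real \<Rightarrow> complex) \<Rightarrow> (real \<Rightarrow> complex) \<Rightarrow> bool" where
  "weak_deriv a b n f g \<longleftrightarrow> L2 a b g \<and>
     (\<forall>\<phi>. test_fun a b \<phi> \<longrightarrow>
        (LINT x|lebesgue_on {a<..<b}. f x * vderiv n \<phi> x)
          = (-1) ^ n * (LINT x|lebesgue_on {a<..<b}. g x * \<phi> x))"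

text \<open>Weak derivatives are unique up to null sets, so the choice below does not affect any
  norm or almost-everywhere statement.  It is meaningful only where a weak derivative exists.\<close>

definition wderiv :: "real \<Rightarrow> real \<Rightarrow> nat \<Rightarrow> (real \<Rightarrow> complex) \<Rightarrow> real \<Rightarrow> complex" where
  "wderiv a b n f = (SOME g. weak_deriv a b n f g)"

text \<open>\<open>Sob a b m\<close> is membership in $H^m(a,b)$, with $H^0 = L^2$.  The norm \<open>Sob_norm\<close> is
  meaningful only on members.\<close>

definition Sob :: "real \<Rightarrow> real \<Rightarrow> nat \<Rightarrow> (real \<Rightarrow> complex) \<Rightarrow> bool" where
  "Sob a b m f \<longleftrightarrow> L2 a b f \<and> (\<forall>n\<in>{1..m}. \<exists>g. weak_deriv a b n f g)"

definition Sob_norm :: "real \<Rightarrow> real \<Rightarrow> nat \<Rightarrow> (real \<Rightarrow> complex) \<Rightarrow> real" where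
  "Sob_norm a b m f = sqrt ((L2_norm a b f)\<^sup>2 + (\<Sum>n=1..m. (L2_norm a b (wderiv a b n f))\<^sup>2))"

text \<open>$H^1_0(a,b)$ is the closure of the test functions in $H^1(a,b)$.\<close>

definition H10 :: "real \<Rightarrow> real \<Rightarrow> (real \<Rightarrow> complex) \<Rightarrow> bool" where
  "H10 a b f \<longleftrightarrow> Sob a b 1 f \<and>
     (\<exists>\<phi>. (\<forall>n::nat. test_fun a b (\<phi> n)) \<and>
        (\<lambda>n. Sob_norm a b 1 (\<lambda>x. f x - \<phi> n x)) \<longlonglongrightarrow> 0)"

text \<open>A function \<open>u\<close> of time and space is written \<open>u t x\<close>.  \<open>cont_Sob I a b m\<close> is $C(I;H^m(a,b))$.\<close>

definition cont_Sob :: "real set \<Rightarrow> real \<Rightarrow> real \<Rightarrow> nat \<Rightarrow> (real \<Rightarrow> real \<Rightarrow> complex) \<Rightarrow> bool" where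
  "cont_Sob I a b m u \<longleftrightarrow> (\<forall>t\<in>I. Sob a b m (u t) \<and>
     ((\<lambda>s. Sob_norm a b m (\<lambda>x. u s x - u t x)) \<longlongrightarrow> 0) (at t within I))"

definition has_time_deriv_Sob ::
    "real set \<Rightarrow> real \<Rightarrow> real \<Rightarrow> nat \<Rightarrow> (real \<Rightarrow> real \<Rightarrow> complex) \<Rightarrow> (real \<Rightarrow> real \<Rightarrow> complex) \<Rightarrow> bool" where
  "has_time_deriv_Sob I a b m u v \<longleftrightarrow> (\<forall>t\<in>I.
     ((\<lambda>s. Sob_norm a b m (\<lambda>x. (u s x - u t x) /\<^sub>R (s - t) - v t x)) \<longlongrightarrow> 0) (at t within I))"

text \<open>\<open>D 0\<close> belongs to $C^k(I;H^m(a,b))$ and \<open>D j\<close> is its time derivative of order \<open>j\<close>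
  for $j \le k$.\<close>

definition Ck_Sob ::
    "real set \<Rightarrow> real \<Rightarrow> real \<Rightarrow> nat \<Rightarrow> nat \<Rightarrow> (nat \<Rightarrow> real \<Rightarrow> real \<Rightarrow> complex) \<Rightarrow> bool" where
  "Ck_Sob I a b k m D \<longleftrightarrow> (\<forall>j\<le>k. cont_Sob I a b m (D j)) \<and>
     (\<forall>j<k. has_time_deriv_Sob I a b m (D j) (D (Suc j)))"

text \<open>The norm of $L^\infty(0,T;H^m(a,b))$.  The extended value keeps the library's convention
  that the essential supremum of a non-measurable function is infinite.\<close>

definition Linf_Sob :: "real \<Rightarrow> real \<Rightarrow> real \<Rightarrow> nat \<Rightarrow> (real \<Rightarrow> real \<Rightarrow> complex) \<Rightarrow> ereal" where
  "Linf_Sob T a b m v = esssup (lebesgue_on {0<..<T}) (\<lambda>t. ereal (Sob_norm a b m (v t)))"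

text \<open>For \<open>\<epsilon> = 0\<close> and \<open>z = 0\<close> the value is 0.\<close>

definition log_nl :: "real \<Rightarrow> complex \<Rightarrow> complex" where
  "log_nl \<epsilon> z = z * of_real (ln ((\<epsilon> + cmod z)\<^sup>2))"

text \<open>Strong solutions on $[0,S)$ with $0 < S \le \infty$: $u \in C([0,S);H^2) \cap C^1([0,S);L^2)$, with
  the equation holding in $L^2(a,b)$ at each time.  Each \<open>u t\<close> is taken to be the continuous
  representative on $[a,b]$, so that boundary and grid values make sense.\<close>

definition solves ::
    "real \<Rightarrow> real \<Rightarrow> real \<Rightarrow> (real \<Rightarrow> complex) \<Rightarrow> (real \<Rightarrow> real \<Rightarrow> complex) \<Rightarrow> ereal \<Rightarrow> bool" where
  "solves a b \<epsilon> u0 u S \<longleftrightarrow> (let I = {t. 0 \<le> t \<and> ereal t < S} in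
     (\<forall>t\<in>I. continuous_on {a..b} (u t)) \<and>
     cont_Sob I a b 2 u \<and>
     (\<exists>v. cont_Sob I a b 0 v \<and> has_time_deriv_Sob I a b 0 u v \<and>
        (\<forall>t\<in>I. AE x in lebesgue_on {a<..<b}.
           \<i> * v t x + wderiv a b 2 (u t) x = log_nl \<epsilon> (u t x))) \<and>
     (\<forall>x\<in>{a..b}. u 0 x = u0 x) \<and>
     (\<forall>t\<in>I. u t a = 0 \<and> u t b = 0))"

definition T_max :: "real \<Rightarrow> real \<Rightarrow> real \<Rightarrow> (real \<Rightarrow> complex) \<Rightarrow> ereal" where
  "T_max a b \<epsilon> u0 = Sup {S. 0 < S \<and> (\<exists>v. solves a b \<epsilon> u0 v S)}"

text \<open>\<open>D j\<close> is the time derivative of order \<open>j\<close> of \<open>u\<close>.  It is determined up to null sets in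
  space, so quantifying it existentially together with the bound is harmless.\<close>

definition regular :: "real \<Rightarrow> real \<Rightarrow> real \<Rightarrow> real \<Rightarrow> (real \<Rightarrow> real \<Rightarrow> complex) \<Rightarrow> bool" where
  "regular a b T C0 u \<longleftrightarrow> (\<exists>D. D 0 = u \<and>
     cont_Sob {0..T} a b 5 u \<and> Ck_Sob {0..T} a b 2 4 D \<and> Ck_Sob {0..T} a b 3 2 D \<and>
     Linf_Sob T a b 5 u + Linf_Sob T a b 4 (D 2) + Linf_Sob T a b 2 (D 3) \<le> ereal C0)"

definition mesh :: "real \<Rightarrow> real \<Rightarrow> nat \<Rightarrow> real" where
  "mesh a b M = (b - a) / real M"

definition node :: "real \<Rightarrow> real \<Rightarrow> nat \<Rightarrow> nat \<Rightarrow> real" where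
  "node a b M j = a + real j * mesh a b M"

definition dx_plus :: "real \<Rightarrow> (nat \<Rightarrow> complex) \<Rightarrow> nat \<Rightarrow> complex" where
  "dx_plus h v j = (v (j + 1) - v j) /\<^sub>R h"

definition dxx :: "real \<Rightarrow> (nat \<Rightarrow> complex) \<Rightarrow> nat \<Rightarrow> complex" where
  "dxx h v j = (v (j + 1) - 2 * v j + v (j - 1)) /\<^sub>R h\<^sup>2"

definition dt_c :: "real \<Rightarrow> (nat \<Rightarrow> nat \<Rightarrow> complex) \<Rightarrow> nat \<Rightarrow> nat \<Rightarrow> complex" where
  "dt_c \<tau> U k j = (U (k + 1) j - U (k - 1) j) /\<^sub>R (2 * \<tau>)"

text \<open>The initial velocity $\partial_t u^\varepsilon(x,0)$.  The second derivative of the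
  initial datum is taken within $[a,b]$, hence one-sided at the endpoints.\<close>

definition u_one :: "real \<Rightarrow> real \<Rightarrow> real \<Rightarrow> (real \<Rightarrow> complex) \<Rightarrow> real \<Rightarrow> complex" where
  "u_one a b \<epsilon> u0 x = \<i> *
     (vector_derivative (\<lambda>y. vector_derivative u0 (at y within {a..b})) (at x within {a..b})
        - log_nl \<epsilon> (u0 x))"

text \<open>\<open>U k j\<close> is the value at time level \<open>k\<close> and node \<open>j\<close>; only \<open>j \<le> M\<close> is relevant.
  The conditions for level 1 at the boundary nodes are compatible with the zero boundary values
  because the second derivative of a regular initial datum vanishes there.\<close>

definition fd_scheme ::
    "real \<Rightarrow> real \<Rightarrow> real \<Rightarrow> (real \<Rightarrow> complex) \<Rightarrow> nat \<Rightarrow> real \<Rightarrow> (nat \<Rightarrow> nat \<Rightarrow> complex) \<Rightarrow> bool" where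
  "fd_scheme a b \<epsilon> u0 M \<tau> U \<longleftrightarrow>
     (\<forall>k\<ge>1. \<forall>j\<in>{1..M-1}.
        \<i> * dt_c \<tau> U k j =
          - (1/2) * dxx (mesh a b M) (\<lambda>i. U (k + 1) i + U (k - 1) i) j + log_nl \<epsilon> (U k j)) \<and>
     (\<forall>k. U k 0 = 0 \<and> U k M = 0) \<and>
     (\<forall>j\<le>M. U 0 j = u0 (node a b M j)) \<and>
     (\<forall>j\<le>M. U 1 j = U 0 j + of_real \<tau> * u_one a b \<epsilon> u0 (node a b M j))"

text \<open>For \<open>M = 1\<close> there is no interior node and the maximum is unspecified; every discrete norm
  of a grid function vanishing at the boundary is then 0.\<close>

definition stability :: "real \<Rightarrow> nat \<Rightarrow> real \<Rightarrow> nat \<Rightarrow> (nat \<Rightarrow> nat \<Rightarrow> complex) \<Rightarrow> bool" where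
  "stability \<epsilon> M \<tau> N U \<longleftrightarrow> (\<forall>k\<le>N. 0 < \<tau> \<and>
     \<tau> \<le> 1 / (2 * max \<bar>ln \<epsilon>\<bar> (ln (\<epsilon> + (MAX j\<in>{1..M-1}. cmod (U k j))))))"

definition d_norm :: "real \<Rightarrow> nat \<Rightarrow> (nat \<Rightarrow> complex) \<Rightarrow> real" where
  "d_norm h M v = sqrt (h * (\<Sum>j=1..M-1. (cmod (v j))\<^sup>2))"

definition d_seminorm_H1 :: "real \<Rightarrow> nat \<Rightarrow> (nat \<Rightarrow> complex) \<Rightarrow> real" where
  "d_seminorm_H1 h M v = sqrt (h * (\<Sum>j<M. (cmod (dx_plus h v j))\<^sup>2))"

definition d_norm_H1 :: "real \<Rightarrow> nat \<Rightarrow> (nat \<Rightarrow> complex) \<Rightarrow> real" where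
  "d_norm_H1 h M v = sqrt ((d_norm h M v)\<^sup>2 + (d_seminorm_H1 h M v)\<^sup>2)"

definition grid_err ::
    "real \<Rightarrow> real \<Rightarrow> nat \<Rightarrow> real \<Rightarrow> (real \<Rightarrow> real \<Rightarrow> complex) \<Rightarrow> (nat \<Rightarrow> nat \<Rightarrow> complex) \<Rightarrow> nat \<Rightarrow> nat \<Rightarrow> complex" where
  "grid_err a b M \<tau> u U k j = u (real k * \<tau>) (node a b M j) - U k j"

text \<open>$f \sim g$ on \<open>A\<close>, with comparison constants that do not depend on the argument.\<close>

definition comparable_on :: "real set \<Rightarrow> (real \<Rightarrow> real) \<Rightarrow> (real \<Rightarrow> real) \<Rightarrow> bool" where
  "comparable_on A f g \<longleftrightarrow> (\<exists>c d. 0 < c \<and> 0 < d \<and> (\<forall>x\<in>A. c * g x \<le> f x \<and> f x \<le> d * g x))"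

end

theory Submission
  imports Defs
begin

text \<open>
Write $L = b - a$.  All constants that may depend on the individual problem are absorbed by one
observation: for fixed $T$ and $p$ one has $\varepsilon^{-p} \le K \exp(T |\ln \varepsilon|^2)$, so the
choice $C = 1$ works as soon as every error bound has the form $K \varepsilon^{-p} (h^2 + \tau^2)$.
Conversely, step sizes below a multiple of $\sqrt\varepsilon \exp(-T|\ln\varepsilon|^2)$ are smaller than
any power of $\varepsilon$.

\<^bold>\<open>Classical solutions.\<close>  Membership in $H^m$ is turned into the existence of $m - 1$ continuous
derivatives by the lemma of du Bois-Reymond (\<open>du_Bois_Reymond\<close>, \<open>weak_deriv_1_imp_primitive\<close>), which
rests on explicit bump functions.  The continuous representatives depend linearly on the function
and are bounded by the Sobolev norm, so time derivatives in $H^m$ become pointwise time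
derivatives.  \<open>regular_imp_classical\<close> collects the outcome in the locale \<open>classical_solution\<close>; from there
on the proof is about smooth functions only.

\<^bold>\<open>Model error.\<close>  The difference of $u^\varepsilon$ and $u$ is controlled in $L^2$ by the energy method: the
nonlinearity $f_\varepsilon(z) = z \ln((\varepsilon + |z|)^2)$ satisfies
$|\mathrm{Im}((f_\varepsilon(w) - f_\varepsilon(z)) \overline{(w - z)})| \le 2 |w - z|^2$ with a constant that does not see
$\varepsilon$, and replacing $f_\varepsilon$ by $f_0$ costs at most $2 \varepsilon$ pointwise.  Since
the difference and its second derivative vanish at the boundary, two integrations by parts give
$\|e'\|^6 \le \|e\|^4 \|e'''\|^2$, and the uniform bound on $e'''$ yields $\|e'\| \le \sqrt\varepsilon$ for small
$\varepsilon$ (\<open>interpolation_inequality\<close>).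

\<^bold>\<open>Discretization error.\<close>  The numerical solution is compared with a discrete Ritz projection of
$u^\varepsilon$, the grid function that vanishes at the boundary and whose second difference equals
$u^\varepsilon_{xx}$ at the nodes.  This matters for the $H^1$ estimate: the consistency error of the second
difference need not vanish at the boundary, whereas the consistency error of the projection does
(\<open>consistency_bdry\<close>), so it has a discrete $H^1$ norm of order $h^2 + \tau^2$.
The scheme propagates the $L^2$ norm and the $H^1$ seminorm with the same stability
estimate (\<open>energy_L2\<close>, \<open>energy_H1\<close>).  The derivative of $f_\varepsilon$ grows like $|\ln \varepsilon|$ but its Lipschitz
constant is of order $1/\varepsilon$; in the norm $|v|_{H^1} + \|v\|/\varepsilon$ the nonlinearity is nevertheless
Lipschitz with constant $2 |\ln \varepsilon| + K$ (\<open>wnorm_nonlinearity\<close>), so that Gronwall's lemma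
loses only a power of $\varepsilon$ (\<open>scheme_error\<close>).  The bound on the numerical solution that the
Lipschitz estimate requires is part of the induction over the time levels.
\<close>

section \<open>Smooth bump functions\<close>

definition exp_recip :: "nat \<Rightarrow> real \<Rightarrow> real" where
  "exp_recip k x = (if x > 0 then exp (- (1 / x)) / x ^ k else 0)"

lemma exp_recip_tendsto_0: "((\<lambda>x. exp_recip k x) \<longlongrightarrow> 0) (at 0)"
proof -
  have 1: "((\<lambda>y::real. y ^ k / exp y) \<longlongrightarrow> 0) at_top"
    by (rule tendsto_power_div_exp_0)
  have "((\<lambda>x::real. (inverse x) ^ k / exp (inverse x)) \<longlongrightarrow> 0) (at_right 0)"
    by (rule filterlim_compose[OF 1 filterlim_inverse_at_top_right])
  then have "((\<lambda>x. exp_recip k x) \<longlongrightarrow> 0) (at_right 0)"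
  proof (rule Lim_transform_eventually)
    show "\<forall>\<^sub>F x in at_right 0. (inverse x) ^ k / exp (inverse x) = exp_recip k x"
      using eventually_at_right_less[of "0::real"]
      by eventually_elim (simp add: exp_recip_def field_simps exp_minus)
  qed
  moreover have "((\<lambda>x. exp_recip k x) \<longlongrightarrow> 0) (at_left 0)"
    by (rule tendsto_eventually) (auto simp: exp_recip_def eventually_at_filter)
  ultimately show ?thesis
    by (simp add: filterlim_split_at)
qed

lemma exp_recip_has_derivative:
  "(exp_recip k has_real_derivative (exp_recip (k + 2) x - real k * exp_recip (k + 1) x)) (at x)"
proof -
  consider "x > 0" | "x < 0" | "x = 0" by linarith
  then show ?thesis
  proof cases
    case 1
    have "((\<lambda>x. exp (- (1 / x)) / x ^ k) has_real_derivative
       (exp_recip (k + 2) x - real k * exp_recip (k + 1) x)) (at x)"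
      using 1
      apply (auto intro!: derivative_eq_intros simp: exp_recip_def)
      apply (cases k)
       apply (auto simp: field_simps power2_eq_square)
      done
    then show ?thesis
      by (rule has_field_derivative_transform_within_open[of _ _ _ "{0<..}"])
         (use 1 in \<open>auto simp: exp_recip_def\<close>)
  next
    case 2
    have "((\<lambda>x. 0) has_real_derivative (exp_recip (k + 2) x - real k * exp_recip (k + 1) x)) (at x)"
      using 2 by (simp add: exp_recip_def)
    then show ?thesis
      by (rule has_field_derivative_transform_within_open[of _ _ _ "{..<0}"])
         (use 2 in \<open>auto simp: exp_recip_def\<close>)
  next
    case 3
    have "((\<lambda>h. (exp_recip k (0 + h) - exp_recip k 0) / h) \<longlongrightarrow> 0) (at 0)"
    proof (rule Lim_transform_eventually[OF exp_recip_tendsto_0[of "k + 1"]])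
      show "\<forall>\<^sub>F h in at 0. exp_recip (k + 1) h = (exp_recip k (0 + h) - exp_recip k 0) / h"
        by (auto simp: exp_recip_def eventually_at_filter field_simps)
    qed
    then show ?thesis
      using 3 by (simp add: DERIV_def exp_recip_def)
  qed
qed

text \<open>
An algebra of functions that is closed under differentiation, whence all its members are smooth.
It contains the dilates and translates of $e^{-1/x} x^{-k}$, extended by zero to $x \<le> 0$.
\<close>

inductive_set flat_alg :: "(real \<Rightarrow> complex) set" where
  base: "(\<lambda>x. of_real (exp_recip k (p * x + q))) \<in> flat_alg"
| scale: "f \<in> flat_alg \<Longrightarrow> (\<lambda>x. c * f x) \<in> flat_alg"
| add: "f \<in> flat_alg \<Longrightarrow> g \<in> flat_alg \<Longrightarrow> (\<lambda>x. f x + g x) \<in> flat_alg"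
| mult: "f \<in> flat_alg \<Longrightarrow> g \<in> flat_alg \<Longrightarrow> (\<lambda>x. f x * g x) \<in> flat_alg"

lemma flat_alg_deriv:
  "f \<in> flat_alg \<Longrightarrow> \<exists>f'\<in>flat_alg. \<forall>x. (f has_vector_derivative f' x) (at x)"
proof (induction rule: flat_alg.induct)
  case (base k p q)
  define g where "g = (\<lambda>x. of_real p * (complex_of_real (exp_recip (k + 2) (p * x + q)) +
      (- of_real (real k)) * complex_of_real (exp_recip (k + 1) (p * x + q))))"
  have "g \<in> flat_alg"
    unfolding g_def by (intro flat_alg.intros)
  moreover have "((\<lambda>x. complex_of_real (exp_recip k (p * x + q))) has_vector_derivative g x) (at x)" for x
  proof -
    have "((\<lambda>x. exp_recip k (p * x + q)) has_real_derivative
       (exp_recip (k + 2) (p * x + q) - real k * exp_recip (k + 1) (p * x + q)) * p) (at x)"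
      by (rule DERIV_chain2[OF exp_recip_has_derivative]) (auto intro!: derivative_eq_intros)
    then have "((\<lambda>x. complex_of_real (exp_recip k (p * x + q))) has_vector_derivative
       of_real ((exp_recip (k + 2) (p * x + q) - real k * exp_recip (k + 1) (p * x + q)) * p)) (at x)"
      by (intro has_vector_derivative_of_real)
    then show ?thesis by (simp add: g_def algebra_simps)
  qed
  ultimately show ?case by blast
next
  case (scale f c)
  then obtain f' where f': "f' \<in> flat_alg" "\<forall>x. (f has_vector_derivative f' x) (at x)" by blast
  then show ?case
    by (intro bexI[of _ "\<lambda>x. c * f' x"]) (auto intro!: flat_alg.intros has_vector_derivative_mult_right)
next
  case (add f g)
  then obtain f' g' where f': "f' \<in> flat_alg" "\<forall>x. (f has_vector_derivative f' x) (at x)"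
     and g': "g' \<in> flat_alg" "\<forall>x. (g has_vector_derivative g' x) (at x)" by blast
  then show ?case
    by (intro bexI[of _ "\<lambda>x. f' x + g' x"]) (auto intro!: flat_alg.intros has_vector_derivative_add)
next
  case (mult f g)
  then obtain f' g' where f': "f' \<in> flat_alg" "\<forall>x. (f has_vector_derivative f' x) (at x)"
     and g': "g' \<in> flat_alg" "\<forall>x. (g has_vector_derivative g' x) (at x)" by blast
  then show ?case using mult.hyps
    by (intro bexI[of _ "\<lambda>x. f x * g' x + f' x * g x"]) (auto intro!: flat_alg.intros has_vector_derivative_mult)
qed

lemma vderiv_Suc: "vderiv (Suc n) f = vderiv n (\<lambda>x. vector_derivative f (at x))"
  by (simp add: vderiv_def funpow_Suc_right del: funpow.simps)

lemma vderiv_0: "vderiv 0 f = f"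
  by (simp add: vderiv_def)

lemma vderiv_Suc_has:
  assumes "\<And>x. (f has_vector_derivative f' x) (at x)"
  shows "vderiv (Suc n) f = vderiv n f'"
proof -
  have "(\<lambda>x. vector_derivative f (at x)) = f'"
    using assms by (auto intro!: vector_derivative_at)
  then show ?thesis by (simp add: vderiv_Suc)
qed

lemma flat_alg_differentiable:
  assumes "f \<in> flat_alg" shows "f differentiable_on S"
proof -
  obtain f' where "\<And>x. (f has_vector_derivative f' x) (at x)"
    using flat_alg_deriv[OF assms] by blast
  then have "f differentiable at x within S" for x
    by (meson differentiableI_vector has_vector_derivative_at_within)
  then show ?thesis by (simp add: differentiable_on_def)
qed

lemma vderiv_flat_alg: "f \<in> flat_alg \<Longrightarrow> vderiv n f \<in> flat_alg"
proof (induction n arbitrary: f)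
  case (Suc n)
  then show ?case by (metis flat_alg_deriv vderiv_Suc_has)
qed (simp add: vderiv_0)

lemma flat_alg_continuous: "f \<in> flat_alg \<Longrightarrow> continuous_on S f"
  by (simp add: differentiable_imp_continuous_on flat_alg_differentiable)

lemma test_fun_flat_alg:
  assumes "f \<in> flat_alg" "a < c" "d < b" "\<And>x. x \<notin> {c..d} \<Longrightarrow> f x = 0"
  shows "test_fun a b f"
  unfolding test_fun_def
proof
  show "\<forall>n. vderiv n f differentiable_on UNIV"
    by (simp add: assms(1) flat_alg_differentiable vderiv_flat_alg)
  have "closure {x. f x \<noteq> 0} \<subseteq> {c..d}"
  proof (rule closure_minimal)
    show "{x. f x \<noteq> 0} \<subseteq> {c..d}" using assms(4) by blast
  qed simp
  then show "closure {x. f x \<noteq> 0} \<subseteq> {a<..<b}"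
    using assms(2,3) by force
qed

text \<open>
Since $e^{-1/(n y)}$ tends to 1 for $y > 0$ as $n$ grows, these functions tend to the indicator of the
interval boundedly and pointwise.  This makes a normalization or a quotient of exponentials
superfluous.
\<close>

definition bump :: "real \<Rightarrow> real \<Rightarrow> nat \<Rightarrow> real \<Rightarrow> complex" where
  "bump c d n x = of_real (exp_recip 0 (real n * (x - c)) * exp_recip 0 (real n * (d - x)))"

lemma bump_flat_alg: "bump c d n \<in> flat_alg"
proof -
  have "bump c d n = (\<lambda>x. complex_of_real (exp_recip 0 (real n * x + (- (real n * c))))
     * complex_of_real (exp_recip 0 ((- real n) * x + real n * d)))"
    by (auto simp: bump_def algebra_simps)
  then show ?thesis by (simp only:) (intro flat_alg.intros)
qed

lemma bump_zero: "x \<notin> {c<..<d} \<Longrightarrow> bump c d n x = 0"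
  by (cases "n = 0") (auto simp: bump_def exp_recip_def zero_less_mult_iff)

lemma bump_le_1: "norm (bump c d n x) \<le> 1"
proof -
  have "0 \<le> exp_recip 0 y \<and> exp_recip 0 y \<le> 1" for y
    by (auto simp: exp_recip_def)
  then show ?thesis
    by (simp add: bump_def norm_mult mult_le_one)
qed

lemma exp_recip_0_tendsto: "y > 0 \<Longrightarrow> (\<lambda>n. exp_recip 0 (real n * y)) \<longlonglongrightarrow> 1"
proof -
  assume y: "y > 0"
  have "(\<lambda>n. exp (- (1 / y) * (1 / real n))) \<longlonglongrightarrow> exp (- (1 / y) * 0)"
    by (intro tendsto_intros lim_const_over_n)
  then have "(\<lambda>n. exp (- (1 / y) * (1 / real n))) \<longlonglongrightarrow> 1" by simp
  then show ?thesis
  proof (rule Lim_transform_eventually)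
    show "\<forall>\<^sub>F n in sequentially. exp (- (1 / y) * (1 / real n)) = exp_recip 0 (real n * y)"
      using eventually_gt_at_top[of "0::nat"]
      by eventually_elim (use y in \<open>auto simp: exp_recip_def field_simps\<close>)
  qed
qed

lemma bump_tendsto: "(\<lambda>n. bump c d n x) \<longlonglongrightarrow> indicator {c<..<d} x"
proof (cases "x \<in> {c<..<d}")
  case True
  then have "(\<lambda>n. complex_of_real (exp_recip 0 (real n * (x - c)) * exp_recip 0 (real n * (d - x)))) \<longlonglongrightarrow> of_real (1 * 1)"
    by (intro tendsto_of_real tendsto_mult exp_recip_0_tendsto) auto
  then show ?thesis using True by (simp add: bump_def)
next
  case False
  then show ?thesis by (simp add: bump_zero)
qed

lemma test_fun_bump:
  assumes "a < c" "d < b" shows "test_fun a b (bump c d n)"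
  by (rule test_fun_flat_alg[OF bump_flat_alg assms]) (auto simp: bump_zero)

section \<open>The lemma of du Bois-Reymond\<close>

abbreviation Leb :: "real \<Rightarrow> real \<Rightarrow> real measure" where
  "Leb a b \<equiv> lebesgue_on {a<..<b}"

lemma finite_measure_Leb: "finite_measure (Leb a b)"
proof
  show "emeasure (Leb a b) (space (Leb a b)) \<noteq> \<infinity>"
    by (cases "a \<le> b") (auto simp: emeasure_restrict_space)
qed

lemma continuous_measurable_Leb:
  fixes f :: "real \<Rightarrow> 'a::euclidean_space"
  shows "continuous_on {a<..<b} f \<Longrightarrow> f \<in> borel_measurable (Leb a b)"
  by (rule continuous_imp_measurable_on_sets_lebesgue) auto

lemma L2_measurable: "L2 a b f \<Longrightarrow> f \<in> borel_measurable (Leb a b)"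
  by (simp add: L2_def)

lemma L2_integrable:
  assumes "L2 a b f" shows "integrable (Leb a b) f"
proof (rule Bochner_Integration.integrable_bound)
  interpret finite_measure "Leb a b" by (rule finite_measure_Leb)
  show "integrable (Leb a b) (\<lambda>x. 1 + (cmod (f x))\<^sup>2)"
    using assms by (intro Bochner_Integration.integrable_add) (auto simp: L2_def)
  show "f \<in> borel_measurable (Leb a b)" using assms by (simp add: L2_def)
  have "t \<le> 1 + t\<^sup>2" for t :: real
    using sum_power2_ge_zero[of "t - 1" 0] zero_le_power2[of "t+1"] by (auto simp: power2_eq_square algebra_simps)
  then show "AE x in Leb a b. norm (f x) \<le> norm (1 + (cmod (f x))\<^sup>2)"
    by (auto intro!: AE_I2 order_trans[OF _ abs_ge_self])
qed

lemma integrable_mult_bounded: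
  fixes h g :: "real \<Rightarrow> complex"
  assumes "integrable (Leb a b) h" "g \<in> borel_measurable (Leb a b)" "\<And>x. x \<in> {a<..<b} \<Longrightarrow> norm (g x) \<le> B"
  shows "integrable (Leb a b) (\<lambda>x. h x * g x)"
proof (rule Bochner_Integration.integrable_bound)
  show "integrable (Leb a b) (\<lambda>x. B * norm (h x))" using assms by auto
  show "(\<lambda>x. h x * g x) \<in> borel_measurable (Leb a b)" using assms by measurable
  show "AE x in Leb a b. norm (h x * g x) \<le> norm (B * norm (h x))"
    using assms(3) 
    by (auto intro!: AE_I2 order_trans[OF _ abs_ge_self] simp: norm_mult mult.commute mult_right_mono)
qed

lemma integrable_mult_continuous:
  fixes h g :: "real \<Rightarrow> complex"
  assumes "integrable (Leb a b) h" "continuous_on {a..b} g"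
  shows "integrable (Leb a b) (\<lambda>x. h x * g x)"
proof -
  have "bounded (g ` {a..b})"
    by (rule compact_imp_bounded[OF compact_continuous_image[OF assms(2)]]) auto
  then obtain B where "\<forall>y \<in> g ` {a..b}. norm y \<le> B"
    unfolding bounded_iff by blast
  then show ?thesis
    using assms
    by (intro integrable_mult_bounded[where B=B] continuous_measurable_Leb)
       (auto intro: continuous_on_subset)
qed

lemma continuous_integrable_Leb:
  assumes "continuous_on {a..b} (g :: real \<Rightarrow> complex)"
  shows "integrable (Leb a b) g"
proof -
  interpret finite_measure "Leb a b" by (rule finite_measure_Leb)
  show ?thesis
    using integrable_mult_continuous[OF _ assms, of "\<lambda>_. 1"] by simp
qed

lemma LINT_bump_tendsto:
  fixes h :: "real \<Rightarrow> complex"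
  assumes "integrable (Leb a b) h"
  shows "(\<lambda>n. LINT x|Leb a b. h x * bump c d n x) \<longlonglongrightarrow> (LINT x|Leb a b. h x * indicator {c<..<d} x)"
proof (rule integral_dominated_convergence[where w = "\<lambda>x. norm (h x)"])
  have [measurable]: "(\<lambda>x. indicator {c<..<d} x :: complex) \<in> borel_measurable (Leb a b)"
    by (intro measurable_restrict_space1 borel_measurable_indicator) simp
  show "(\<lambda>x. h x * indicator {c<..<d} x) \<in> borel_measurable (Leb a b)"
    using assms by measurable
  show "(\<lambda>x. h x * bump c d n x) \<in> borel_measurable (Leb a b)" for n
    by (rule borel_measurable_times) (use assms in \<open>auto intro!: continuous_measurable_Leb flat_alg_continuous bump_flat_alg\<close>)
  show "AE x in Leb a b. (\<lambda>n. h x * bump c d n x) \<longlonglongrightarrow> h x * indicator {c<..<d} x"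
    by (intro AE_I2 tendsto_mult tendsto_const bump_tendsto)
  show "AE x in Leb a b. norm (h x * bump c d n x) \<le> norm (h x)" for n
    by (intro AE_I2) (simp add: norm_mult mult_left_le bump_le_1)
qed (use assms in auto)

lemma AE_Leb_iff: "(AE x in Leb a b. P x) \<longleftrightarrow> (AE x in lebesgue. x \<in> {a<..<b} \<longrightarrow> P x)"
  by (rule AE_restrict_space_iff) auto

text \<open>
In the limit the bumps become indicators, so all integrals over small intervals vanish; by the
differentiation theorem the averages recover the function at almost every point.
\<close>

lemma AE_zero_if_orthogonal_bumps:
  fixes h :: "real \<Rightarrow> complex"
  assumes h: "integrable (Leb a b) h"
    and z: "\<And>c d n. a < c \<Longrightarrow> c < d \<Longrightarrow> d < b \<Longrightarrow> (LINT x|Leb a b. h x * bump c d n x) = 0"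
  shows "AE x in Leb a b. h x = 0"
proof -
  have int0: "(LINT x|Leb a b. h x * indicator {c<..<d} x) = 0" if "a < c" "c < d" "d < b" for c d
    using LIMSEQ_unique[OF LINT_bump_tendsto[OF h, of c d]] z[OF that] by simp
  define F where "F x = indicator {a<..<b} x *\<^sub>R h x" for x
  have Fi: "integrable lebesgue F"
    using h unfolding F_def by (subst (asm) integrable_restrict_space) auto
  have Fc: "F integrable_on cbox c d" for c d
    using integrable_on_lebesgue[OF Fi] integrable_on_subcbox by blast
  have F0: "integral {c..d} F = 0" if "a < c" "c < d" "d < b" for c d
  proof -
    have "integrable (lebesgue_on {c<..<d}) F"
      using Fi integrable_mult_indicator[of "{c<..<d}" lebesgue F] by (subst integrable_restrict_space) auto
    then have "integral {c<..<d} F = integral\<^sup>L (lebesgue_on {c<..<d}) F"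
      by (simp add: lebesgue_integral_eq_integral)
    also have "\<dots> = (LINT x|lebesgue. indicator {c<..<d} x *\<^sub>R F x)"
      by (rule integral_restrict_space) auto
    also have "\<dots> = (LINT x|lebesgue. indicator {a<..<b} x *\<^sub>R (h x * indicator {c<..<d} x))"
      by (rule Bochner_Integration.integral_cong) (use that in \<open>auto simp: F_def indicator_def\<close>)
    also have "\<dots> = (LINT x|Leb a b. h x * indicator {c<..<d} x)"
      by (rule integral_restrict_space[symmetric]) auto
    finally show ?thesis using int0[OF that] by (simp add: integral_open_interval_real)
  qed
  obtain N where N: "negligible N" and
    lim: "\<And>x e. x \<notin> N \<Longrightarrow> 0 < e \<Longrightarrow> \<exists>d>0. \<forall>h. 0 < h \<and> h < d \<longrightarrow>
       norm (integral (cbox x (x + h *\<^sub>R One)) F /\<^sub>R h ^ DIM(real) - F x) < e"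
    using integrable_ccontinuous_explicit[of F] Fc by blast
  have "h x = 0" if "x \<notin> N" "x \<in> {a<..<b}" for x
  proof (rule ccontr)
    assume "h x \<noteq> 0"
    then have "norm (F x) > 0" using that by (simp add: F_def)
    then obtain d where d: "d > 0" "\<And>h. 0 < h \<Longrightarrow> h < d \<Longrightarrow>
       norm (integral (cbox x (x + h *\<^sub>R One)) F /\<^sub>R h ^ DIM(real) - F x) < norm (F x)"
      using lim[OF \<open>x \<notin> N\<close>] by blast
    define k where "k = min d (b - x) / 2"
    have k: "0 < k" "k < d" "x + k < b" using d that by (auto simp: k_def min_def field_simps)
    have "integral {x..x+k} F = 0" using F0[of x "x+k"] k that by simp
    then show False using d(2)[OF k(1,2)] by simp
  qed
  moreover have "AE x in lebesgue. x \<notin> N"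
    using N by (simp add: AE_not_in negligible_iff_null_sets)
  ultimately show ?thesis by (auto simp: AE_Leb_iff)
qed

text \<open>
A compactly supported primitive exists exactly when the mean is zero; this is where the constant in
the lemma of du Bois-Reymond comes from.
\<close>

lemma test_fun_antiderivative:
  assumes th: "\<theta> \<in> flat_alg" "a < c" "c \<le> d" "d < b" "\<And>x. x \<notin> {c..d} \<Longrightarrow> \<theta> x = 0"
    and z: "(LINT x|Leb a b. \<theta> x) = 0"
  obtains \<phi> where "test_fun a b \<phi>" "vderiv (Suc 0) \<phi> = \<theta>"
proof -
  define \<phi> where "\<phi> x = integral {a..x} \<theta>" for x
  have cont: "continuous_on S \<theta>" for S by (rule flat_alg_continuous[OF th(1)])
  have inte: "\<theta> integrable_on {x..y}" for x y
    by (rule integrable_continuous_real[OF cont])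
  have tot: "integral {a..b} \<theta> = 0"
  proof -
    have "integral {a<..<b} \<theta> = (LINT x|Leb a b. \<theta> x)"
      by (rule lebesgue_integral_eq_integral[symmetric]) (simp_all add: continuous_integrable_Leb cont)
    then show ?thesis using z by (simp add: integral_open_interval_real)
  qed
  have left: "\<phi> x = 0" if "x < c" for x
  proof -
    have "\<phi> x = integral {a..x} (\<lambda>_. 0)"
      unfolding \<phi>_def by (rule Henstock_Kurzweil_Integration.integral_cong) (use th(5) that in auto)
    then show ?thesis by simp
  qed
  have right: "\<phi> x = 0" if "x > d" for x
  proof -
    have *: "integral {d..y} \<theta> = 0" for y
    proof -
      have "integral {d..y} \<theta> = integral {d..y} (\<lambda>_. 0)"
        by (rule integral_spike[of "{d}"]) (use th(5) in auto)
      then show ?thesis by simp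
    qed
    have "integral {a..d} \<theta> + integral {d..y} \<theta> = integral {a..y} \<theta>" if "y \<ge> d" for y
      using th(2,3) that by (intro Henstock_Kurzweil_Integration.integral_combine inte) auto
    from this[of x] this[of b] show ?thesis using * tot th(4) that by (simp add: \<phi>_def)
  qed
  have deriv: "(\<phi> has_vector_derivative \<theta> x) (at x)" for x
  proof (cases "x < c")
    case True
    have "((\<lambda>_. 0) has_vector_derivative 0) (at x)" by simp
    then have "(\<phi> has_vector_derivative 0) (at x)"
      by (rule has_vector_derivative_transform_within_open[of _ _ _ "{..<c}"]) (use True left in auto)
    then show ?thesis using th(5)[of x] True by simp
  next
    case False
    have "((\<lambda>u. integral {a..u} \<theta>) has_vector_derivative \<theta> x) (at x within {a..x+1})"
      by (rule integral_has_vector_derivative[OF cont]) (use False th(2) in auto)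
    then have "(\<phi> has_vector_derivative \<theta> x) (at x within {a..x+1})"
      by (simp add: \<phi>_def[abs_def])
    then show ?thesis
      using False th(2) by (subst (asm) at_within_interior) auto
  qed
  have vd: "vderiv (Suc n) \<phi> = vderiv n \<theta>" for n
    by (rule vderiv_Suc_has[OF deriv])
  have "vderiv n \<phi> differentiable_on UNIV" for n
  proof (cases n)
    case 0
    have "\<phi> differentiable at x" for x using deriv differentiableI_vector by blast
    then show ?thesis using 0 by (simp add: vderiv_0 differentiable_on_def)
  next
    case (Suc m)
    then show ?thesis by (simp add: vd flat_alg_differentiable vderiv_flat_alg th(1))
  qed
  moreover have "closure {x. \<phi> x \<noteq> 0} \<subseteq> {c..d}"
  proof (rule closure_minimal)
    show "{x. \<phi> x \<noteq> 0} \<subseteq> {c..d}" using left right by (force simp: not_le[symmetric])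
  qed simp
  ultimately have "test_fun a b \<phi>" using th(2,4) by (force simp: test_fun_def)
  moreover have "vderiv (Suc 0) \<phi> = \<theta>" by (simp add: vd vderiv_0)
  ultimately show ?thesis using that by blast
qed

text \<open>
Subtracting from a bump the right multiple of one fixed bump gives mean zero, hence the derivative of
a test function.  Testing with it shows that \<open>h - \<kappa>\<close> is orthogonal to every bump, where \<open>\<kappa>\<close> is the
average of \<open>h\<close> against the fixed bump.
\<close>

lemma du_Bois_Reymond:
  fixes h :: "real \<Rightarrow> complex"
  assumes ab: "a < b" and h: "integrable (Leb a b) h"
    and z: "\<And>\<phi>. test_fun a b \<phi> \<Longrightarrow> (LINT x|Leb a b. h x * vderiv (Suc 0) \<phi> x) = 0"
  shows "\<exists>\<kappa>. AE x in Leb a b. h x = \<kappa>"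
proof -
  interpret finite_measure "Leb a b" by (rule finite_measure_Leb)
  \<comment> \<open>Any fixed interval inside $(a,b)$ would do; its bump is the reference for the mean.\<close>
  define c0 d0 where "c0 = (2*a + b)/3" and "d0 = (a + 2*b)/3"
  have cd: "a < c0" "c0 < d0" "d0 < b" using ab by (auto simp: c0_def d0_def field_simps)
  have bi: "integrable (Leb a b) (bump c d n)" for c d n
    by (intro continuous_integrable_Leb flat_alg_continuous bump_flat_alg)
  have hbi: "integrable (Leb a b) (\<lambda>x. h x * bump c d n x)" for c d n
    by (intro integrable_mult_continuous h flat_alg_continuous bump_flat_alg)
  have "\<exists>n. (LINT x|Leb a b. bump c0 d0 n x) \<noteq> 0"
  proof (rule ccontr)
    assume "\<not> ?thesis"
    then have "(LINT x|Leb a b. indicator {c0<..<d0} x) = (0::complex)"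
      using LIMSEQ_unique[OF LINT_bump_tendsto[of a b "\<lambda>_. 1" c0 d0]] by simp
    moreover have "(LINT x|Leb a b. indicator {c0<..<d0} x) = complex_of_real (d0 - c0)"
    proof -
      have "(LINT x|Leb a b. indicator {c0<..<d0} x) = complex_of_real (LINT x|Leb a b. indicator {c0<..<d0} x)"
      proof -
        have "(indicator {c0<..<d0} :: real \<Rightarrow> complex) = (\<lambda>x. complex_of_real (indicator {c0<..<d0} x))"
          by (auto simp: indicator_def)
        then show ?thesis by (simp only: integral_complex_of_real)
      qed
      also have "(LINT x|Leb a b. indicator {c0<..<d0} x) = measure (Leb a b) {c0<..<d0}"
        using cd by (subst Bochner_Integration.integral_indicator) (auto intro!: arg_cong[where f = "measure (Leb a b)"])
      also have "\<dots> = d0 - c0" using cd by (subst measure_restrict_space) auto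
      finally show ?thesis .
    qed
    ultimately show False using cd by simp
  qed
  then obtain n0 where n0: "(LINT x|Leb a b. bump c0 d0 n0 x) \<noteq> 0" by blast
  define m \<kappa> where "m = (LINT x|Leb a b. bump c0 d0 n0 x)" and "\<kappa> = (LINT x|Leb a b. h x * bump c0 d0 n0 x) / m"
  have "AE x in Leb a b. h x - \<kappa> = 0"
  proof (rule AE_zero_if_orthogonal_bumps)
    show "integrable (Leb a b) (\<lambda>x. h x - \<kappa>)" using h by auto
    fix c d n assume cd': "a < c" "c < d" "d < b"
    define q where "q = (LINT x|Leb a b. bump c d n x) / m"
    define \<theta> where "\<theta> x = bump c d n x + (- q) * bump c0 d0 n0 x" for x
    have "\<theta> \<in> flat_alg" unfolding \<theta>_def[abs_def] by (intro flat_alg.intros bump_flat_alg)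
    moreover have "(LINT x|Leb a b. \<theta> x) = 0"
      unfolding \<theta>_def using bi n0 by (simp add: q_def m_def)
    moreover have "\<theta> x = 0" if "x \<notin> {min c c0..max d d0}" for x
    proof -
      have "x \<notin> {c<..<d}" "x \<notin> {c0<..<d0}" using that by (auto simp: min_le_iff_disj le_max_iff_disj)
      then show ?thesis by (simp add: \<theta>_def bump_zero)
    qed
    moreover have "a < min c c0" "min c c0 \<le> max d d0" "max d d0 < b" using cd cd' by auto
    ultimately obtain \<phi> where "test_fun a b \<phi>" "vderiv (Suc 0) \<phi> = \<theta>"
      by (metis test_fun_antiderivative)
    then have "0 = (LINT x|Leb a b. h x * \<theta> x)" using z by metis
    also have "\<dots> = (LINT x|Leb a b. h x * bump c d n x - q * (h x * bump c0 d0 n0 x))"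
      by (simp add: \<theta>_def algebra_simps)
    also have "\<dots> = (LINT x|Leb a b. h x * bump c d n x) - q * (LINT x|Leb a b. h x * bump c0 d0 n0 x)"
      using hbi by simp
    also have "\<dots> = (LINT x|Leb a b. (h x - \<kappa>) * bump c d n x)"
      using hbi bi by (simp add: left_diff_distrib q_def \<kappa>_def)
    finally show "(LINT x|Leb a b. (h x - \<kappa>) * bump c d n x) = 0" by simp
  qed
  then show ?thesis by auto
qed

section \<open>Integration by parts against test functions\<close>

lemma test_fun_has_derivative:
  assumes "test_fun a b \<phi>"
  shows "(\<phi> has_vector_derivative vderiv (Suc 0) \<phi> x) (at x)"
proof -
  have "vderiv 0 \<phi> differentiable_on UNIV" using assms unfolding test_fun_def by blast
  then have "\<phi> differentiable (at x)" by (simp add: vderiv_0 differentiable_on_def)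
  then show ?thesis
    by (simp add: vderiv_Suc vderiv_0 vector_derivative_works)
qed

lemma test_fun_continuous:
  assumes "test_fun a b \<phi>" shows "continuous_on S (vderiv n \<phi>)"
  using assms unfolding test_fun_def
  by (meson continuous_on_subset differentiable_imp_continuous_on subset_UNIV)

lemma test_fun_zero: "test_fun a b \<phi> \<Longrightarrow> x \<notin> {a<..<b} \<Longrightarrow> \<phi> x = 0"
  unfolding test_fun_def using closure_subset[of "{x. \<phi> x \<noteq> 0}"] by blast

lemma vderiv_add: "vderiv m (vderiv n f) = vderiv (n + m) f"
  by (simp add: vderiv_def funpow_add add.commute[of n m])

lemma test_fun_vderiv_1:
  assumes "test_fun a b \<phi>" shows "test_fun a b (vderiv (Suc 0) \<phi>)"
  unfolding test_fun_def
proof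
  show "\<forall>n. vderiv n (vderiv (Suc 0) \<phi>) differentiable_on UNIV"
    using assms by (simp add: vderiv_add test_fun_def)
  let ?S = "closure {x. \<phi> x \<noteq> 0}"
  have "{x. vderiv (Suc 0) \<phi> x \<noteq> 0} \<subseteq> ?S"
  proof (rule subsetI, rule ccontr)
    fix x assume x: "x \<in> {x. vderiv (Suc 0) \<phi> x \<noteq> 0}" "x \<notin> ?S"
    have "((\<lambda>_. 0) has_vector_derivative (0::complex)) (at x)" by simp
    then have "(\<phi> has_vector_derivative 0) (at x)"
    proof (rule has_vector_derivative_transform_within_open[of _ _ _ "- ?S"])
      show "\<And>y. y \<in> - ?S \<Longrightarrow> 0 = \<phi> y" using closure_subset[of "{x. \<phi> x \<noteq> 0}"] by fastforce
    qed (use x in auto)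
    then show False
      using x(1) vector_derivative_unique_at[OF test_fun_has_derivative[OF assms]] by simp
  qed
  then have "closure {x. vderiv (Suc 0) \<phi> x \<noteq> 0} \<subseteq> ?S" by (rule closure_minimal) simp
  then show "closure {x. vderiv (Suc 0) \<phi> x \<noteq> 0} \<subseteq> {a<..<b}"
    using assms by (auto simp: test_fun_def)
qed

lemma test_fun_vderiv:
  assumes "test_fun a b \<phi>" shows "test_fun a b (vderiv n \<phi>)"
proof (induction n)
  case (Suc n)
  then show ?case using test_fun_vderiv_1[OF Suc] by (simp add: vderiv_add)
qed (simp add: vderiv_0 assms)

lemma LINT_Leb_eq_integral:
  assumes "integrable (Leb a b) (g :: real \<Rightarrow> 'a::euclidean_space)"
  shows "(LINT x|Leb a b. g x) = integral {a..b} g"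
  using assms by (simp add: lebesgue_integral_eq_integral integral_open_interval_real)

lemma integrable_on_Leb:
  assumes g: "integrable (Leb a b) (g :: real \<Rightarrow> 'a::euclidean_space)" and "a \<le> c" "d \<le> b"
  shows "g integrable_on {c..d}"
proof -
  have "g integrable_on {a<..<b}" using integrable_on_lebesgue_on[OF g] by simp
  then have "g integrable_on {a..b}" by (simp add: integrable_on_open_interval_real)
  then show ?thesis by (rule integrable_subinterval_real) (use assms in auto)
qed

lemma AE_Leb_negligible:
  assumes "AE x in Leb a b. P x"
  obtains N where "negligible N" "\<And>x. x \<in> {a..b} \<Longrightarrow> x \<notin> N \<Longrightarrow> P x"
proof -
  have "AE x in lebesgue. x \<in> {a<..<b} \<longrightarrow> P x" using assms by (simp only: AE_Leb_iff)
  then have "\<exists>N\<in>null_sets lebesgue. {x \<in> space lebesgue. \<not> (x \<in> {a<..<b} \<longrightarrow> P x)} \<subseteq> N"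
    by (simp only: eventually_ae_filter)
  then obtain N where N: "N \<in> null_sets lebesgue" "{x \<in> space lebesgue. \<not> (x \<in> {a<..<b} \<longrightarrow> P x)} \<subseteq> N"
    by (rule bexE)
  have "negligible N" using N(1) by (simp add: negligible_iff_null_sets)
  then have n: "negligible (N \<union> {a, b})" by (rule negligible_Un) (simp add: negligible_finite)
  show ?thesis
  proof (rule that[OF n])
    fix x assume x: "x \<in> {a..b}" "x \<notin> N \<union> {a, b}"
    then have "a < x" "x < b" by auto
    then show "P x" using N(2) x(2) by auto
  qed
qed

lemma integral_cong_AE_Leb:
  assumes "AE x in Leb a b. f x = (g x :: 'a::euclidean_space)" "a \<le> c" "d \<le> b"
  shows "integral {c..d} f = integral {c..d} g"
proof -
  obtain N where "negligible N" "\<And>x. x \<in> {a..b} \<Longrightarrow> x \<notin> N \<Longrightarrow> f x = g x"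
    using AE_Leb_negligible[OF assms(1)] by blast
  then show ?thesis using assms(2,3) by (intro integral_spike[of N]) auto
qed

text \<open>
Fubini's theorem on the triangle $y < x$, applied to $g(y) \<phi>'(x)$; the inner integral over $x$ is
$-\<phi>(y)$ because a test function vanishes at $b$.
\<close>

lemma primitive_by_parts:
  assumes ab: "a < b" and g: "integrable (Leb a b) (g :: real \<Rightarrow> complex)" and \<phi>: "test_fun a b \<phi>"
  shows "(LINT x|Leb a b. integral {a..x} g * vderiv (Suc 0) \<phi> x) = - (LINT x|Leb a b. g x * \<phi> x)"
proof -
  interpret finite_measure "Leb a b" by (rule finite_measure_Leb)
  interpret pair_sigma_finite "Leb a b" "Leb a b" by unfold_locales
  let ?p = "vderiv (Suc 0) \<phi>"
  define H where "H x y = indicator {y<..} x *\<^sub>R (g y * ?p x)" for x y :: real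
  have pc: "continuous_on S ?p" for S by (rule test_fun_continuous[OF \<phi>])
  have "bounded (?p ` {a..b})"
    by (rule compact_imp_bounded[OF compact_continuous_image[OF pc]]) auto
  then obtain B where B: "\<forall>z \<in> ?p ` {a..b}. norm z \<le> B" unfolding bounded_iff by blast
  have m1: "(\<lambda>z. g (snd z)) \<in> borel_measurable (Leb a b \<Otimes>\<^sub>M Leb a b)"
    by (rule measurable_compose[OF measurable_snd]) (use g in auto)
  have m2: "(\<lambda>z. ?p (fst z)) \<in> borel_measurable (Leb a b \<Otimes>\<^sub>M Leb a b)"
    by (rule measurable_compose[OF measurable_fst]) (intro continuous_measurable_Leb pc)
  have id: "(\<lambda>x. x) \<in> borel_measurable (Leb a b)" by (intro continuous_measurable_Leb continuous_on_id)
  have "(\<lambda>z. (\<lambda>x. x) (fst z)) \<in> borel_measurable (Leb a b \<Otimes>\<^sub>M Leb a b)"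
    by (rule measurable_compose[OF measurable_fst[of "Leb a b" "Leb a b"] id])
  then have f1: "(\<lambda>z. fst z) \<in> borel_measurable (Leb a b \<Otimes>\<^sub>M Leb a b)" by simp
  have "(\<lambda>z. (\<lambda>x. x) (snd z)) \<in> borel_measurable (Leb a b \<Otimes>\<^sub>M Leb a b)"
    by (rule measurable_compose[OF measurable_snd[of "Leb a b" "Leb a b"] id])
  then have f2: "(\<lambda>z. snd z) \<in> borel_measurable (Leb a b \<Otimes>\<^sub>M Leb a b)" by simp
  have Hm: "case_prod H \<in> borel_measurable (Leb a b \<Otimes>\<^sub>M Leb a b)"
  proof -
    have "{z \<in> space (Leb a b \<Otimes>\<^sub>M Leb a b). snd z < fst z} \<in> sets (Leb a b \<Otimes>\<^sub>M Leb a b)"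
      by (rule borel_measurable_less[OF f2 f1])
    then have "(\<lambda>z. indicator {z \<in> space (Leb a b \<Otimes>\<^sub>M Leb a b). snd z < fst z} z *\<^sub>R (g (snd z) * ?p (fst z)))
        \<in> borel_measurable (Leb a b \<Otimes>\<^sub>M Leb a b)"
      using m1 m2 by (intro borel_measurable_scaleR borel_measurable_indicator borel_measurable_times)
    then show ?thesis
      by (rule measurable_cong[THEN iffD1, rotated]) (auto simp: H_def indicator_def)
  qed
  have gi: "integrable (Leb a b \<Otimes>\<^sub>M Leb a b) (\<lambda>(x, y). norm (g y) * B)"
    using g by (intro Fubini_integrable) (auto intro!: borel_measurable_times borel_measurable_norm m1 simp: split_beta')
  have Hi: "integrable (Leb a b \<Otimes>\<^sub>M Leb a b) (case_prod H)"
  proof (rule Bochner_Integration.integrable_bound[OF gi Hm])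
    show "AE z in Leb a b \<Otimes>\<^sub>M Leb a b. norm (case_prod H z) \<le> norm (case z of (x, y) \<Rightarrow> norm (g y) * B)"
    proof (rule AE_I2)
      fix z assume "z \<in> space (Leb a b \<Otimes>\<^sub>M Leb a b)"
      then have "fst z \<in> {a..b}" by (auto simp: space_pair_measure)
      then have "norm (?p (fst z)) \<le> B" using B by blast
      then show "norm (case_prod H z) \<le> norm (case z of (x, y) \<Rightarrow> norm (g y) * B)"
        by (auto simp: H_def indicator_def norm_mult split_beta' intro!: order_trans[OF _ abs_ge_self] mult_left_mono)
    qed
  qed
  have swap: "(LINT y|Leb a b. (LINT x|Leb a b. H x y)) = (LINT x|Leb a b. (LINT y|Leb a b. H x y))"
    by (rule Fubini_integral[OF Hi])
  have inner1: "(LINT y|Leb a b. H x y) = integral {a..x} g * ?p x" if x: "x \<in> {a<..<b}" for x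
  proof -
    have "(LINT y|Leb a b. H x y) = (LINT y|Leb a b. (indicator {..<x} y *\<^sub>R g y) * ?p x)"
      by (rule Bochner_Integration.integral_cong) (auto simp: H_def indicator_def)
    also have "\<dots> = (LINT y|Leb a b. indicator {..<x} y *\<^sub>R g y) * ?p x"
      by (rule integral_mult_left_zero)
    also have "(LINT y|Leb a b. indicator {..<x} y *\<^sub>R g y) = (LINT y|lebesgue. indicator {a<..<b} y *\<^sub>R (indicator {..<x} y *\<^sub>R g y))"
      by (rule integral_restrict_space) auto
    also have "\<dots> = (LINT y|lebesgue. indicator {a<..<x} y *\<^sub>R g y)"
      by (rule Bochner_Integration.integral_cong) (use x in \<open>auto simp: indicator_def\<close>)
    also have "\<dots> = (LINT y|Leb a x. g y)"
      by (rule integral_restrict_space[symmetric]) auto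
    also have "\<dots> = integral {a..x} g"
    proof (rule LINT_Leb_eq_integral)
      have "integrable lebesgue (\<lambda>y. indicator {a<..<b} y *\<^sub>R g y)"
        using g by (subst (asm) integrable_restrict_space) auto
      then have "integrable lebesgue (\<lambda>y. indicator {a<..<x} y *\<^sub>R (indicator {a<..<b} y *\<^sub>R g y))"
        by (rule integrable_mult_indicator[rotated]) auto
      also have "(\<lambda>y. indicator {a<..<x} y *\<^sub>R (indicator {a<..<b} y *\<^sub>R g y)) = (\<lambda>y. indicator {a<..<x} y *\<^sub>R g y)"
        using x by (auto simp: indicator_def)
      finally show "integrable (Leb a x) g" by (subst integrable_restrict_space) auto
    qed
    finally show ?thesis .
  qed
  have inner2: "(LINT x|Leb a b. H x y) = - (g y * \<phi> y)" if y: "y \<in> {a<..<b}" for y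
  proof -
    have "(LINT x|Leb a b. H x y) = (LINT x|Leb a b. g y * (indicator {y<..} x *\<^sub>R ?p x))"
      by (rule Bochner_Integration.integral_cong) (auto simp: H_def indicator_def)
    also have "\<dots> = g y * (LINT x|Leb a b. indicator {y<..} x *\<^sub>R ?p x)"
      by (rule integral_mult_right_zero)
    also have "(LINT x|Leb a b. indicator {y<..} x *\<^sub>R ?p x) = (LINT x|lebesgue. indicator {a<..<b} x *\<^sub>R (indicator {y<..} x *\<^sub>R ?p x))"
      by (rule integral_restrict_space) auto
    also have "\<dots> = (LINT x|lebesgue. indicator {y<..<b} x *\<^sub>R ?p x)"
      by (rule Bochner_Integration.integral_cong) (use y in \<open>auto simp: indicator_def\<close>)
    also have "\<dots> = (LINT x|Leb y b. ?p x)"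
      by (rule integral_restrict_space[symmetric]) auto
    also have "\<dots> = integral {y..b} ?p"
      by (rule LINT_Leb_eq_integral) (intro continuous_integrable_Leb pc)
    also have "\<dots> = \<phi> b - \<phi> y"
      by (rule integral_unique, rule fundamental_theorem_of_calculus)
         (use y in \<open>auto intro: has_vector_derivative_at_within test_fun_has_derivative[OF \<phi>]\<close>)
    also have "\<phi> b = 0" by (rule test_fun_zero[OF \<phi>]) auto
    finally show ?thesis by simp
  qed
  have "(LINT x|Leb a b. integral {a..x} g * ?p x) = (LINT x|Leb a b. (LINT y|Leb a b. H x y))"
    by (rule Bochner_Integration.integral_cong) (auto simp: inner1)
  also have "\<dots> = (LINT y|Leb a b. (LINT x|Leb a b. H x y))" by (rule swap[symmetric])
  also have "\<dots> = (LINT y|Leb a b. - (g y * \<phi> y))"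
    by (rule Bochner_Integration.integral_cong) (auto simp: inner2)
  finally show ?thesis by simp
qed

lemma weak_deriv_1_imp_primitive:
  assumes ab: "a < b" and f: "integrable (Leb a b) (f :: real \<Rightarrow> complex)" and g: "integrable (Leb a b) g"
    and w: "\<And>\<phi>. test_fun a b \<phi> \<Longrightarrow> (LINT x|Leb a b. f x * vderiv (Suc 0) \<phi> x) = - (LINT x|Leb a b. g x * \<phi> x)"
  shows "\<exists>\<kappa>. AE x in Leb a b. f x = \<kappa> + integral {a..x} g"
proof -
  have cG: "continuous_on {a..b} (\<lambda>x. integral {a..x} g)"
    by (rule indefinite_integral_continuous_1) (rule integrable_on_Leb[OF g], auto)
  have "\<exists>\<kappa>. AE x in Leb a b. f x - integral {a..x} g = \<kappa>"
  proof (rule du_Bois_Reymond[OF ab])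
    show "integrable (Leb a b) (\<lambda>x. f x - integral {a..x} g)"
      using f continuous_integrable_Leb[OF cG] by auto
    fix \<phi> assume \<phi>: "test_fun a b \<phi>"
    have i: "integrable (Leb a b) (\<lambda>x. f x * vderiv (Suc 0) \<phi> x)"
       "integrable (Leb a b) (\<lambda>x. integral {a..x} g * vderiv (Suc 0) \<phi> x)"
      by (intro integrable_mult_continuous f continuous_integrable_Leb[OF cG] test_fun_continuous[OF \<phi>])+
    have "(LINT x|Leb a b. (f x - integral {a..x} g) * vderiv (Suc 0) \<phi> x)
       = (LINT x|Leb a b. f x * vderiv (Suc 0) \<phi> x) - (LINT x|Leb a b. integral {a..x} g * vderiv (Suc 0) \<phi> x)"
      unfolding left_diff_distrib by (rule Bochner_Integration.integral_diff[OF i])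
    then show "(LINT x|Leb a b. (f x - integral {a..x} g) * vderiv (Suc 0) \<phi> x) = 0"
      using w[OF \<phi>] primitive_by_parts[OF ab g \<phi>] by simp
  qed
  then obtain \<kappa> where "AE x in Leb a b. f x - integral {a..x} g = \<kappa>" by blast
  then have "AE x in Leb a b. f x = \<kappa> + integral {a..x} g" by eventually_elim (auto simp: algebra_simps)
  then show ?thesis by blast
qed

section \<open>Continuous representatives of Sobolev functions\<close>

lemma L2_add:
  assumes f: "L2 a b f" and g: "L2 a b g" shows "L2 a b (\<lambda>x. f x + g x)"
  unfolding L2_def
proof
  show "(\<lambda>x. f x + g x) \<in> borel_measurable (Leb a b)" using assms by (auto simp: L2_def)
  show "integrable (Leb a b) (\<lambda>x. (cmod (f x + g x))\<^sup>2)"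
  proof (rule Bochner_Integration.integrable_bound)
    show "integrable (Leb a b) (\<lambda>x. 2 * (cmod (f x))\<^sup>2 + 2 * (cmod (g x))\<^sup>2)"
      using assms by (auto simp: L2_def)
    show "(\<lambda>x. (cmod (f x + g x))\<^sup>2) \<in> borel_measurable (Leb a b)" using assms by (auto simp: L2_def)
    have "(cmod (p + q))\<^sup>2 \<le> 2 * (cmod p)\<^sup>2 + 2 * (cmod q)\<^sup>2" for p q
    proof -
      have "(cmod (p + q))\<^sup>2 \<le> (cmod p + cmod q)\<^sup>2" by (intro power_mono norm_triangle_ineq) auto
      also have "\<dots> \<le> 2 * (cmod p)\<^sup>2 + 2 * (cmod q)\<^sup>2"
        using zero_le_power2[of "cmod p - cmod q"] by (simp add: power2_eq_square algebra_simps)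
      finally show ?thesis .
    qed
    then show "AE x in Leb a b. norm ((cmod (f x + g x))\<^sup>2) \<le> norm (2 * (cmod (f x))\<^sup>2 + 2 * (cmod (g x))\<^sup>2)"
      by (intro AE_I2) simp
  qed
qed

lemma L2_scale: "L2 a b f \<Longrightarrow> L2 a b (\<lambda>x. c * f x)"
  unfolding L2_def by (auto simp: norm_mult power_mult_distrib)

lemma L2_continuous:
  assumes "continuous_on {a..b} f" shows "L2 a b f"
proof -
  have "integrable (Leb a b) (\<lambda>x. complex_of_real ((cmod (f x))\<^sup>2))"
    by (intro continuous_integrable_Leb continuous_intros assms)
  then have "integrable (Leb a b) (\<lambda>x. (cmod (f x))\<^sup>2)" 
    using complex_of_real_integrable_eq by blast
  then show ?thesis
    using assms by (auto simp: L2_def intro!: continuous_measurable_Leb intro: continuous_on_subset)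
qed

lemma L2_norm_cong_AE:
  assumes "AE x in Leb a b. f x = g x" "f \<in> borel_measurable (Leb a b)" "g \<in> borel_measurable (Leb a b)"
  shows "L2_norm a b f = L2_norm a b g"
  unfolding L2_norm_def using assms by (intro arg_cong[where f=sqrt] integral_cong_AE) auto

lemma L2_norm_nonneg [simp]: "0 \<le> L2_norm a b f"
  by (simp add: L2_norm_def)

lemma L2_norm_power2: "(L2_norm a b f)\<^sup>2 = (LINT x|Leb a b. (cmod (f x))\<^sup>2)"
  by (simp add: L2_norm_def)

lemma L1_le_L2:
  assumes ab: "a < b" and f: "L2 a b f"
  shows "integral {a..b} (\<lambda>x. cmod (f x)) \<le> sqrt (b - a) * L2_norm a b f"
proof -
  interpret finite_measure "Leb a b" by (rule finite_measure_Leb)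
  have i1: "integrable (Leb a b) (\<lambda>x. cmod (f x))" using L2_integrable[OF f] by auto
  have i2: "integrable (Leb a b) (\<lambda>x. (cmod (f x))\<^sup>2)" using f by (simp add: L2_def)
  define m where "m = (LINT x|Leb a b. cmod (f x)) / (b - a)"
  have L: "(LINT x|Leb a b. 1) = b - a"
    using ab by (simp add: measure_restrict_space)
  have "0 \<le> (LINT x|Leb a b. (cmod (f x) - m)\<^sup>2)"
    by (rule Bochner_Integration.integral_nonneg) auto
  also have "\<dots> = (LINT x|Leb a b. (cmod (f x))\<^sup>2 - 2 * m * cmod (f x) + m\<^sup>2 * 1)"
    by (rule Bochner_Integration.integral_cong) (auto simp: power2_eq_square algebra_simps)
  also have "\<dots> = (L2_norm a b f)\<^sup>2 - 2 * m * (LINT x|Leb a b. cmod (f x)) + m\<^sup>2 * (b - a)"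
    using i1 i2 by (simp add: L2_norm_power2 del: lebesgue_integral_const) (use L in simp)
  also have "(LINT x|Leb a b. cmod (f x)) = m * (b - a)" using ab by (simp add: m_def)
  finally have "m\<^sup>2 * (b - a) \<le> (L2_norm a b f)\<^sup>2" by (simp add: power2_eq_square algebra_simps)
  then have "(m * (b - a))\<^sup>2 \<le> (sqrt (b - a) * L2_norm a b f)\<^sup>2"
    using mult_left_mono[OF \<open>m\<^sup>2 * (b - a) \<le> (L2_norm a b f)\<^sup>2\<close>, of "b - a"] ab by (simp add: power_mult_distrib power2_eq_square mult_ac)
  then have "m * (b - a) \<le> sqrt (b - a) * L2_norm a b f"
    by (rule power2_le_imp_le) (use ab in auto)
  moreover have "integral {a..b} (\<lambda>x. cmod (f x)) = m * (b - a)"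
    using LINT_Leb_eq_integral[OF i1] ab by (simp add: m_def)
  ultimately show ?thesis by simp
qed

lemma weak_deriv_L2: "weak_deriv a b n f g \<Longrightarrow> L2 a b g"
  by (simp add: weak_deriv_def)

text \<open>
The choice of a weak derivative by Hilbert's operator is thereby determined up to a null
set, and with it all norms.
\<close>

lemma weak_deriv_unique:
  assumes "weak_deriv a b n f g" "weak_deriv a b n f g'"
  shows "AE x in Leb a b. g x = g' x"
proof -
  have g: "integrable (Leb a b) g" and g': "integrable (Leb a b) g'"
    using assms by (auto intro: L2_integrable weak_deriv_L2)
  have "AE x in Leb a b. g x - g' x = 0"
  proof (rule AE_zero_if_orthogonal_bumps)
    show "integrable (Leb a b) (\<lambda>x. g x - g' x)" using g g' by auto
    fix c d n' assume "a < c" "c < d" "d < b"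
    then have t: "test_fun a b (bump c d n')" by (intro test_fun_bump)
    have "(LINT x|Leb a b. g x * bump c d n' x) = (LINT x|Leb a b. g' x * bump c d n' x)"
      using assms t by (auto simp: weak_deriv_def)
    moreover have "(LINT x|Leb a b. (g x - g' x) * bump c d n' x) =
       (LINT x|Leb a b. g x * bump c d n' x) - (LINT x|Leb a b. g' x * bump c d n' x)"
      using g g' by (simp add: left_diff_distrib integrable_mult_continuous flat_alg_continuous bump_flat_alg)
    ultimately show "(LINT x|Leb a b. (g x - g' x) * bump c d n' x) = 0" by simp
  qed
  then show ?thesis by eventually_elim simp
qed

lemma weak_deriv_linear:
  assumes "L2 a b f" "L2 a b f'" "weak_deriv a b n f g" "weak_deriv a b n f' g'"
  shows "weak_deriv a b n (\<lambda>x. f x + c * f' x) (\<lambda>x. g x + c * g' x)"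
  unfolding weak_deriv_def
proof (intro conjI allI impI)
  have i: "integrable (Leb a b) f" "integrable (Leb a b) f'" "integrable (Leb a b) g" "integrable (Leb a b) g'"
    using assms by (auto intro: L2_integrable weak_deriv_L2)
  show "L2 a b (\<lambda>x. g x + c * g' x)" using assms by (intro L2_add L2_scale weak_deriv_L2)
  fix \<phi> assume t: "test_fun a b \<phi>"
  have cont: "continuous_on {a..b} (vderiv n \<phi>)" for n by (rule test_fun_continuous[OF t])
  have split: "(LINT x|Leb a b. (p x + c * q x) * vderiv n \<phi> x) =
      (LINT x|Leb a b. p x * vderiv n \<phi> x) + c * (LINT x|Leb a b. q x * vderiv n \<phi> x)"
    if "integrable (Leb a b) p" "integrable (Leb a b) q" for p q n
  proof -
    have "(LINT x|Leb a b. (p x + c * q x) * vderiv n \<phi> x) =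
      (LINT x|Leb a b. p x * vderiv n \<phi> x + c * (q x * vderiv n \<phi> x))"
      by (simp add: algebra_simps)
    then show ?thesis
      using integrable_mult_continuous[OF that(1) cont] integrable_mult_continuous[OF that(2) cont] by simp
  qed
  show "(LINT x|Leb a b. (f x + c * f' x) * vderiv n \<phi> x) = (-1) ^ n * (LINT x|Leb a b. (g x + c * g' x) * \<phi> x)"
    using split[OF i(1,2), of n] split[OF i(3,4), of 0] assms(3,4) t
    by (simp add: weak_deriv_def vderiv_0 algebra_simps)
qed

text \<open>
Including order zero makes the Sobolev norm a single sum and gives the lemmas on successive weak
derivatives a uniform form.
\<close>

definition weak_der :: "real \<Rightarrow> real \<Rightarrow> nat \<Rightarrow> (real \<Rightarrow> complex) \<Rightarrow> real \<Rightarrow> complex" where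
  "weak_der a b n f = (if n = 0 then f else wderiv a b n f)"

lemma Sob_L2: "Sob a b m f \<Longrightarrow> L2 a b f"
  by (simp add: Sob_def)

lemma weak_deriv_weak_der:
  assumes "Sob a b m f" "n \<le> m" shows "weak_deriv a b n f (weak_der a b n f)"
proof (cases "n = 0")
  case True
  then show ?thesis using assms by (simp add: weak_der_def weak_deriv_def vderiv_0 Sob_def)
next
  case False
  then have "\<exists>g. weak_deriv a b n f g" using assms by (auto simp: Sob_def)
  then show ?thesis using False by (simp add: weak_der_def wderiv_def someI_ex)
qed

lemma Sob_linear:
  assumes "Sob a b m f" "Sob a b m g" shows "Sob a b m (\<lambda>x. f x + c * g x)"
  unfolding Sob_def
proof (intro conjI ballI)
  show "L2 a b (\<lambda>x. f x + c * g x)" using assms by (intro L2_add L2_scale Sob_L2)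
  fix n assume "n \<in> {1..m}"
  then show "\<exists>h. weak_deriv a b n (\<lambda>x. f x + c * g x) h"
    using weak_deriv_linear[OF Sob_L2[OF assms(1)] Sob_L2[OF assms(2)] weak_deriv_weak_der[OF assms(1)] weak_deriv_weak_der[OF assms(2)]]
    by auto
qed

lemma weak_der_linear:
  assumes "Sob a b m f" "Sob a b m g" "n \<le> m"
  shows "AE x in Leb a b. weak_der a b n (\<lambda>x. f x + c * g x) x = weak_der a b n f x + c * weak_der a b n g x"
  using assms
  by (intro weak_deriv_unique[of a b n "\<lambda>x. f x + c * g x"] weak_deriv_linear weak_deriv_weak_der[of a b m] Sob_linear Sob_L2)

lemma L2_weak_der: "Sob a b m f \<Longrightarrow> n \<le> m \<Longrightarrow> L2 a b (weak_der a b n f)"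
  by (rule weak_deriv_L2[OF weak_deriv_weak_der])

lemma Sob_norm_nonneg [simp]: "0 \<le> Sob_norm a b m f"
  by (simp add: Sob_norm_def sum_nonneg)

lemma Sob_norm_power2: "(Sob_norm a b m f)\<^sup>2 = (\<Sum>n\<le>m. (L2_norm a b (weak_der a b n f))\<^sup>2)"
proof -
  have "{..m} = insert 0 {1..m}" by auto
  then have "(\<Sum>n\<le>m. (L2_norm a b (weak_der a b n f))\<^sup>2) = (L2_norm a b f)\<^sup>2 + (\<Sum>n=1..m. (L2_norm a b (wderiv a b n f))\<^sup>2)"
    by (simp add: weak_der_def)
  then show ?thesis by (simp add: Sob_norm_def sum_nonneg)
qed

lemma L2_norm_weak_der_le: "n \<le> m \<Longrightarrow> L2_norm a b (weak_der a b n f) \<le> Sob_norm a b m f"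
  by (rule power2_le_imp_le) (auto simp: Sob_norm_power2 intro: member_le_sum)

lemma Sob_norm_mono: "n \<le> m \<Longrightarrow> Sob_norm a b n f \<le> Sob_norm a b m f"
  by (rule power2_le_imp_le) (auto simp: Sob_norm_power2 intro: sum_mono2)

text \<open>
Weak derivatives of different orders are defined independently of each other.  They are linked by
testing the lower order against the derivative of a test function.
\<close>

lemma weak_der_Suc_primitive:
  assumes ab: "a < b" and f: "Sob a b m f" and n: "Suc n \<le> m"
  shows "\<exists>\<kappa>. AE x in Leb a b. weak_der a b n f x = \<kappa> + integral {a..x} (weak_der a b (Suc n) f)"
proof (rule weak_deriv_1_imp_primitive[OF ab])
  show "integrable (Leb a b) (weak_der a b n f)" "integrable (Leb a b) (weak_der a b (Suc n) f)"
    using f n by (auto intro!: L2_integrable L2_weak_der[of a b m])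
  fix \<phi> assume t: "test_fun a b \<phi>"
  have t': "test_fun a b (vderiv (Suc 0) \<phi>)" by (rule test_fun_vderiv[OF t])
  have "(LINT x|Leb a b. f x * vderiv n (vderiv (Suc 0) \<phi>) x) = (-1) ^ n * (LINT x|Leb a b. weak_der a b n f x * vderiv (Suc 0) \<phi> x)"
    using weak_deriv_weak_der[OF f, of n] n t' by (simp add: weak_deriv_def)
  moreover have "(LINT x|Leb a b. f x * vderiv (Suc n) \<phi> x) = (-1) ^ Suc n * (LINT x|Leb a b. weak_der a b (Suc n) f x * \<phi> x)"
    using weak_deriv_weak_der[OF f n] t by (simp add: weak_deriv_def)
  ultimately have "(-1) ^ n * (LINT x|Leb a b. weak_der a b n f x * vderiv (Suc 0) \<phi> x)
      = (-1) ^ n * (- (LINT x|Leb a b. weak_der a b (Suc n) f x * \<phi> x))"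
    by (simp add: vderiv_add)
  then show "(LINT x|Leb a b. weak_der a b n f x * vderiv (Suc 0) \<phi> x) = - (LINT x|Leb a b. weak_der a b (Suc n) f x * \<phi> x)"
    by (subst (asm) mult_left_cancel) simp_all
qed

lemma continuous_AE_eq:
  fixes F G :: "real \<Rightarrow> 'a::euclidean_space"
  assumes ab: "a < b" and F: "continuous_on {a..b} F" and G: "continuous_on {a..b} G"
    and eq: "AE x in Leb a b. F x = G x" and x: "x \<in> {a..b}"
  shows "F x = G x"
proof -
  define C where "C = {x \<in> {a..b}. F x - G x = 0}"
  have C: "closed C" unfolding C_def
    by (intro continuous_closed_preimage_constant continuous_intros F G)
  have "AE x\<in>{a<..<b} in lebesgue. x \<in> C"
    using eq unfolding AE_Leb_iff by eventually_elim (auto simp: C_def)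
  then have "y \<in> C" if "y \<in> {a<..<b}" for y
    using mem_closed_if_AE_lebesgue_open[OF open_greaterThanLessThan C _ that] by blast
  then have "closure {a<..<b} \<subseteq> C" by (intro closure_minimal C) auto
  then show ?thesis using x ab by (auto simp: C_def)
qed

text \<open>
The continuous representative on $[a,b]$ of the weak derivative of order \<open>n\<close>.  It exists if one more
weak derivative exists, and its values outside $[a,b]$ are arbitrary.
\<close>

definition cont_der :: "real \<Rightarrow> real \<Rightarrow> nat \<Rightarrow> (real \<Rightarrow> complex) \<Rightarrow> real \<Rightarrow> complex" where
  "cont_der a b n f = (SOME F. continuous_on {a..b} F \<and> (AE x in Leb a b. weak_der a b n f x = F x))"

lemma
  assumes ab: "a < b" and f: "Sob a b m f" and n: "n < m"
  shows cont_der_continuous: "continuous_on {a..b} (cont_der a b n f)"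
    and cont_der_AE: "AE x in Leb a b. weak_der a b n f x = cont_der a b n f x"
proof -
  obtain \<kappa> where \<kappa>: "AE x in Leb a b. weak_der a b n f x = \<kappa> + integral {a..x} (weak_der a b (Suc n) f)"
    using weak_der_Suc_primitive[OF ab f Suc_leI[OF n]] by blast
  have "integrable (Leb a b) (weak_der a b (Suc n) f)" using f n by (intro L2_integrable L2_weak_der[of a b m]) auto
  then have "continuous_on {a..b} (\<lambda>x. \<kappa> + integral {a..x} (weak_der a b (Suc n) f))"
    by (intro continuous_intros indefinite_integral_continuous_1 integrable_on_Leb) auto
  with \<kappa> have "\<exists>F. continuous_on {a..b} F \<and> (AE x in Leb a b. weak_der a b n f x = F x)" by blast
  then have "continuous_on {a..b} (cont_der a b n f) \<and> (AE x in Leb a b. weak_der a b n f x = cont_der a b n f x)"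
    unfolding cont_der_def by (rule someI_ex)
  then show "continuous_on {a..b} (cont_der a b n f)" "AE x in Leb a b. weak_der a b n f x = cont_der a b n f x" by auto
qed

lemma cont_der_unique:
  assumes ab: "a < b" and f: "Sob a b m f" and n: "n < m" and F: "continuous_on {a..b} F"
    and eq: "AE x in Leb a b. weak_der a b n f x = F x" and x: "x \<in> {a..b}"
  shows "cont_der a b n f x = F x"
proof (rule continuous_AE_eq[OF ab cont_der_continuous[OF ab f n] F _ x])
  show "AE x in Leb a b. cont_der a b n f x = F x" using cont_der_AE[OF ab f n] eq by eventually_elim simp
qed

lemma cont_der_0: "a < b \<Longrightarrow> Sob a b m f \<Longrightarrow> 0 < m \<Longrightarrow> continuous_on {a..b} f \<Longrightarrow> x \<in> {a..b} \<Longrightarrow> cont_der a b 0 f x = f x"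
  by (rule cont_der_unique[where m = m]) (auto simp: weak_der_def)

lemma cont_der_linear:
  assumes "a < b" "Sob a b m f" "Sob a b m g" "n < m" "x \<in> {a..b}"
  shows "cont_der a b n (\<lambda>x. f x + c * g x) x = cont_der a b n f x + c * cont_der a b n g x"
proof (rule cont_der_unique[OF assms(1) Sob_linear[OF assms(2,3)] assms(4) _ _ assms(5)])
  show "continuous_on {a..b} (\<lambda>x. cont_der a b n f x + c * cont_der a b n g x)"
    using assms by (intro continuous_intros cont_der_continuous[of a b m])
  show "AE x in Leb a b. weak_der a b n (\<lambda>x. f x + c * g x) x = cont_der a b n f x + c * cont_der a b n g x"
    using weak_der_linear[OF assms(2,3), of n c] cont_der_AE[OF assms(1,2,4)] cont_der_AE[OF assms(1,3,4)] assms(4)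
    by (auto elim!: AE_mp)
qed

lemma cont_der_primitive:
  assumes ab: "a < b" and f: "Sob a b m f" and n: "n < m" and x: "x \<in> {a..b}"
  shows "cont_der a b n f x = cont_der a b n f a + integral {a..x} (weak_der a b (Suc n) f)"
proof -
  obtain \<kappa> where \<kappa>: "AE x in Leb a b. weak_der a b n f x = \<kappa> + integral {a..x} (weak_der a b (Suc n) f)"
    using weak_der_Suc_primitive[OF ab f Suc_leI[OF n]] by blast
  have "integrable (Leb a b) (weak_der a b (Suc n) f)" using f n by (intro L2_integrable L2_weak_der[of a b m]) auto
  then have "continuous_on {a..b} (\<lambda>x. \<kappa> + integral {a..x} (weak_der a b (Suc n) f))"
    by (intro continuous_intros indefinite_integral_continuous_1 integrable_on_Leb) auto
  then have "cont_der a b n f x = \<kappa> + integral {a..x} (weak_der a b (Suc n) f)" if "x \<in> {a..b}" for x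
    by (rule cont_der_unique[OF ab f n _ \<kappa> that])
  from this[OF x] this[of a] show ?thesis using ab by simp
qed

text \<open>
The right-hand side is the increment of a monotone function whose total increase is bounded by the
Sobolev norm.  It takes the place of a pointwise bound on the derivative of order \<open>Suc n\<close>, which
need not have a continuous representative when \<open>Suc n = m\<close>.
\<close>

lemma cont_der_increment_le:
  assumes ab: "a < b" and f: "Sob a b m f" and n: "n < m" and xy: "a \<le> x" "x \<le> y" "y \<le> b"
  shows "cmod (cont_der a b n f y - cont_der a b n f x) \<le>
     integral {a..y} (\<lambda>s. cmod (weak_der a b (Suc n) f s)) - integral {a..x} (\<lambda>s. cmod (weak_der a b (Suc n) f s))"
proof -
  let ?g = "weak_der a b (Suc n) f"
  have g: "integrable (Leb a b) ?g" using f n by (intro L2_integrable L2_weak_der[of a b m]) auto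
  then have g': "integrable (Leb a b) (\<lambda>s. cmod (?g s))" by auto
  have 1: "integral {a..x} ?g + integral {x..y} ?g = integral {a..y} ?g"
    using xy by (intro Henstock_Kurzweil_Integration.integral_combine integrable_on_Leb[OF g]) auto
  have 2: "integral {a..x} (\<lambda>s. cmod (?g s)) + integral {x..y} (\<lambda>s. cmod (?g s)) = integral {a..y} (\<lambda>s. cmod (?g s))"
    using xy by (intro Henstock_Kurzweil_Integration.integral_combine integrable_on_Leb[OF g']) auto
  have "cmod (integral {x..y} ?g) \<le> integral {x..y} (\<lambda>s. cmod (?g s))"
    by (rule integral_norm_bound_integral[OF integrable_on_Leb[OF g] integrable_on_Leb[OF g']]) (use xy in auto)
  moreover have "cont_der a b n f y - cont_der a b n f x = integral {x..y} ?g"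
    using cont_der_primitive[OF ab f n, of x] cont_der_primitive[OF ab f n, of y] xy 1 by (auto simp: algebra_simps)
  ultimately show ?thesis using 2 by simp
qed

lemma cont_der_has_derivative:
  assumes ab: "a < b" and f: "Sob a b m f" and n: "Suc n < m" and x: "x \<in> {a..b}"
  shows "(cont_der a b n f has_vector_derivative cont_der a b (Suc n) f x) (at x within {a..b})"
proof -
  have "((\<lambda>u. integral {a..u} (cont_der a b (Suc n) f)) has_vector_derivative cont_der a b (Suc n) f x) (at x within {a..b})"
    by (rule integral_has_vector_derivative[OF cont_der_continuous[OF ab f n] x])
  then have "((\<lambda>u. cont_der a b n f a + integral {a..u} (cont_der a b (Suc n) f)) has_vector_derivative 0 + cont_der a b (Suc n) f x) (at x within {a..b})"
    by (intro has_vector_derivative_add has_vector_derivative_const)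
  then show ?thesis
    unfolding add_0_left
  proof (rule has_vector_derivative_transform[OF x, rotated])
    fix u assume u: "u \<in> {a..b}"
    have "integral {a..u} (cont_der a b (Suc n) f) = integral {a..u} (weak_der a b (Suc n) f)"
    proof (rule integral_cong_AE_Leb)
      show "AE x in Leb a b. cont_der a b (Suc n) f x = weak_der a b (Suc n) f x"
        using cont_der_AE[OF ab f n] by eventually_elim simp
    qed (use u in auto)
    then show "cont_der a b n f u = cont_der a b n f a + integral {a..u} (cont_der a b (Suc n) f)"
      using cont_der_primitive[OF ab f _ u, of n] n by simp
  qed
qed

text \<open>
The Sobolev embedding: the oscillation is at most the integral of the next derivative, and
the mean of the modulus is bounded by the $L^2$ norm.
\<close>

lemma cont_der_bound:
  assumes ab: "a < b" and f: "Sob a b m f" and n: "n < m" and x: "x \<in> {a..b}"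
  shows "cmod (cont_der a b n f x) \<le> (1 / sqrt (b - a) + sqrt (b - a)) * Sob_norm a b m f"
proof -
  let ?L = "b - a" let ?S = "Sob_norm a b m f" let ?F = "cont_der a b n f"
  have weak_der': "L2 a b (weak_der a b (Suc n) f)" using f n by (intro L2_weak_der[of a b m]) auto
  have inc: "cmod (?F y - ?F z) \<le> sqrt ?L * ?S" if "a \<le> z" "z \<le> y" "y \<le> b" for y z
  proof -
    let ?g = "\<lambda>s. cmod (weak_der a b (Suc n) f s)"
    have gi: "integrable (Leb a b) ?g" using L2_integrable[OF weak_der'] by auto
    have "integral {a..y} ?g \<le> integral {a..b} ?g"
      using that by (intro integral_subset_le integrable_on_Leb[OF gi]) auto
    moreover have "0 \<le> integral {a..z} ?g"
      using that by (intro Henstock_Kurzweil_Integration.integral_nonneg integrable_on_Leb[OF gi]) auto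
    moreover have "integral {a..b} ?g \<le> sqrt ?L * ?S"
      using L1_le_L2[OF ab weak_der'] L2_norm_weak_der_le[of "Suc n" m a b f] n ab
      by (meson Suc_leI mult_left_mono order_trans real_sqrt_ge_zero diff_ge_0_iff_ge less_imp_le)
    ultimately show ?thesis using cont_der_increment_le[OF ab f n that] by linarith
  qed
  have inc': "cmod (?F x) \<le> cmod (?F y) + sqrt ?L * ?S" if "y \<in> {a..b}" for y
  proof -
    have "cmod (?F x - ?F y) \<le> sqrt ?L * ?S"
      using inc[of x y] inc[of y x] that x by (cases "x \<le> y") (auto simp: norm_minus_commute)
    then show ?thesis using norm_triangle_ineq2[of "?F x" "?F y"] by linarith
  qed
  have cF: "continuous_on {a..b} ?F" by (rule cont_der_continuous[OF ab f n])
  have "cmod (?F x) * ?L = integral {a..b} (\<lambda>_. cmod (?F x))" using ab by simp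
  also have "\<dots> \<le> integral {a..b} (\<lambda>y. cmod (?F y) + sqrt ?L * ?S)"
    by (intro integral_le integrable_continuous_real continuous_intros cF inc')
  also have "\<dots> = integral {a..b} (\<lambda>y. cmod (?F y)) + sqrt ?L * ?S * ?L"
    using ab by (subst Henstock_Kurzweil_Integration.integral_add) (auto intro!: integrable_continuous_real continuous_intros cF)
  also have "integral {a..b} (\<lambda>y. cmod (?F y)) \<le> sqrt ?L * ?S"
  proof -
    have "integral {a..b} (\<lambda>y. cmod (?F y)) \<le> sqrt ?L * L2_norm a b ?F"
      by (rule L1_le_L2[OF ab L2_continuous[OF cF]])
    also have "L2_norm a b ?F = L2_norm a b (weak_der a b n f)"
      using cont_der_AE[OF ab f n] L2_measurable[OF L2_continuous[OF cF]] L2_measurable[OF L2_weak_der[OF f, of n]] n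
      by (intro L2_norm_cong_AE) (auto elim!: eventually_mono)
    also have "sqrt ?L * \<dots> \<le> sqrt ?L * ?S" using ab n by (intro mult_left_mono L2_norm_weak_der_le) auto
    finally show ?thesis .
  qed
  finally have "cmod (?F x) * ?L \<le> sqrt ?L * ?S + sqrt ?L * ?S * ?L" by simp
  also have "\<dots> = ((1 / sqrt ?L + sqrt ?L) * ?S) * ?L"
  proof -
    have "?L = sqrt ?L * sqrt ?L" using ab by simp
    then have *: "1 / sqrt ?L * ?L = sqrt ?L" using ab by (simp add: field_simps)
    have "s * S + s * S * L = ((p + s) * S) * L" if "p * L = s" for p s S L :: real
      unfolding that[symmetric] by (simp add: algebra_simps)
    from this[OF *] show ?thesis .
  qed
  finally show ?thesis using ab by simp
qed

section \<open>Taylor estimates, the mesh defect, and differentiation in time\<close>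

lemma vector_mvt:
  fixes f :: "real \<Rightarrow> 'a::real_normed_vector"
  assumes d: "\<And>z. z \<in> {p..q} \<Longrightarrow> (f has_vector_derivative f' z) (at z within {p..q})"
    and B: "\<And>z. z \<in> {p..q} \<Longrightarrow> norm (f' z) \<le> B" and xy: "x \<in> {p..q}" "y \<in> {p..q}"
  shows "norm (f x - f y) \<le> B * \<bar>x - y\<bar>"
proof -
  have "norm (f x - f y) \<le> B * norm (x - y)"
  proof (rule differentiable_bound[of "{p..q}" f "\<lambda>z h. h *\<^sub>R f' z"])
    show "(f has_derivative (\<lambda>h. h *\<^sub>R f' z)) (at z within {p..q})" if "z \<in> {p..q}" for z
      using d[OF that] by (simp add: has_vector_derivative_def)
    show "onorm (\<lambda>h. h *\<^sub>R f' z) \<le> B" if "z \<in> {p..q}" for z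
    proof (rule onorm_bound)
      show "0 \<le> B" using B[OF that] norm_ge_zero order_trans by blast
      show "norm (h *\<^sub>R f' z) \<le> B * norm h" for h
        using mult_right_mono[OF B[OF that], of "\<bar>h\<bar>"] by (simp add: mult.commute)
    qed
  qed (use xy in auto)
  then show ?thesis by simp
qed

text \<open>
Taylor's formula with the remainder measured by the oscillation of the highest derivative.  In this
form it covers both a Lipschitz continuous highest derivative (error terms in time) and one whose
oscillation is bounded by the integral of a weak derivative (the mesh defect below).
\<close>

lemma taylor_oscillation_1:
  fixes f :: "real \<Rightarrow> 'a::real_normed_vector"
  assumes d: "\<And>z. z \<in> {p..q} \<Longrightarrow> (f has_vector_derivative f' z) (at z within {p..q})"
    and V: "\<And>z. z \<in> {p..q} \<Longrightarrow> norm (f' z - f' x) \<le> V" and xy: "x \<in> {p..q}" "y \<in> {p..q}"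
  shows "norm (f y - f x - (y - x) *\<^sub>R f' x) \<le> \<bar>y - x\<bar> * V"
proof -
  have "closed_segment x y \<subseteq> {p..q}" using xy by (simp add: closed_segment_subset)
  from vector_differentiable_bound_linearization[OF d this V xy(1)] show ?thesis by simp
qed

lemma taylor_oscillation_2:
  fixes f :: "real \<Rightarrow> 'a::real_normed_vector"
  assumes d1: "\<And>z. z \<in> {p..q} \<Longrightarrow> (f has_vector_derivative f' z) (at z within {p..q})"
    and d2: "\<And>z. z \<in> {p..q} \<Longrightarrow> (f' has_vector_derivative f'' z) (at z within {p..q})"
    and V: "\<And>z. z \<in> {p..q} \<Longrightarrow> norm (f'' z - f'' x) \<le> V" and xy: "x \<in> {p..q}" "y \<in> {p..q}"
  shows "norm (f y - f x - (y - x) *\<^sub>R f' x - ((y - x)\<^sup>2 / 2) *\<^sub>R f'' x) \<le> (y - x)\<^sup>2 * V"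
proof -
  define I where "I = {min x y..max x y}"
  have sub: "I \<subseteq> {p..q}" using xy by (auto simp: I_def)
  define g g' where "g z = f z - ((z - x)\<^sup>2 / 2) *\<^sub>R f'' x" and "g' z = f' z - (z - x) *\<^sub>R f'' x" for z
  have V0: "0 \<le> V" using V[OF xy(1)] by simp
  have g: "(g has_vector_derivative g' z) (at z within I)" if "z \<in> I" for z
  proof -
    have 1: "(f has_vector_derivative f' z) (at z within I)"
      by (rule has_vector_derivative_within_subset[OF d1 sub]) (use that sub in auto)
    have "((\<lambda>z. (z - x)\<^sup>2 / 2) has_real_derivative (z - x)) (at z within I)"
      by (auto intro!: derivative_eq_intros)
    then have "((\<lambda>z. ((z - x)\<^sup>2 / 2) *\<^sub>R f'' x) has_vector_derivative (z - x) *\<^sub>R f'' x) (at z within I)"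
      by (auto intro!: derivative_eq_intros simp: has_real_derivative_iff_has_vector_derivative)
    with 1 show ?thesis unfolding g_def[abs_def] g'_def by (rule has_vector_derivative_diff)
  qed
  have g': "norm (g' z - g' x) \<le> \<bar>y - x\<bar> * V" if "z \<in> I" for z
  proof -
    have "norm (f' z - f' x - (z - x) *\<^sub>R f'' x) \<le> \<bar>z - x\<bar> * V"
      by (rule taylor_oscillation_1[OF d2 V]) (use that sub xy in auto)
    also have "\<dots> \<le> \<bar>y - x\<bar> * V" using that V0 by (intro mult_right_mono) (auto simp: I_def)
    finally show ?thesis by (simp add: g'_def algebra_simps)
  qed
  have "norm (g y - g x - (y - x) *\<^sub>R g' x) \<le> \<bar>y - x\<bar> * (\<bar>y - x\<bar> * V)"
    using g g' unfolding I_def by (rule taylor_oscillation_1) (auto simp: I_def)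
  also have "\<dots> = (y - x)\<^sup>2 * V" by (simp add: power2_eq_square flip: mult.assoc)
  finally show ?thesis by (simp add: g_def g'_def algebra_simps)
qed

text \<open>
The accumulated error of the central difference \<open>g1(x + h/2) - g1(x - h/2)\<close> as an approximation of
\<open>h g2(x)\<close>, where \<open>g2\<close> is the derivative of \<open>g1\<close>.  Partial sums occur because the Ritz projection below
is obtained by summing second derivatives over the nodes.
\<close>

definition defect :: "real \<Rightarrow> real \<Rightarrow> nat \<Rightarrow> nat \<Rightarrow> (real \<Rightarrow> complex) \<Rightarrow> (real \<Rightarrow> complex) \<Rightarrow> complex" where
  "defect a b M J g1 g2 = (\<Sum>l=1..J. g1 (node a b M l + mesh a b M / 2) - g1 (node a b M l - mesh a b M / 2)
      - mesh a b M *\<^sub>R g2 (node a b M l))"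

lemma mesh_pos: "a < b \<Longrightarrow> 0 < M \<Longrightarrow> 0 < mesh a b M"
  by (simp add: mesh_def)

lemma node_Suc: "node a b M (Suc l) = node a b M l + mesh a b M"
  by (simp add: node_def algebra_simps)

lemma node_0: "node a b M 0 = a" by (simp add: node_def)

lemma node_M: "0 < M \<Longrightarrow> node a b M M = b" by (simp add: node_def mesh_def)

lemma node_mono: "a < b \<Longrightarrow> i \<le> j \<Longrightarrow> node a b M i \<le> node a b M j"
  using mult_right_mono[of "real i" "real j" "mesh a b M"] by (simp add: node_def) (simp add: mesh_def)

lemma node_in: "a < b \<Longrightarrow> 0 < M \<Longrightarrow> j \<le> M \<Longrightarrow> node a b M j \<in> {a..b}"
  using node_mono[of a b 0 j M] node_mono[of a b j M M] by (simp add: node_0 node_M)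

lemma node_half_in:
  assumes "a < b" "1 \<le> j" "j < M"
  shows "a \<le> node a b M j - mesh a b M / 2" "node a b M j + mesh a b M / 2 \<le> b"
proof -
  obtain i where i: "j = Suc i" using assms by (cases j) auto
  have "node a b M i \<ge> a" "node a b M (Suc j) \<le> b" "mesh a b M > 0"
    using node_in[of a b M i] node_in[of a b M "Suc j"] assms i by (auto intro: mesh_pos)
  then show "a \<le> node a b M j - mesh a b M / 2" "node a b M j + mesh a b M / 2 \<le> b"
    by (auto simp: i node_Suc)
qed

text \<open>
On each cell the error is at most $h^2$ times the increment of the integral of the modulus of the fourth
derivative; these increments telescope.  Bounding the terms separately would require a bounded
fourth derivative.
\<close>

lemma defect_Sob:
  assumes ab: "a < b" and f: "Sob a b 4 f" and J: "J < M"
  shows "cmod (defect a b M J (cont_der a b 1 f) (cont_der a b 2 f)) \<le> (mesh a b M)\<^sup>2 * (sqrt (b - a) * Sob_norm a b 4 f)"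
proof -
  let ?h = "mesh a b M" let ?x = "node a b M"
  define A where "A x = integral {a..x} (\<lambda>s. cmod (weak_der a b 4 f s))" for x
  have h: "?h > 0" using ab J by (intro mesh_pos) auto
  have inc: "cmod (cont_der a b 3 f y - cont_der a b 3 f x) \<le> A y - A x" if "a \<le> x" "x \<le> y" "y \<le> b" for x y
    using cont_der_increment_le[OF ab f _ that, of 3] by (simp add: A_def numeral_eq_Suc)
  have mono: "A x \<le> A y" if "a \<le> x" "x \<le> y" "y \<le> b" for x y
    using inc[OF that] norm_ge_zero[of "cont_der a b 3 f y - cont_der a b 3 f x"] by linarith
  have A0: "A a = 0" by (simp add: A_def)
  have Ab: "A b \<le> sqrt (b - a) * Sob_norm a b 4 f"
  proof -
    have "A b \<le> sqrt (b - a) * L2_norm a b (weak_der a b 4 f)"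
      unfolding A_def by (intro L1_le_L2 ab L2_weak_der[OF f]) simp
    also have "\<dots> \<le> sqrt (b - a) * Sob_norm a b 4 f"
      using ab by (intro mult_left_mono L2_norm_weak_der_le) auto
    finally show ?thesis .
  qed
  have step: "cmod (cont_der a b 1 f (?x l + ?h/2) - cont_der a b 1 f (?x l - ?h/2) - ?h *\<^sub>R cont_der a b 2 f (?x l))
      \<le> ?h\<^sup>2 * (A (?x l + ?h/2) - A (?x l - ?h/2))" if l: "l \<in> {1..J}" for l
  proof -
    define y where "y = ?x l"
    define V where "V = A (y + ?h/2) - A (y - ?h/2)"
    have y: "a \<le> y - ?h/2" "y + ?h/2 \<le> b" using node_half_in[OF ab, of l M] l J by (auto simp: y_def)
    have d: "(cont_der a b n f has_vector_derivative cont_der a b (Suc n) f z) (at z within {y - ?h/2..y + ?h/2})"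
      if "Suc n < 4" "z \<in> {y - ?h/2..y + ?h/2}" for n z
      by (rule has_vector_derivative_within_subset[OF cont_der_has_derivative[OF ab f that(1)]]) (use that y in auto)
    have d1: "(cont_der a b 1 f has_vector_derivative cont_der a b 2 f z) (at z within {y - ?h/2..y + ?h/2})"
      and d2: "(cont_der a b 2 f has_vector_derivative cont_der a b 3 f z) (at z within {y - ?h/2..y + ?h/2})"
      if "z \<in> {y - ?h/2..y + ?h/2}" for z
      using d[of 1 z] d[of 2 z] that by (auto simp: numeral_eq_Suc)
    have osc: "cmod (cont_der a b 3 f z - cont_der a b 3 f y) \<le> V" if z: "z \<in> {y - ?h/2..y + ?h/2}" for z
    proof (cases "z \<le> y")
      case True
      have "cmod (cont_der a b 3 f y - cont_der a b 3 f z) \<le> A y - A z" by (rule inc) (use z y h True in auto)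
      moreover have "A y \<le> A (y + ?h/2)" "A (y - ?h/2) \<le> A z" by (rule mono; use z y h True in auto)+
      ultimately show ?thesis by (simp add: V_def norm_minus_commute)
    next
      case False
      have "cmod (cont_der a b 3 f z - cont_der a b 3 f y) \<le> A z - A y" by (rule inc) (use z y h False in auto)
      moreover have "A z \<le> A (y + ?h/2)" "A (y - ?h/2) \<le> A y" by (rule mono; use z y h False in auto)+
      ultimately show ?thesis by (simp add: V_def)
    qed
    have t: "cmod (cont_der a b 1 f z - cont_der a b 1 f y - (z - y) *\<^sub>R cont_der a b 2 f y - ((z - y)\<^sup>2/2) *\<^sub>R cont_der a b 3 f y) \<le> (z - y)\<^sup>2 * V"
      if "z \<in> {y - ?h/2..y + ?h/2}" for z
      by (rule taylor_oscillation_2[OF d1 d2 osc]) (use that h in auto)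
    \<comment> \<open>The even terms of the two expansions around the node cancel in \<open>p - q\<close>.\<close>
    define p q where "p = cont_der a b 1 f (y + ?h/2) - cont_der a b 1 f y - (?h/2) *\<^sub>R cont_der a b 2 f y - ((?h/2)\<^sup>2/2) *\<^sub>R cont_der a b 3 f y"
      and "q = cont_der a b 1 f (y - ?h/2) - cont_der a b 1 f y - (- ?h/2) *\<^sub>R cont_der a b 2 f y - ((?h/2)\<^sup>2/2) *\<^sub>R cont_der a b 3 f y"
    have "cmod p \<le> (?h/2)\<^sup>2 * V" "cmod q \<le> (?h/2)\<^sup>2 * V"
      using t[of "y + ?h/2"] t[of "y - ?h/2"] h by (simp_all add: p_def q_def)
    moreover have "cont_der a b 1 f (y + ?h/2) - cont_der a b 1 f (y - ?h/2) - ?h *\<^sub>R cont_der a b 2 f y = p - q"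
    proof -
      have "?h *\<^sub>R cont_der a b 2 f y = (?h/2) *\<^sub>R cont_der a b 2 f y + (?h/2) *\<^sub>R cont_der a b 2 f y"
        by (simp add: scaleR_add_left[symmetric])
      then show ?thesis by (simp add: p_def q_def)
    qed
    ultimately have "cmod (cont_der a b 1 f (y + ?h/2) - cont_der a b 1 f (y - ?h/2) - ?h *\<^sub>R cont_der a b 2 f y) \<le> 2 * ((?h/2)\<^sup>2 * V)"
      using norm_triangle_ineq4[of p q] by simp
    also have "\<dots> \<le> ?h\<^sup>2 * V"
    proof -
      have "0 \<le> V" using osc[of y] h by simp
      then have "0 \<le> ?h\<^sup>2 * V" by simp
      then show ?thesis by (simp add: power_divide mult.commute)
    qed
    finally show ?thesis by (simp add: y_def V_def)
  qed
  have "cmod (defect a b M J (cont_der a b 1 f) (cont_der a b 2 f)) \<le> (\<Sum>l=1..J. ?h\<^sup>2 * (A (?x l + ?h/2) - A (?x l - ?h/2)))"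
    unfolding defect_def by (rule sum_norm_le) (rule step)
  also have "\<dots> = ?h\<^sup>2 * (\<Sum>l=1..J. A (?x l + ?h/2) - A (?x l - ?h/2))"
    by (simp add: sum_distrib_left)
  also have "(\<Sum>l=1..J. A (?x l + ?h/2) - A (?x l - ?h/2)) \<le> A b"
  proof -
    have "(\<Sum>l=1..j. A (?x l + ?h/2) - A (?x l - ?h/2)) = A (?x j + ?h/2) - A (?x 0 + ?h/2)" for j
    proof (induction j)
      case (Suc j)
      have "?x (Suc j) - ?h/2 = ?x j + ?h/2" by (simp add: node_Suc)
      then show ?case using Suc by (simp add: add.commute)
    qed simp
    moreover have "A (?x J + ?h/2) \<le> A b"
    proof (rule mono)
      show "?x J + ?h/2 \<le> b"
        using node_in[OF ab, of M "Suc J"] J h by (simp add: node_Suc)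
      show "a \<le> ?x J + ?h/2" using node_in[OF ab, of M J] J h by simp
    qed simp
    moreover have "A a \<le> A (?x 0 + ?h/2)"
    proof (rule mono)
      have "?x 1 \<le> b" using node_in[OF ab, of M 1] J by (auto)
      then show "?x 0 + ?h/2 \<le> b" using h by (simp add: node_Suc[of a b M 0, simplified])
    qed (use h in \<open>auto simp: node_0\<close>)
    ultimately show ?thesis using A0 by simp
  qed
  finally show ?thesis using Ab by (meson mult_left_mono order_trans zero_le_power2)
qed

text \<open>
Bounds in $L^\<infinity>(0,T)$ hold at every time for quantities that depend continuously on time.
\<close>

lemma AE_le_imp_le:
  fixes \<phi> :: "real \<Rightarrow> real"
  assumes T: "0 < T" and c: "continuous_on {0..T} \<phi>" and ae: "AE t in Leb 0 T. \<phi> t \<le> B" and t: "t \<in> {0..T}"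
  shows "\<phi> t \<le> B"
proof -
  have "max (\<phi> t) B = B"
  proof (rule continuous_AE_eq[OF T _ _ _ t])
    show "continuous_on {0..T} (\<lambda>t. max (\<phi> t) B)" by (intro continuous_intros c)
    show "AE t in Leb 0 T. max (\<phi> t) B = B" using ae by eventually_elim auto
  qed simp
  then show ?thesis by (simp add: max_def split: if_splits)
qed

lemma esssup_nonneg:
  assumes "0 < T" and f: "\<And>t. 0 \<le> f t"
  shows "0 \<le> esssup (Leb 0 T) (\<lambda>t. ereal (f t))"
proof (rule ccontr)
  assume "\<not> ?thesis"
  then have lt: "esssup (Leb 0 T) (\<lambda>t. ereal (f t)) < 0" by simp
  have "AE t in Leb 0 T. ereal (f t) \<le> esssup (Leb 0 T) (\<lambda>t. ereal (f t))" by (rule esssup_AE)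
  then have "AE t in Leb 0 T. False"
  proof eventually_elim
    case (elim t)
    then have "ereal (f t) < 0" using lt by (rule order_le_less_trans)
    then show ?case using f[of t] by (simp add: not_less[symmetric])
  qed
  then have "emeasure (Leb 0 T) (space (Leb 0 T)) = 0" unfolding ae_filter_eq_bot_iff[symmetric] by (simp only: eventually_False)
  then show False using assms(1) by (simp add: emeasure_restrict_space)
qed

lemma Linf_Sob_nonneg: "0 < T \<Longrightarrow> 0 \<le> Linf_Sob T a b m v"
  unfolding Linf_Sob_def by (rule esssup_nonneg) auto

lemma Linf_Sob_AE: "Linf_Sob T a b m v \<le> ereal C \<Longrightarrow> AE t in Leb 0 T. Sob_norm a b m (v t) \<le> C"
  unfolding Linf_Sob_def using esssup_AE[of "\<lambda>t. ereal (Sob_norm a b m (v t))" "Leb 0 T"]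
  by (auto elim!: eventually_mono dest: order_trans)

definition embed_const :: "real \<Rightarrow> real" where "embed_const L = 1 / sqrt L + sqrt L"

lemma cont_der_diff:
  assumes "a < b" "Sob a b m f" "Sob a b m g" "n < m" "x \<in> {a..b}"
  shows "cont_der a b n (\<lambda>x. f x - g x) x = cont_der a b n f x - cont_der a b n g x"
  using cont_der_linear[OF assms, of "-1"] by simp

lemma Sob_diff: "Sob a b m f \<Longrightarrow> Sob a b m g \<Longrightarrow> Sob a b m (\<lambda>x. f x - g x)"
  using Sob_linear[of a b m f g "-1"] by simp

lemma Sob_scale: "Sob a b m f \<Longrightarrow> Sob a b m (\<lambda>x. c * f x)"
  using Sob_linear[of a b m f f "c - 1"] by (simp add: algebra_simps)

lemma cont_der_scale:
  assumes "a < b" "Sob a b m f" "n < m" "x \<in> {a..b}"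
  shows "cont_der a b n (\<lambda>x. c * f x) x = c * cont_der a b n f x"
  using cont_der_linear[OF assms(1,2,2,3,4), of "c - 1"] by (simp add: algebra_simps)

lemma cont_der_diff_le:
  assumes "a < b" "Sob a b m f" "Sob a b m g" "n < m" "x \<in> {a..b}"
  shows "cmod (cont_der a b n f x - cont_der a b n g x) \<le> embed_const (b - a) * Sob_norm a b m (\<lambda>x. f x - g x)"
  using cont_der_bound[OF assms(1) Sob_diff[OF assms(2,3)] assms(4,5)] cont_der_diff[OF assms] by (simp add: embed_const_def)

lemma cont_der_jointly_continuous:
  assumes ab: "a < b" and u: "cont_Sob I a b m u" and n: "n < m"
  shows "continuous_on (I \<times> {a..b}) (\<lambda>(t, x). cont_der a b n (u t) x)"
  unfolding continuous_on_iff
proof (intro ballI allI impI)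
  fix z and e :: real assume z: "z \<in> I \<times> {a..b}" and e: "0 < e"
  obtain t0 x0 where z0: "z = (t0, x0)" "t0 \<in> I" "x0 \<in> {a..b}" using z by auto
  have S: "Sob a b m (u t)" if "t \<in> I" for t using u that by (simp add: cont_Sob_def)
  define K where "K = embed_const (b - a)"
  have K: "K > 0" using ab by (auto simp: K_def embed_const_def intro!: add_pos_pos)
  have "((\<lambda>s. Sob_norm a b m (\<lambda>x. u s x - u t0 x)) \<longlongrightarrow> 0) (at t0 within I)"
    using u z0 by (simp add: cont_Sob_def)
  then have "\<forall>\<^sub>F s in at t0 within I. Sob_norm a b m (\<lambda>x. u s x - u t0 x) < e / (2 * K)"
    using e K by (intro order_tendstoD(2)[of _ 0]) auto
  then obtain d1 where d1: "d1 > 0" "\<And>s. s \<in> I \<Longrightarrow> s \<noteq> t0 \<Longrightarrow> dist s t0 < d1 \<Longrightarrow> Sob_norm a b m (\<lambda>x. u s x - u t0 x) < e / (2 * K)"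
    unfolding eventually_at by blast
  have "continuous_on {a..b} (cont_der a b n (u t0))" by (rule cont_der_continuous[OF ab S[OF z0(2)] n])
  then obtain d2 where d2: "d2 > 0" "\<And>x. x \<in> {a..b} \<Longrightarrow> dist x x0 < d2 \<Longrightarrow> dist (cont_der a b n (u t0) x) (cont_der a b n (u t0) x0) < e / 2"
    using z0(3) e half_gt_zero unfolding continuous_on_iff by metis
  show "\<exists>d>0. \<forall>z'\<in>I \<times> {a..b}. dist z' z < d \<longrightarrow> dist (case z' of (t, x) \<Rightarrow> cont_der a b n (u t) x) (case z of (t, x) \<Rightarrow> cont_der a b n (u t) x) < e"
  proof (intro exI[of _ "min d1 d2"] conjI ballI impI)
    fix z' assume z': "z' \<in> I \<times> {a..b}" "dist z' z < min d1 d2"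
    obtain t x where tx: "z' = (t, x)" "t \<in> I" "x \<in> {a..b}" using z' by auto
    have dt: "dist t t0 < d1" and dx: "dist x x0 < d2"
      using z'(2) dist_fst_le[of z' z] dist_snd_le[of z' z] by (auto simp: tx z0)
    have "cmod (cont_der a b n (u t) x - cont_der a b n (u t0) x) < e / 2"
    proof (cases "t = t0")
      case False
      have "cmod (cont_der a b n (u t) x - cont_der a b n (u t0) x) \<le> K * Sob_norm a b m (\<lambda>x. u t x - u t0 x)"
        unfolding K_def by (rule cont_der_diff_le[OF ab S S n]) (use tx z0 in auto)
      also have "\<dots> < K * (e / (2 * K))" using d1(2)[OF tx(2) False dt] K by (intro mult_strict_left_mono)
      finally show ?thesis using K by simp
    qed (use e in simp)
    moreover have "cmod (cont_der a b n (u t0) x - cont_der a b n (u t0) x0) < e / 2"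
      using d2(2)[OF tx(3) dx] by (simp add: dist_norm)
    ultimately have "cmod ((cont_der a b n (u t) x - cont_der a b n (u t0) x) + (cont_der a b n (u t0) x - cont_der a b n (u t0) x0)) < e"
      using norm_triangle_ineq[of "cont_der a b n (u t) x - cont_der a b n (u t0) x" "cont_der a b n (u t0) x - cont_der a b n (u t0) x0"] by linarith
    then show "dist (case z' of (t, x) \<Rightarrow> cont_der a b n (u t) x) (case z of (t, x) \<Rightarrow> cont_der a b n (u t) x) < e"
      by (simp add: tx z0 dist_norm)
  qed (use d1 d2 in auto)
qed

text \<open>
Taking the continuous representative at a point is a bounded linear functional on $H^m$, so it commutes with
differentiation in time.
\<close>

lemma cont_der_time_derivative:
  assumes ab: "a < b" and d: "has_time_deriv_Sob I a b m u v" and u: "\<And>t. t \<in> I \<Longrightarrow> Sob a b m (u t)"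
    and v: "\<And>t. t \<in> I \<Longrightarrow> Sob a b m (v t)" and n: "n < m" and t: "t \<in> I" and x: "x \<in> {a..b}"
  shows "((\<lambda>s. cont_der a b n (u s) x) has_vector_derivative cont_der a b n (v t) x) (at t within I)"
proof -
  have "((\<lambda>s. Sob_norm a b m (\<lambda>x. (u s x - u t x) /\<^sub>R (s - t) - v t x)) \<longlongrightarrow> 0) (at t within I)"
    using d t by (simp add: has_time_deriv_Sob_def)
  then have lim: "((\<lambda>s. embed_const (b - a) * Sob_norm a b m (\<lambda>x. (u s x - u t x) /\<^sub>R (s - t) - v t x)) \<longlongrightarrow> 0) (at t within I)"
    by (rule tendsto_mult_right_zero)
  have "((\<lambda>s. (cont_der a b n (u s) x - cont_der a b n (u t) x) /\<^sub>R (s - t) - cont_der a b n (v t) x) \<longlongrightarrow> 0) (at t within I)"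
  proof (rule Lim_null_comparison[OF _ lim])
    have "cmod ((cont_der a b n (u s) x - cont_der a b n (u t) x) /\<^sub>R (s - t) - cont_der a b n (v t) x) \<le>
        embed_const (b - a) * Sob_norm a b m (\<lambda>x. (u s x - u t x) /\<^sub>R (s - t) - v t x)" if s: "s \<in> I" for s
    proof -
      have S: "Sob a b m (\<lambda>x. of_real (inverse (s - t)) * (u s x - u t x))"
        by (intro Sob_scale Sob_diff u s t)
      have "cont_der a b n (\<lambda>x. of_real (inverse (s - t)) * (u s x - u t x)) x = (cont_der a b n (u s) x - cont_der a b n (u t) x) /\<^sub>R (s - t)"
        using cont_der_scale[OF ab Sob_diff[OF u[OF s] u[OF t]] n x] cont_der_diff[OF ab u[OF s] u[OF t] n x]
        by (simp add: scaleR_conv_of_real)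
      then show ?thesis
        using cont_der_diff_le[OF ab S v[OF t] n x] by (simp add: scaleR_conv_of_real)
    qed
    then show "\<forall>\<^sub>F s in at t within I. norm ((cont_der a b n (u s) x - cont_der a b n (u t) x) /\<^sub>R (s - t) - cont_der a b n (v t) x)
       \<le> embed_const (b - a) * Sob_norm a b m (\<lambda>x. (u s x - u t x) /\<^sub>R (s - t) - v t x)"
      by (auto simp: eventually_at_filter)
  qed
  then have "((\<lambda>s. (cont_der a b n (u s) x - cont_der a b n (u t) x) /\<^sub>R (s - t)) \<longlongrightarrow> cont_der a b n (v t) x) (at t within I)"
    by (simp add: LIM_zero_iff)
  then show ?thesis
    unfolding has_vector_derivative_def has_derivative_within
  proof (intro conjI bounded_linear_scaleR_left, goal_cases)
    case 1
    then have "((\<lambda>s. (cont_der a b n (u s) x - cont_der a b n (u t) x) /\<^sub>R (s - t) - cont_der a b n (v t) x) \<longlongrightarrow> 0) (at t within I)"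
      by (simp add: LIM_zero)
    then have "((\<lambda>s. norm ((cont_der a b n (u s) x - cont_der a b n (u t) x) /\<^sub>R (s - t) - cont_der a b n (v t) x)) \<longlongrightarrow> 0) (at t within I)"
      by (rule tendsto_norm_zero)
    then have "((\<lambda>s. norm ((1 / norm (s - t)) *\<^sub>R (cont_der a b n (u s) x - (cont_der a b n (u t) x + (s - t) *\<^sub>R cont_der a b n (v t) x)))) \<longlongrightarrow> 0) (at t within I)"
    proof (rule Lim_transform_eventually)
      show "\<forall>\<^sub>F s in at t within I. norm ((cont_der a b n (u s) x - cont_der a b n (u t) x) /\<^sub>R (s - t) - cont_der a b n (v t) x) =
        norm ((1 / norm (s - t)) *\<^sub>R (cont_der a b n (u s) x - (cont_der a b n (u t) x + (s - t) *\<^sub>R cont_der a b n (v t) x)))"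
      proof (rule eventually_at_filter[THEN iffD2], rule always_eventually, intro allI impI)
        fix s assume "s \<noteq> t"
        then have "(cont_der a b n (u s) x - cont_der a b n (u t) x) /\<^sub>R (s - t) - cont_der a b n (v t) x
           = inverse (s - t) *\<^sub>R (cont_der a b n (u s) x - (cont_der a b n (u t) x + (s - t) *\<^sub>R cont_der a b n (v t) x))"
          by (simp add: scaleR_diff_right scaleR_add_right)
        then show "norm ((cont_der a b n (u s) x - cont_der a b n (u t) x) /\<^sub>R (s - t) - cont_der a b n (v t) x) =
          norm ((1 / norm (s - t)) *\<^sub>R (cont_der a b n (u s) x - (cont_der a b n (u t) x + (s - t) *\<^sub>R cont_der a b n (v t) x)))"
          by (simp add: divide_inverse)
      qed
    qed
    then show ?case by (rule tendsto_norm_zero_cancel)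
  qed
qed

section \<open>Regular strong solutions are classical\<close>

lemma abs_mult_ln_le:
  assumes "0 \<le> r" "r \<le> 1" shows "r * \<bar>ln r\<bar> \<le> 2 * sqrt (r::real)"
proof (cases "r = 0")
  case False
  then have r: "0 < r" using assms by simp
  have "ln (1 / sqrt r) \<le> 1 / sqrt r - 1" using r by (intro ln_le_minus_one) simp
  moreover have "ln (1 / sqrt r) = - ln r / 2" using r by (simp add: ln_div ln_sqrt)
  moreover have "\<bar>ln r\<bar> = - ln r" using r assms by simp
  ultimately have "\<bar>ln r\<bar> \<le> 2 / sqrt r" using r by simp
  then have "r * \<bar>ln r\<bar> \<le> r * (2 / sqrt r)" using r by (intro mult_left_mono) auto
  also have "\<dots> = 2 * sqrt r" using r by (metis real_div_sqrt less_imp_le mult.commute times_divide_eq_right)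
  finally show ?thesis .
qed simp

lemma log_nl_eq: "0 \<le> \<epsilon> \<Longrightarrow> log_nl \<epsilon> z = z * of_real (2 * ln (\<epsilon> + cmod z))"
  by (cases "\<epsilon> + cmod z = 0") (auto simp: log_nl_def ln_realpow add_nonneg_eq_0_iff)

text \<open>
For $\<epsilon> = 0$ continuity at the origin holds because $r |\ln r| \<le> 2 \sqrt r$.  It is needed for the limit
equation to hold up to the boundary.
\<close>

lemma isCont_log_nl:
  assumes "0 \<le> \<epsilon>" shows "isCont (log_nl \<epsilon>) z"
proof (cases "\<epsilon> + cmod z = 0")
  case False
  then have "isCont (\<lambda>z. z * of_real (2 * ln (\<epsilon> + cmod z))) z"
    by (intro continuous_intros) auto
  moreover have "log_nl \<epsilon> = (\<lambda>z. z * of_real (2 * ln (\<epsilon> + cmod z)))"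
    using assms by (auto simp: log_nl_eq)
  ultimately show ?thesis by simp
next
  case True
  then have e: "\<epsilon> = 0" "z = 0" using assms by (auto simp: add_nonneg_eq_0_iff)
  have "(log_nl 0 \<longlongrightarrow> 0) (at 0)"
  proof (rule Lim_null_comparison)
    have "((\<lambda>w. 4 * sqrt (cmod w)) \<longlongrightarrow> 4 * sqrt (cmod 0)) (at (0::complex))"
      by (intro tendsto_intros)
    then show "((\<lambda>w. 4 * sqrt (cmod w)) \<longlongrightarrow> 0) (at (0::complex))" by simp
    have "cmod (log_nl 0 w) \<le> 4 * sqrt (cmod w)" if "cmod w < 1" for w
      using abs_mult_ln_le[of "cmod w"] that by (simp add: log_nl_eq norm_mult)
    then show "\<forall>\<^sub>F w in at 0. norm (log_nl 0 w) \<le> 4 * sqrt (cmod w)"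
      unfolding eventually_at by (auto intro!: exI[of _ 1])
  qed
  then show ?thesis using e by (simp add: isCont_def log_nl_eq)
qed

lemma continuous_on_log_nl:
  "0 \<le> \<epsilon> \<Longrightarrow> continuous_on S f \<Longrightarrow> continuous_on S (\<lambda>x. log_nl \<epsilon> (f x))"
  by (rule continuous_on_compose2[of UNIV]) (auto intro: continuous_at_imp_continuous_on isCont_log_nl)

lemma L2_norm_diff_power2_le:
  assumes f: "L2 a b f" and g: "L2 a b g"
  shows "(L2_norm a b (\<lambda>x. f x - g x))\<^sup>2 \<le> 2 * (L2_norm a b f)\<^sup>2 + 2 * (L2_norm a b g)\<^sup>2"
proof -
  have fg: "L2 a b (\<lambda>x. f x - g x)" using L2_add[OF f L2_scale[OF g, of "-1"]] by simp
  have "(L2_norm a b (\<lambda>x. f x - g x))\<^sup>2 \<le> (LINT x|Leb a b. 2 * (cmod (f x))\<^sup>2 + 2 * (cmod (g x))\<^sup>2)"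
    unfolding L2_norm_power2
  proof (rule Bochner_Integration.integral_mono)
    have "(cmod (p - q))\<^sup>2 \<le> 2 * (cmod p)\<^sup>2 + 2 * (cmod q)\<^sup>2" for p q
    proof -
      have "(cmod (p - q))\<^sup>2 \<le> (cmod p + cmod q)\<^sup>2" by (intro power_mono norm_triangle_ineq4) auto
      also have "\<dots> \<le> 2 * (cmod p)\<^sup>2 + 2 * (cmod q)\<^sup>2"
        using zero_le_power2[of "cmod p - cmod q"] by (simp add: power2_eq_square algebra_simps)
      finally show ?thesis .
    qed
    then show "(cmod (f x - g x))\<^sup>2 \<le> 2 * (cmod (f x))\<^sup>2 + 2 * (cmod (g x))\<^sup>2" for x .
  qed (use f g fg in \<open>auto simp: L2_def\<close>)
  then show ?thesis using f g by (simp add: L2_norm_power2 L2_def)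
qed

lemma L2_norm_0_imp_AE:
  assumes f: "L2 a b f" and "L2_norm a b f = 0" shows "AE x in Leb a b. f x = 0"
proof -
  have "(LINT x|Leb a b. (cmod (f x))\<^sup>2) = 0" using assms(2) L2_norm_power2[of a b f] by simp
  then have "AE x in Leb a b. (cmod (f x))\<^sup>2 = 0"
    using f by (subst (asm) integral_nonneg_eq_0_iff_AE) (auto simp: L2_def)
  then show ?thesis by eventually_elim simp
qed

lemma L2_norm_le_Sob_norm: "L2_norm a b f \<le> Sob_norm a b m f"
  using L2_norm_weak_der_le[of 0 m a b f] by (simp add: weak_der_def)

lemma L2_diff: "L2 a b f \<Longrightarrow> L2 a b g \<Longrightarrow> L2 a b (\<lambda>x. f x - g x)"
  using L2_add[of a b f "\<lambda>x. (-1) * g x"] L2_scale[of a b g "-1"] by simp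

text \<open>
A strong solution comes with a time derivative in $L^2$, a regular one with a time derivative in
$H^4$.  Limits in $L^2$ being unique, these agree, and the equation can be read in the smoother class.
\<close>

lemma time_derivative_unique:
  assumes d: "has_time_deriv_Sob I a b m u v" and d': "has_time_deriv_Sob J a b m' u v'" and J: "J \<subseteq> I" "t \<in> J"
    and nt: "at t within J \<noteq> bot" and u: "\<And>s. s \<in> J \<Longrightarrow> L2 a b (u s)" and v: "L2 a b (v t)" "L2 a b (v' t)"
  shows "AE x in Leb a b. v t x = v' t x"
proof -
  define q where "q s x = (u s x - u t x) /\<^sub>R (s - t)" for s x
  have q: "L2 a b (q s)" if "s \<in> J" for s
    using L2_scale[OF L2_diff[OF u[OF that] u[OF J(2)]], of "of_real (inverse (s - t))"]
    by (simp add: q_def[abs_def] scaleR_conv_of_real)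
  have "((\<lambda>s. Sob_norm a b m (\<lambda>x. q s x - v t x)) \<longlongrightarrow> 0) (at t within J)"
    using d J unfolding has_time_deriv_Sob_def q_def by (blast intro: tendsto_within_subset)
  moreover have "((\<lambda>s. Sob_norm a b m' (\<lambda>x. q s x - v' t x)) \<longlongrightarrow> 0) (at t within J)"
    using d' J unfolding has_time_deriv_Sob_def q_def by blast
  ultimately have "((\<lambda>s. 2 * (Sob_norm a b m (\<lambda>x. q s x - v t x))\<^sup>2 + 2 * (Sob_norm a b m' (\<lambda>x. q s x - v' t x))\<^sup>2)
      \<longlongrightarrow> 2 * 0\<^sup>2 + 2 * 0\<^sup>2) (at t within J)"
    by (intro tendsto_intros)
  moreover have "(L2_norm a b (\<lambda>x. v t x - v' t x))\<^sup>2 \<le>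
      2 * (Sob_norm a b m (\<lambda>x. q s x - v t x))\<^sup>2 + 2 * (Sob_norm a b m' (\<lambda>x. q s x - v' t x))\<^sup>2" if "s \<in> J" for s
  proof -
    have "(L2_norm a b (\<lambda>x. (q s x - v' t x) - (q s x - v t x)))\<^sup>2 \<le>
       2 * (L2_norm a b (\<lambda>x. q s x - v' t x))\<^sup>2 + 2 * (L2_norm a b (\<lambda>x. q s x - v t x))\<^sup>2"
      using q[OF that] v by (intro L2_norm_diff_power2_le L2_diff)
    also have "\<dots> \<le> 2 * (Sob_norm a b m' (\<lambda>x. q s x - v' t x))\<^sup>2 + 2 * (Sob_norm a b m (\<lambda>x. q s x - v t x))\<^sup>2"
      by (intro add_mono mult_left_mono power_mono L2_norm_le_Sob_norm) auto
    finally show ?thesis by (simp add: algebra_simps)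
  qed
  then have "\<forall>\<^sub>F s in at t within J. (L2_norm a b (\<lambda>x. v t x - v' t x))\<^sup>2 \<le>
      2 * (Sob_norm a b m (\<lambda>x. q s x - v t x))\<^sup>2 + 2 * (Sob_norm a b m' (\<lambda>x. q s x - v' t x))\<^sup>2"
    by (auto simp: eventually_at_filter)
  ultimately have "(L2_norm a b (\<lambda>x. v t x - v' t x))\<^sup>2 \<le> 0"
    using nt by (intro tendsto_lowerbound[where F = "at t within J"]) auto
  then have "AE x in Leb a b. v t x - v' t x = 0"
    using v by (intro L2_norm_0_imp_AE L2_diff) auto
  then show ?thesis by eventually_elim simp
qed

text \<open>
\<open>W j n t x\<close> is the value of the derivative of order \<open>j\<close> in time and \<open>n\<close> in space, and \<open>B\<close> bounds those
derivatives on which a uniform bound is assumed: orders 0 and 2 in time with at most three space derivatives, and order 3 in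
time with at most one.  Bounds on the first time derivative are
recovered by interpolation where they are used.  Fourth space derivatives enter through \<open>defect\<close> only.
\<close>

locale classical_solution =
  fixes a b T \<epsilon> B :: real and W :: "nat \<Rightarrow> nat \<Rightarrow> real \<Rightarrow> real \<Rightarrow> complex"
  assumes ab: "a < b" and T: "0 < T" and eps: "0 \<le> \<epsilon>"
    and joint: "\<And>j n. j \<le> 2 \<Longrightarrow> n \<le> 3 \<Longrightarrow> continuous_on ({0..T} \<times> {a..b}) (\<lambda>(t, x). W j n t x)"
    and dx: "\<And>j n t x. j \<le> 2 \<Longrightarrow> n < 3 \<Longrightarrow> t \<in> {0..T} \<Longrightarrow> x \<in> {a..b} \<Longrightarrow>
       (W j n t has_vector_derivative W j (Suc n) t x) (at x within {a..b})"
    and dx3: "\<And>t x. t \<in> {0..T} \<Longrightarrow> x \<in> {a..b} \<Longrightarrow>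
       (W 3 0 t has_vector_derivative W 3 1 t x) (at x within {a..b})"
    and dt: "\<And>j n t x. j < 2 \<Longrightarrow> n \<le> 3 \<Longrightarrow> t \<in> {0..T} \<Longrightarrow> x \<in> {a..b} \<Longrightarrow>
       ((\<lambda>s. W j n s x) has_vector_derivative W (Suc j) n t x) (at t within {0..T})"
    and dt2: "\<And>n t x. n \<le> 1 \<Longrightarrow> t \<in> {0..T} \<Longrightarrow> x \<in> {a..b} \<Longrightarrow>
       ((\<lambda>s. W 2 n s x) has_vector_derivative W 3 n t x) (at t within {0..T})"
    and bound: "\<And>j n t x. j \<in> {0, 2} \<Longrightarrow> n \<le> 3 \<Longrightarrow> t \<in> {0..T} \<Longrightarrow> x \<in> {a..b} \<Longrightarrow> cmod (W j n t x) \<le> B"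
    and bound3: "\<And>n t x. n \<le> 1 \<Longrightarrow> t \<in> {0..T} \<Longrightarrow> x \<in> {a..b} \<Longrightarrow> cmod (W 3 n t x) \<le> B"
    and defect_le: "\<And>j J M t. j \<in> {0, 2} \<Longrightarrow> J < M \<Longrightarrow> t \<in> {0..T} \<Longrightarrow>
       cmod (defect a b M J (W j 1 t) (W j 2 t)) \<le> (mesh a b M)\<^sup>2 * B"
    and pde: "\<And>t x. t \<in> {0..T} \<Longrightarrow> x \<in> {a..b} \<Longrightarrow> \<i> * W 1 0 t x + W 0 2 t x = log_nl \<epsilon> (W 0 0 t x)"
    and bdry: "\<And>t. t \<in> {0..T} \<Longrightarrow> W 0 0 t a = 0 \<and> W 0 0 t b = 0"

lemma continuous_slices:
  assumes "continuous_on (I \<times> S) (\<lambda>(t, x). f t x)"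
  shows "x \<in> S \<Longrightarrow> continuous_on I (\<lambda>t. f t x)" and "t \<in> I \<Longrightarrow> continuous_on S (f t)"
proof -
  show "continuous_on I (\<lambda>t. f t x)" if "x \<in> S"
  proof -
    have "continuous_on I (\<lambda>t. (case (t, x) of (t, x) \<Rightarrow> f t x))"
      by (rule continuous_on_compose2[OF assms]) (use that in \<open>auto intro!: continuous_intros\<close>)
    then show ?thesis by simp
  qed
  show "continuous_on S (f t)" if "t \<in> I"
  proof -
    have "continuous_on S (\<lambda>x. (case (t, x) of (t, x) \<Rightarrow> f t x))"
      by (rule continuous_on_compose2[OF assms]) (use that in \<open>auto intro!: continuous_intros\<close>)
    then show ?thesis by simp
  qed
qed

lemma ereal_nonneg_sum3_le:
  fixes p q r :: ereal
  assumes "0 \<le> p" "0 \<le> q" "0 \<le> r" "p + q + r \<le> c"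
  shows "p \<le> c" "q \<le> c" "r \<le> c"
proof -
  have "p \<le> p + q" "q \<le> p + q" "p + q \<le> p + q + r" "r \<le> p + q + r"
    using assms by (auto intro: add_increasing add_increasing2)
  then show "p \<le> c" "q \<le> c" "r \<le> c" using assms(4) by (meson order_trans)+
qed

text \<open>
The continuous representatives of the weak derivatives serve as \<open>W\<close>.  Essential bounds in time extend
to all times by continuity, and the equation, an identity of continuous functions almost
everywhere, holds up to the boundary.
\<close>

lemma regular_imp_classical:
  assumes ab: "a < b" and T: "0 < T" and eps: "0 \<le> \<epsilon>" and C0: "0 < C0"
    and sol: "solves a b \<epsilon> u0 u S" and TS: "ereal T < S" and reg: "regular a b T C0 u"
  shows "\<exists>W. classical_solution a b T \<epsilon> (embed_const (b - a) * C0) W \<and>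
     (\<forall>t\<in>{0..T}. Sob a b 4 (u t) \<and> continuous_on {a..b} (u t) \<and> (\<forall>n. W 0 n t = cont_der a b n (u t))
        \<and> (\<forall>x\<in>{a..b}. W 0 0 t x = u t x)) \<and> (\<forall>x\<in>{a..b}. u 0 x = u0 x)"
proof -
  obtain D where D: "D 0 = u" "cont_Sob {0..T} a b 5 u" "Ck_Sob {0..T} a b 2 4 D" "Ck_Sob {0..T} a b 3 2 D"
      "Linf_Sob T a b 5 u + Linf_Sob T a b 4 (D 2) + Linf_Sob T a b 2 (D 3) \<le> ereal C0"
    using reg unfolding regular_def by blast
  define K where "K = embed_const (b - a)"
  have K: "0 \<le> K" using ab by (auto simp: K_def embed_const_def)
  define I where "I = {t. 0 \<le> t \<and> ereal t < S}"
  have TI: "{0..T} \<subseteq> I" 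
  proof
    fix t assume "t \<in> {0..T}"
    then have "0 \<le> t" "ereal t \<le> ereal T" by auto
    then show "t \<in> I" using order_le_less_trans[OF _ TS, of "ereal t"] by (simp add: I_def)
  qed
  from sol obtain v where v: "cont_Sob I a b 0 v" "has_time_deriv_Sob I a b 0 u v"
     "\<And>t. t \<in> I \<Longrightarrow> AE x in Leb a b. \<i> * v t x + wderiv a b 2 (u t) x = log_nl \<epsilon> (u t x)"
     and cu: "\<And>t. t \<in> I \<Longrightarrow> continuous_on {a..b} (u t)" and init: "\<forall>x\<in>{a..b}. u 0 x = u0 x"
     and bd: "\<And>t. t \<in> I \<Longrightarrow> u t a = 0 \<and> u t b = 0"
    unfolding solves_def Let_def I_def by blast
  define W where "W j n t = cont_der a b n (D j t)" for j n t
  have c4: "cont_Sob {0..T} a b 4 (D j)" if "j \<le> 2" for j using D(3) that by (simp add: Ck_Sob_def)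
  have c2: "cont_Sob {0..T} a b 2 (D j)" if "j \<le> 3" for j using D(4) that by (simp add: Ck_Sob_def)
  have S4: "Sob a b 4 (D j t)" if "j \<le> 2" "t \<in> {0..T}" for j t using c4[OF that(1)] that by (simp add: cont_Sob_def)
  have S2: "Sob a b 2 (D j t)" if "j \<le> 3" "t \<in> {0..T}" for j t using c2[OF that(1)] that by (simp add: cont_Sob_def)
  have joint: "continuous_on ({0..T} \<times> {a..b}) (\<lambda>(t, x). W j n t x)" if "j \<le> 2" "n \<le> 3" for j n
    unfolding W_def by (rule cont_der_jointly_continuous[OF ab c4[OF that(1)]]) (use that in auto)
  have joint3: "continuous_on ({0..T} \<times> {a..b}) (\<lambda>(t, x). W 3 n t x)" if "n \<le> 1" for n
    unfolding W_def by (rule cont_der_jointly_continuous[OF ab c2]) (use that in auto)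
  have W0: "W 0 0 t x = u t x" if "t \<in> {0..T}" "x \<in> {a..b}" for t x
    unfolding W_def D(1) by (rule cont_der_0[OF ab S4[of 0 t, unfolded D(1)] _ cu]) (use that TI in auto)
  have L: "Linf_Sob T a b 5 u \<le> ereal C0" "Linf_Sob T a b 4 (D 2) \<le> ereal C0" "Linf_Sob T a b 2 (D 3) \<le> ereal C0"
    using ereal_nonneg_sum3_le[OF Linf_Sob_nonneg[OF T] Linf_Sob_nonneg[OF T] Linf_Sob_nonneg[OF T] D(5)] by auto
  have AE4: "AE t in Leb 0 T. Sob_norm a b 4 (D j t) \<le> C0" if "j \<in> {0, 2}" for j
  proof (cases "j = 0")
    case True
    then show ?thesis using Linf_Sob_AE[OF L(1)] Sob_norm_mono[of 4 5 a b] D(1)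
      by (auto elim!: eventually_mono intro: order_trans)
  next
    case False
    then show ?thesis using Linf_Sob_AE[OF L(2)] that by simp
  qed
  have AE3: "AE t in Leb 0 T. Sob_norm a b 2 (D 3 t) \<le> C0" by (rule Linf_Sob_AE[OF L(3)])
  have inT: "AE t in Leb 0 T. t \<in> {0..T}" by (rule AE_I2) auto
  have bound: "cmod (W j n t x) \<le> K * C0" if "j \<in> {0, 2}" "n \<le> 3" "t \<in> {0..T}" "x \<in> {a..b}" for j n t x
  proof (rule AE_le_imp_le[OF T _ _ that(3)])
    show "continuous_on {0..T} (\<lambda>t. cmod (W j n t x))"
      using continuous_slices(1)[OF joint[of j n] that(4)] that by (auto intro: continuous_on_norm)
    show "AE t in Leb 0 T. cmod (W j n t x) \<le> K * C0"
      using AE4[OF that(1)] inT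
    proof eventually_elim
      case (elim t)
      have "cmod (W j n t x) \<le> K * Sob_norm a b 4 (D j t)"
        unfolding W_def K_def embed_const_def by (rule cont_der_bound[OF ab S4 _ that(4)]) (use elim that in auto)
      also have "\<dots> \<le> K * C0" using elim K by (intro mult_left_mono)
      finally show ?case .
    qed
  qed
  have bound3: "cmod (W 3 n t x) \<le> K * C0" if "n \<le> 1" "t \<in> {0..T}" "x \<in> {a..b}" for n t x
  proof (rule AE_le_imp_le[OF T _ _ that(2)])
    show "continuous_on {0..T} (\<lambda>t. cmod (W 3 n t x))"
      using continuous_slices(1)[OF joint3[of n] that(3)] that by (auto intro: continuous_on_norm)
    show "AE t in Leb 0 T. cmod (W 3 n t x) \<le> K * C0"
      using AE3 inT
    proof eventually_elim
      case (elim t)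
      have "cmod (W 3 n t x) \<le> K * Sob_norm a b 2 (D 3 t)"
        unfolding W_def K_def embed_const_def by (rule cont_der_bound[OF ab S2 _ that(3)]) (use elim that in auto)
      also have "\<dots> \<le> K * C0" using elim K by (intro mult_left_mono)
      finally show ?case .
    qed
  qed
  have defect_le: "cmod (defect a b M J (W j 1 t) (W j 2 t)) \<le> (mesh a b M)\<^sup>2 * (K * C0)"
    if j: "j \<in> {0, 2}" and J: "J < M" and t: "t \<in> {0..T}" for j J M t
  proof (rule AE_le_imp_le[OF T _ _ t])
    have h: "a \<le> node a b M l - mesh a b M / 2" "node a b M l + mesh a b M / 2 \<le> b" "0 < mesh a b M"
      if "l \<in> {1..J}" for l
      using node_half_in[OF ab, of l M] mesh_pos[OF ab, of M] that J by auto
    have c: "continuous_on {0..T} (\<lambda>t. W j n t x)" if "x \<in> {a..b}" "n \<le> 3" for n x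
      using continuous_slices(1)[OF joint that(1)] that j by auto
    show "continuous_on {0..T} (\<lambda>t. cmod (defect a b M J (W j 1 t) (W j 2 t)))"
      unfolding defect_def
    proof (intro continuous_intros c)
      fix l assume "l \<in> {1..J}"
      from h[OF this] show "node a b M l + mesh a b M / 2 \<in> {a..b}" "node a b M l - mesh a b M / 2 \<in> {a..b}" "node a b M l \<in> {a..b}"
        by auto
    qed auto
    show "AE t in Leb 0 T. cmod (defect a b M J (W j 1 t) (W j 2 t)) \<le> (mesh a b M)\<^sup>2 * (K * C0)"
      using AE4[OF j] inT
    proof eventually_elim
      case (elim t)
      have "cmod (defect a b M J (W j 1 t) (W j 2 t)) \<le> (mesh a b M)\<^sup>2 * (sqrt (b - a) * Sob_norm a b 4 (D j t))"
        unfolding W_def by (rule defect_Sob[OF ab S4 J]) (use elim j in auto)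
      also have "\<dots> \<le> (mesh a b M)\<^sup>2 * (K * C0)"
        using elim ab by (intro mult_left_mono mult_mono) (auto simp: K_def embed_const_def)
      finally show ?case .
    qed
  qed
  have pde: "\<i> * W 1 0 t x + W 0 2 t x = log_nl \<epsilon> (W 0 0 t x)" if t: "t \<in> {0..T}" and x: "x \<in> {a..b}" for t x
  proof (rule continuous_AE_eq[OF ab _ _ _ x])
    have cW: "continuous_on {a..b} (W j n t)" if "j \<le> 2" "n \<le> 3" for j n
      using continuous_slices(2)[OF joint[OF that] t] .
    show "continuous_on {a..b} (\<lambda>x. \<i> * W 1 0 t x + W 0 2 t x)"
      by (intro continuous_intros cW) auto
    show "continuous_on {a..b} (\<lambda>x. log_nl \<epsilon> (W 0 0 t x))"
      by (intro continuous_on_log_nl eps cW) auto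
    have tI: "t \<in> I" using t TI by blast
    have d1: "has_time_deriv_Sob {0..T} a b 4 u (D 1)"
      using D(1,3) unfolding Ck_Sob_def by (metis One_nat_def zero_less_numeral)
    have "at t within {0..T} \<noteq> bot" using t T by (simp add: trivial_limit_within islimpt_Icc)
    then have "AE x in Leb a b. v t x = D 1 t x"
      using v(1) tI S4[of 0] S4[of 1 t] t D(1)
      by (intro time_derivative_unique[OF v(2) d1 TI t]) (auto simp: cont_Sob_def intro: Sob_L2)
    moreover have "AE x in Leb a b. weak_der a b 0 (D 1 t) x = W 1 0 t x"
      unfolding W_def by (rule cont_der_AE[OF ab S4]) (use t in auto)
    moreover have "AE x in Leb a b. weak_der a b 2 (D 0 t) x = W 0 2 t x"
      unfolding W_def by (rule cont_der_AE[OF ab S4]) (use t in auto)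
    moreover have "AE x in Leb a b. x \<in> {a..b}" by (rule AE_I2) auto
    ultimately show "AE x in Leb a b. \<i> * W 1 0 t x + W 0 2 t x = log_nl \<epsilon> (W 0 0 t x)"
      using v(3)[OF tI]
    proof eventually_elim
      case (elim x)
      then show ?case using W0[OF t, of x] by (simp add: weak_der_def D(1))
    qed
  qed
  have "classical_solution a b T \<epsilon> (K * C0) W"
  proof
    fix j n t x assume j: "j \<le> (2::nat)" and n: "n < (3::nat)" and t: "t \<in> {0..T}" and x: "x \<in> {a..b}"
    show "(W j n t has_vector_derivative W j (Suc n) t x) (at x within {a..b})"
      unfolding W_def by (rule cont_der_has_derivative[OF ab S4 _ x]) (use j n t in auto)
  next
    fix t x assume t: "t \<in> {0..T}" and x: "x \<in> {a..b}"
    show "(W 3 0 t has_vector_derivative W 3 1 t x) (at x within {a..b})"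
      unfolding W_def using cont_der_has_derivative[OF ab S2[of 3 t] _ x, of 0] t by simp
  next
    fix j n t x assume j: "j < (2::nat)" and n: "n \<le> (3::nat)" and t: "t \<in> {0..T}" and x: "x \<in> {a..b}"
    have "has_time_deriv_Sob {0..T} a b 4 (D j) (D (Suc j))" using D(3) j by (simp add: Ck_Sob_def)
    then show "((\<lambda>s. W j n s x) has_vector_derivative W (Suc j) n t x) (at t within {0..T})"
      unfolding W_def by (rule cont_der_time_derivative[OF ab _ S4 S4 _ t x]) (use j n in auto)
  next
    fix n t x assume n: "n \<le> (1::nat)" and t: "t \<in> {0..T}" and x: "x \<in> {a..b}"
    have "\<forall>j<3. has_time_deriv_Sob {0..T} a b 2 (D j) (D (Suc j))" using D(4) by (simp add: Ck_Sob_def)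
    from this[rule_format, of 2] have "has_time_deriv_Sob {0..T} a b 2 (D 2) (D 3)" by simp
    then show "((\<lambda>s. W 2 n s x) has_vector_derivative W 3 n t x) (at t within {0..T})"
      unfolding W_def by (rule cont_der_time_derivative[OF ab _ S2 S2 _ t x]) (use n in auto)
  next
    fix t assume t: "t \<in> {0..T}"
    then show "W 0 0 t a = 0 \<and> W 0 0 t b = 0"
      using W0[OF t, of a] W0[OF t, of b] bd[of t] TI ab by auto
  qed (use ab T eps joint bound bound3 defect_le pde in auto)
  moreover have "\<forall>t\<in>{0..T}. Sob a b 4 (u t) \<and> continuous_on {a..b} (u t) \<and> (\<forall>n. W 0 n t = cont_der a b n (u t)) \<and> (\<forall>x\<in>{a..b}. W 0 0 t x = u t x)"
    using S4[of 0] cu TI W0 D(1) by (auto simp: W_def)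
  ultimately show ?thesis using init unfolding K_def by blast
qed

section \<open>Distance between the regularized and the limit solution\<close>

lemma inner_i_self: "inner (z::complex) (\<i> * z) = 0"
  by (simp add: inner_complex_def)

lemma abs_ln_diff_mult_le:
  assumes "0 \<le> \<epsilon>" "0 \<le> r" "r \<le> s"
  shows "r * \<bar>ln (\<epsilon> + s) - ln (\<epsilon> + r)\<bar> \<le> s - (r::real)"
proof (cases "r = 0")
  case False
  then have r: "0 < r" using assms by simp
  have "ln (\<epsilon> + s) - ln (\<epsilon> + r) = ln ((\<epsilon> + s) / (\<epsilon> + r))" using assms r by (simp add: ln_div)
  also have "\<dots> \<le> (\<epsilon> + s) / (\<epsilon> + r) - 1" using assms r by (intro ln_le_minus_one) (auto intro: divide_pos_pos)
  also have "\<dots> = (s - r) / (\<epsilon> + r)" using assms r by (simp add: field_simps)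
  also have "\<dots> \<le> (s - r) / r" using assms r by (intro divide_left_mono) auto
  finally have "ln (\<epsilon> + s) - ln (\<epsilon> + r) \<le> (s - r) / r" .
  moreover have "ln (\<epsilon> + r) \<le> ln (\<epsilon> + s)" using assms r by simp
  ultimately have "r * \<bar>ln (\<epsilon> + s) - ln (\<epsilon> + r)\<bar> \<le> r * ((s - r) / r)" using r by (intro mult_left_mono) auto
  then show ?thesis using r by simp
qed (use assms in simp)

text \<open>
Writing $f(z) = z g(|z|)$ with real $g$, the inner product equals $(g(|z|) - g(|w|))$ times the inner
product of $w$ and $i z$.  The latter is at most $|w - z| \min(|w|,|z|)$, and the minimum compensates
the singularity of the logarithm.
\<close>

lemma log_nl_dissipative:
  assumes e: "0 \<le> \<epsilon>"
  shows "inner (w - z) (- \<i> * (log_nl \<epsilon> w - log_nl \<epsilon> z)) \<le> 2 * (cmod (w - z))\<^sup>2"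
proof -
  let ?g = "\<lambda>z. 2 * ln (\<epsilon> + cmod z)"
  have eq: "inner (w - z) (- \<i> * (log_nl \<epsilon> w - log_nl \<epsilon> z)) = inner w (\<i> * z) * (?g z - ?g w)"
    by (simp add: log_nl_eq[OF e] inner_complex_def algebra_simps)
  have "inner w (\<i> * z) = inner (w - z) (\<i> * z)" "inner w (\<i> * z) = inner (w - z) (\<i> * w)"
    by (simp_all add: inner_complex_def algebra_simps)
  then have b: "\<bar>inner w (\<i> * z)\<bar> \<le> cmod (w - z) * cmod z" "\<bar>inner w (\<i> * z)\<bar> \<le> cmod (w - z) * cmod w"
    using Cauchy_Schwarz_ineq2[of "w - z" "\<i> * z"] Cauchy_Schwarz_ineq2[of "w - z" "\<i> * w"] by (simp_all add: norm_mult)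
  have d: "\<bar>cmod w - cmod z\<bar> \<le> cmod (w - z)" by (rule norm_triangle_ineq3)
  have "\<bar>inner w (\<i> * z)\<bar> * \<bar>?g z - ?g w\<bar> \<le> 2 * (cmod (w - z))\<^sup>2"
  proof -
    define m where "m = min (cmod w) (cmod z)"
    have m: "\<bar>inner w (\<i> * z)\<bar> \<le> cmod (w - z) * m" using b by (auto simp: m_def min_def)
    have "m * \<bar>ln (\<epsilon> + cmod z) - ln (\<epsilon> + cmod w)\<bar> \<le> \<bar>cmod w - cmod z\<bar>"
      using abs_ln_diff_mult_le[OF e, of "cmod w" "cmod z"] abs_ln_diff_mult_le[OF e, of "cmod z" "cmod w"]
      by (cases "cmod w \<le> cmod z") (auto simp: m_def min_def abs_minus_commute)
    moreover have "\<bar>2 * p - 2 * q\<bar> = 2 * \<bar>p - q\<bar>" for p q :: real by (auto simp: abs_if)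
    ultimately have l: "m * \<bar>?g z - ?g w\<bar> \<le> 2 * cmod (w - z)"
      using d by (simp only: mult.left_commute[of m 2])
    have "\<bar>inner w (\<i> * z)\<bar> * \<bar>?g z - ?g w\<bar> \<le> (cmod (w - z) * m) * \<bar>?g z - ?g w\<bar>"
      by (intro mult_right_mono m) auto
    also have "\<dots> = cmod (w - z) * (m * \<bar>?g z - ?g w\<bar>)" by simp
    also have "\<dots> \<le> cmod (w - z) * (2 * cmod (w - z))" by (intro mult_left_mono l) auto
    finally show ?thesis by (simp add: power2_eq_square)
  qed
  then show ?thesis unfolding eq by (simp add: abs_mult[symmetric])
qed

lemma log_nl_regularization_error:
  assumes e: "0 \<le> \<epsilon>" shows "cmod (log_nl \<epsilon> z - log_nl 0 z) \<le> 2 * \<epsilon>"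
proof -
  have "log_nl \<epsilon> z - log_nl 0 z = z * of_real (2 * (ln (\<epsilon> + cmod z) - ln (0 + cmod z)))"
    by (simp add: log_nl_eq e algebra_simps)
  then have "cmod (log_nl \<epsilon> z - log_nl 0 z) = cmod z * \<bar>2 * (ln (\<epsilon> + cmod z) - ln (0 + cmod z))\<bar>"
    by (simp only: norm_mult norm_of_real)
  then have "cmod (log_nl \<epsilon> z - log_nl 0 z) = 2 * (cmod z * \<bar>ln (0 + (\<epsilon> + cmod z)) - ln (0 + cmod z)\<bar>)"
    unfolding abs_mult by simp
  also have "\<dots> \<le> 2 * ((\<epsilon> + cmod z) - cmod z)"
    by (intro mult_left_mono abs_ln_diff_mult_le) (use e in auto)
  finally show ?thesis by simp
qed

lemma integral_Cauchy_Schwarz: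
  fixes f g :: "real \<Rightarrow> complex"
  assumes f: "continuous_on {a..b} f" and g: "continuous_on {a..b} g"
  shows "(integral {a..b} (\<lambda>x. inner (f x) (g x)))\<^sup>2 \<le> integral {a..b} (\<lambda>x. (cmod (f x))\<^sup>2) * integral {a..b} (\<lambda>x. (cmod (g x))\<^sup>2)"
proof -
  define X Y G where "X = integral {a..b} (\<lambda>x. (cmod (f x))\<^sup>2)" and "Y = integral {a..b} (\<lambda>x. inner (f x) (g x))"
    and "G = integral {a..b} (\<lambda>x. (cmod (g x))\<^sup>2)"
  have i: "(\<lambda>x. (cmod (f x))\<^sup>2) integrable_on {a..b}" "(\<lambda>x. inner (f x) (g x)) integrable_on {a..b}"
     "(\<lambda>x. (cmod (g x))\<^sup>2) integrable_on {a..b}"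
    by (intro integrable_continuous_real continuous_intros f g)+
  have q: "0 \<le> p\<^sup>2 * X + 2 * p * q * Y + q\<^sup>2 * G" for p q
  proof -
    have "0 \<le> integral {a..b} (\<lambda>x. (cmod (p *\<^sub>R f x + q *\<^sub>R g x))\<^sup>2)"
      by (intro Henstock_Kurzweil_Integration.integral_nonneg integrable_continuous_real continuous_intros f g) auto
    also have "\<dots> = integral {a..b} (\<lambda>x. p\<^sup>2 * (cmod (f x))\<^sup>2 + 2 * p * q * inner (f x) (g x) + q\<^sup>2 * (cmod (g x))\<^sup>2)"
      unfolding power2_norm_eq_inner
      by (rule Henstock_Kurzweil_Integration.integral_cong) (simp add: inner_add_left inner_add_right inner_commute power2_eq_square algebra_simps)
    also have "\<dots> = p\<^sup>2 * X + 2 * p * q * Y + q\<^sup>2 * G"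
      unfolding X_def Y_def G_def
      by (intro integral_unique has_integral_add has_integral_mult_right integrable_integral i)
    finally show ?thesis .
  qed
  have XG: "0 \<le> X" "0 \<le> G" using q[of 1 0] q[of 0 1] by simp_all
  show ?thesis
  proof (cases "X = 0")
    case True
    have "Y = 0"
    proof (rule ccontr)
      assume "Y \<noteq> 0"
      then show False using q[of "- (G + 1) / (2 * Y)" 1] True by (simp add: field_simps)
    qed
    then show ?thesis using XG by (simp add: X_def[symmetric] Y_def[symmetric] G_def[symmetric])
  next
    case False
    have "0 \<le> Y\<^sup>2 * X + 2 * (- Y) * X * Y + X\<^sup>2 * G" using q[of "- Y" X] by simp
    also have "\<dots> = X * (X * G - Y\<^sup>2)" by (simp add: power2_eq_square algebra_simps)
    finally have "0 \<le> X * G - Y\<^sup>2" using False XG by (simp add: zero_le_mult_iff)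
    then show ?thesis by (simp add: X_def[symmetric] Y_def[symmetric] G_def[symmetric])
  qed
qed

text \<open>
With $I_n = \|f^{(n)}\|^2$, integration by parts and the Cauchy-Schwarz inequality give
$I_1^2 \<le> I_0 I_2$ and $I_2^2 \<le> I_1 I_3$; eliminating $I_2$ yields the claim.
\<close>

lemma interpolation_inequality:
  fixes f :: "nat \<Rightarrow> real \<Rightarrow> complex"
  assumes ab: "a < b" and d: "\<And>n x. n < 3 \<Longrightarrow> x \<in> {a..b} \<Longrightarrow> (f n has_vector_derivative f (Suc n) x) (at x within {a..b})"
    and c: "continuous_on {a..b} (f 3)"
    and z: "f 0 a = 0" "f 0 b = 0" "f 2 a = 0" "f 2 b = 0"
  defines "I \<equiv> \<lambda>n. integral {a..b} (\<lambda>x. (cmod (f n x))\<^sup>2)"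
  shows "(I 1) ^ 3 \<le> (I 0)\<^sup>2 * I 3"
proof -
  have cf: "continuous_on {a..b} (f n)" if "n \<le> 3" for n
  proof (cases "n = 3")
    case False
    then show ?thesis
      unfolding continuous_on_eq_continuous_within
      using has_vector_derivative_continuous[OF d[of n]] that by auto
  qed (use c in simp)
  have nn: "0 \<le> I n" if "n \<le> 3" for n
    unfolding I_def using cf[OF that] by (intro Henstock_Kurzweil_Integration.integral_nonneg integrable_continuous_real continuous_intros) auto
  have step: "(I (Suc n))\<^sup>2 \<le> I n * I (Suc (Suc n))" 
    if n: "Suc n < 3" and bz: "inner (f n a) (f (Suc n) a) = 0" "inner (f n b) (f (Suc n) b) = 0" for n
  proof -
    have "((\<lambda>x. inner (f n x) (f (Suc n) x)) has_vector_derivative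
        inner (f n x) (f (Suc (Suc n)) x) + inner (f (Suc n) x) (f (Suc n) x)) (at x within {a..b})" if "x \<in> {a..b}" for x
      by (rule bounded_bilinear.has_vector_derivative[OF bounded_bilinear_inner]) (use d[of n x] d[of "Suc n" x] n that in auto)
    then have "((\<lambda>x. inner (f n x) (f (Suc (Suc n)) x) + inner (f (Suc n) x) (f (Suc n) x)) has_integral
        inner (f n b) (f (Suc n) b) - inner (f n a) (f (Suc n) a)) {a..b}"
      using ab by (intro fundamental_theorem_of_calculus) auto
    then have "integral {a..b} (\<lambda>x. inner (f n x) (f (Suc (Suc n)) x) + inner (f (Suc n) x) (f (Suc n) x)) = 0"
      using bz by (simp add: integral_unique)
    moreover have "integral {a..b} (\<lambda>x. inner (f n x) (f (Suc (Suc n)) x) + inner (f (Suc n) x) (f (Suc n) x)) =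
        integral {a..b} (\<lambda>x. inner (f n x) (f (Suc (Suc n)) x)) + I (Suc n)"
      unfolding I_def power2_norm_eq_inner
      by (intro Henstock_Kurzweil_Integration.integral_add integrable_continuous_real continuous_intros cf) (use n in auto)
    ultimately have "I (Suc n) = - integral {a..b} (\<lambda>x. inner (f n x) (f (Suc (Suc n)) x))" by simp
    then have "(I (Suc n))\<^sup>2 = (integral {a..b} (\<lambda>x. inner (f n x) (f (Suc (Suc n)) x)))\<^sup>2" by simp
    also have "\<dots> \<le> I n * I (Suc (Suc n))"
      unfolding I_def by (rule integral_Cauchy_Schwarz) (use n in \<open>auto intro: cf\<close>)
    finally show ?thesis .
  qed
  have 1: "(I 1)\<^sup>2 \<le> I 0 * I 2" using step[of 0] z by (simp add: numeral_eq_Suc)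
  have 2: "(I 2)\<^sup>2 \<le> I 1 * I 3" using step[of 1] z by (simp add: numeral_eq_Suc)
  show ?thesis
  proof (cases "I 1 = 0")
    case False
    then have p: "0 < I 1" using nn[of 1] by simp
    have "I 1 * I 1 ^ 3 = ((I 1)\<^sup>2)\<^sup>2" by (simp add: power2_eq_square power3_eq_cube)
    also have "\<dots> \<le> (I 0 * I 2)\<^sup>2" by (intro power_mono 1) simp
    also have "\<dots> = (I 0)\<^sup>2 * (I 2)\<^sup>2" by (simp add: power_mult_distrib)
    also have "\<dots> \<le> (I 0)\<^sup>2 * (I 1 * I 3)" by (intro mult_left_mono 2) simp
    also have "\<dots> = I 1 * ((I 0)\<^sup>2 * I 3)" by simp
    finally show ?thesis using p by simp
  qed (use nn[of 3] in simp)
qed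

lemma vector_derivative_of_zero:
  assumes "((\<lambda>s. f s) has_vector_derivative f') (at t within {0..T})" "0 < T" "t \<in> {0..T}" "\<And>s. s \<in> {0..T} \<Longrightarrow> f s = 0"
  shows "f' = 0"
proof -
  have "((\<lambda>s. 0) has_vector_derivative f') (at t within {0..T})"
    by (rule has_vector_derivative_transform[OF assms(3) _ assms(1)]) (use assms(4) in auto)
  moreover have "((\<lambda>s. 0) has_vector_derivative 0) (at t within {0..T})" by simp
  ultimately show ?thesis
    using vector_derivative_unique_within_closed_interval[of 0 T t] assms(2,3) by (metis atLeastAtMost_iff cbox_interval)
qed

context classical_solution
begin

lemma bdry_time: assumes "j \<le> 2" "t \<in> {0..T}" shows "W j 0 t a = 0 \<and> W j 0 t b = 0"
  using assms
proof (induction j arbitrary: t)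
  case 0
  then show ?case using bdry by simp
next
  case (Suc j)
  have "W (Suc j) 0 t x = 0" if "x \<in> {a, b}" for x
    by (rule vector_derivative_of_zero[OF dt[of j 0 t x] T]) (use Suc that ab in auto)
  then show ?case by simp
qed

text \<open>
At the boundary the solution and its time derivative vanish, hence by the equation so does the
second space derivative.
\<close>

lemma bdry_xx: assumes "t \<in> {0..T}" shows "W 0 2 t a = 0 \<and> W 0 2 t b = 0"
proof -
  have "W 0 2 t x = 0" if x: "x \<in> {a, b}" for x
    using pde[OF assms, of x] bdry_time[of 0 t] bdry_time[of 1 t] assms x ab by (auto simp: log_nl_def)
  then show ?thesis by simp
qed

lemma cont_x: "j \<le> 2 \<Longrightarrow> n \<le> 3 \<Longrightarrow> t \<in> {0..T} \<Longrightarrow> continuous_on {a..b} (W j n t)"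
  by (rule continuous_slices(2)[OF joint])

end

text \<open>
A solution of the regularized equation and one of the limit equation, with common initial values.
\<close>

locale solution_pair = V: classical_solution a b T \<epsilon> B W + Z: classical_solution a b T 0 B Z
  for a b T \<epsilon> B W Z +
  assumes same_init: "\<And>x. x \<in> {a..b} \<Longrightarrow> W 0 0 0 x = Z 0 0 0 x"
begin

definition gap :: "nat \<Rightarrow> real \<Rightarrow> real \<Rightarrow> complex" where "gap n t x = W 0 n t x - Z 0 n t x"

definition gap_energy :: "nat \<Rightarrow> real \<Rightarrow> real" where "gap_energy n t = integral {a..b} (\<lambda>x. (cmod (gap n t x))\<^sup>2)"

lemma gap_joint: "n \<le> 3 \<Longrightarrow> continuous_on ({0..T} \<times> {a..b}) (\<lambda>(t, x). gap n t x)"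
  using continuous_on_diff[OF V.joint[of 0 n] Z.joint[of 0 n]] by (simp add: gap_def split_beta')

lemma gap_cont: "n \<le> 3 \<Longrightarrow> t \<in> {0..T} \<Longrightarrow> continuous_on {a..b} (gap n t)"
  by (rule continuous_slices(2)[OF gap_joint])

lemma gap_dx: "n < 3 \<Longrightarrow> t \<in> {0..T} \<Longrightarrow> x \<in> {a..b} \<Longrightarrow> (gap n t has_vector_derivative gap (Suc n) t x) (at x within {a..b})"
  using has_vector_derivative_diff[OF V.dx[of 0 n t x] Z.dx[of 0 n t x]] by (simp add: gap_def[abs_def])

lemma gap_bound: "n \<le> 3 \<Longrightarrow> t \<in> {0..T} \<Longrightarrow> x \<in> {a..b} \<Longrightarrow> cmod (gap n t x) \<le> 2 * B"
  using V.bound[of 0 n t x] Z.bound[of 0 n t x] norm_triangle_ineq4[of "W 0 n t x" "Z 0 n t x"] by (simp add: gap_def)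

lemma gap_bdry: "t \<in> {0..T} \<Longrightarrow> gap 0 t a = 0 \<and> gap 0 t b = 0 \<and> gap 2 t a = 0 \<and> gap 2 t b = 0"
  using V.bdry Z.bdry V.bdry_xx Z.bdry_xx by (simp add: gap_def)

lemma gap_energy_nonneg: "n \<le> 3 \<Longrightarrow> t \<in> {0..T} \<Longrightarrow> 0 \<le> gap_energy n t"
  unfolding gap_energy_def by (intro Henstock_Kurzweil_Integration.integral_nonneg integrable_continuous_real continuous_intros gap_cont) auto

lemma gap_energy_continuous: "n \<le> 3 \<Longrightarrow> continuous_on {0..T} (gap_energy n)"
proof -
  assume "n \<le> 3"
  then have "continuous_on ({0..T} \<times> {a..b}) (\<lambda>z. (cmod (case z of (t, x) \<Rightarrow> gap n t x))\<^sup>2)"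
    by (intro continuous_intros gap_joint)
  then have "continuous_on ({0..T} \<times> cbox a b) (\<lambda>(t, x). (cmod (gap n t x))\<^sup>2)"
    by (simp add: split_beta')
  from integral_continuous_on_param[OF this] show ?thesis by (simp add: gap_energy_def[abs_def])
qed

lemma energy_integrand_le:
  assumes t: "t \<in> {0..T}" and x: "x \<in> {a..b}"
  shows "2 * inner (gap 0 t x) (W 1 0 t x - Z 1 0 t x) \<le> 8 * (cmod (gap 0 t x))\<^sup>2 + \<epsilon>\<^sup>2 + 2 * inner (gap 0 t x) (\<i> * gap 2 t x)"
proof -
  define w z where "w = W 0 0 t x" and "z = Z 0 0 t x"
  define F where "F = log_nl \<epsilon> w - log_nl 0 z"
  have "\<i> * (W 1 0 t x - Z 1 0 t x) + gap 2 t x = F"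
    using V.pde[OF t x] Z.pde[OF t x] by (simp add: gap_def F_def w_def z_def algebra_simps)
  moreover have "W 1 0 t x - Z 1 0 t x = - \<i> * (\<i> * (W 1 0 t x - Z 1 0 t x) + gap 2 t x) + \<i> * gap 2 t x"
    by (simp add: algebra_simps)
  ultimately have DF: "W 1 0 t x - Z 1 0 t x = - \<i> * F + \<i> * gap 2 t x" by simp
  have "F = (log_nl \<epsilon> w - log_nl \<epsilon> z) + (log_nl \<epsilon> z - log_nl 0 z)" by (simp add: F_def)
  then have s: "W 1 0 t x - Z 1 0 t x = - \<i> * (log_nl \<epsilon> w - log_nl \<epsilon> z) + - \<i> * (log_nl \<epsilon> z - log_nl 0 z) + \<i> * gap 2 t x"
    by (simp only: DF distrib_left)
  have ez: "gap 0 t x = w - z" by (simp add: gap_def w_def z_def)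
  have eq: "inner (gap 0 t x) (W 1 0 t x - Z 1 0 t x) = inner (w - z) (- \<i> * (log_nl \<epsilon> w - log_nl \<epsilon> z))
     + inner (w - z) (- \<i> * (log_nl \<epsilon> z - log_nl 0 z)) + inner (gap 0 t x) (\<i> * gap 2 t x)"
    unfolding s ez by (simp only: inner_add_right)
  have "inner (w - z) (- \<i> * (log_nl \<epsilon> z - log_nl 0 z)) \<le> cmod (w - z) * cmod (- \<i> * (log_nl \<epsilon> z - log_nl 0 z))"
    by (rule norm_cauchy_schwarz)
  also have "\<dots> \<le> cmod (w - z) * (2 * \<epsilon>)"
    using log_nl_regularization_error[OF V.eps, of z] by (intro mult_left_mono) (auto simp: norm_mult)
  finally have 2: "inner (w - z) (- \<i> * (log_nl \<epsilon> z - log_nl 0 z)) \<le> cmod (w - z) * (2 * \<epsilon>)" .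
  have "0 \<le> (2 * cmod (w - z) - \<epsilon>)\<^sup>2" by simp
  then have 3: "4 * (cmod (w - z) * \<epsilon>) \<le> 4 * (cmod (w - z))\<^sup>2 + \<epsilon>\<^sup>2" by (simp add: power2_eq_square algebra_simps)
  show ?thesis
    using eq 2 3 log_nl_dissipative[OF V.eps, of w z] ez by simp
qed

lemma inner_i_xx_integral:
  assumes t: "t \<in> {0..T}"
  shows "integral {a..b} (\<lambda>x. inner (gap 0 t x) (\<i> * gap 2 t x)) = 0"
proof -
  have "((\<lambda>x. inner (gap 0 t x) (\<i> * gap 1 t x)) has_vector_derivative
        inner (gap 0 t x) (\<i> * gap 2 t x) + inner (gap 1 t x) (\<i> * gap 1 t x)) (at x within {a..b})" if x: "x \<in> {a..b}" for x
    using gap_dx[of 0 t x] gap_dx[of 1 t x] t x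
    by (intro bounded_bilinear.has_vector_derivative[OF bounded_bilinear_inner] has_vector_derivative_mult_right) (auto simp: numeral_eq_Suc)
  then have "((\<lambda>x. inner (gap 0 t x) (\<i> * gap 2 t x)) has_integral
        inner (gap 0 t b) (\<i> * gap 1 t b) - inner (gap 0 t a) (\<i> * gap 1 t a)) {a..b}"
    using V.ab by (intro fundamental_theorem_of_calculus) (auto simp: inner_i_self)
  then show ?thesis using gap_bdry[OF t] by (simp add: integral_unique)
qed

text \<open>
The integrand bound gives $E' \<le> 8 E + \<epsilon>^2 L$ for the squared $L^2$ distance $E$, and $E(0) = 0$.
\<close>

lemma gap_energy_0_le:
  assumes t: "t \<in> {0..T}"
  shows "gap_energy 0 t \<le> \<epsilon>\<^sup>2 * (b - a) * exp (8 * T)"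
proof -
  define E' where "E' t = integral (cbox a b) (\<lambda>x. 2 * inner (gap 0 t x) (W 1 0 t x - Z 1 0 t x))" for t
  have dE: "(gap_energy 0 has_real_derivative E' t) (at t within {0..T})" if t: "t \<in> {0..T}" for t
  proof -
    have "((\<lambda>t. integral (cbox a b) (\<lambda>x. (cmod (gap 0 t x))\<^sup>2)) has_real_derivative E' t) (at t within {0..T})"
      unfolding E'_def
    proof (rule leibniz_rule_field_derivative[where U = "{0..T}" and f = "\<lambda>t x. (cmod (gap 0 t x))\<^sup>2"
          and fx = "\<lambda>t x. 2 * inner (gap 0 t x) (W 1 0 t x - Z 1 0 t x)"])
      fix t x assume t: "t \<in> {0..T}" and x: "x \<in> cbox a b"
      have "((\<lambda>s. gap 0 s x) has_vector_derivative W 1 0 t x - Z 1 0 t x) (at t within {0..T})"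
        unfolding gap_def using V.dt[of 0 0 t x] Z.dt[of 0 0 t x] t x by (intro has_vector_derivative_diff) auto
      from bounded_bilinear.has_vector_derivative[OF bounded_bilinear_inner this this]
      show "((\<lambda>t. (cmod (gap 0 t x))\<^sup>2) has_real_derivative 2 * inner (gap 0 t x) (W 1 0 t x - Z 1 0 t x)) (at t within {0..T})"
        by (simp add: power2_norm_eq_inner has_real_derivative_iff_has_vector_derivative inner_commute)
    next
      fix t assume "t \<in> {0..T}"
      then show "(\<lambda>x. (cmod (gap 0 t x))\<^sup>2) integrable_on cbox a b"
        by (intro integrable_continuous continuous_intros) (simp add: gap_cont)
    next
      have "continuous_on ({0..T} \<times> cbox a b) (\<lambda>z. 2 * inner (case z of (t, x) \<Rightarrow> gap 0 t x) ((case z of (t, x) \<Rightarrow> W 1 0 t x) - (case z of (t, x) \<Rightarrow> Z 1 0 t x)))"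
        using gap_joint[of 0] V.joint[of 1 0] Z.joint[of 1 0] by (intro continuous_intros) auto
      then show "continuous_on ({0..T} \<times> cbox a b) (\<lambda>(t, x). 2 * inner (gap 0 t x) (W 1 0 t x - Z 1 0 t x))"
        by (simp add: split_beta')
    qed (use t in auto)
    then show ?thesis by (simp add: gap_energy_def[abs_def])
  qed
  have E'_le: "E' t \<le> 8 * gap_energy 0 t + \<epsilon>\<^sup>2 * (b - a)" if t: "t \<in> {0..T}" for t
  proof -
    have c1: "continuous_on {a..b} (\<lambda>x. (cmod (gap 0 t x))\<^sup>2)" "continuous_on {a..b} (\<lambda>x. inner (gap 0 t x) (\<i> * gap 2 t x))"
       "continuous_on {a..b} (\<lambda>x. 2 * inner (gap 0 t x) (W 1 0 t x - Z 1 0 t x))"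
      using t by (auto intro!: continuous_intros gap_cont V.cont_x Z.cont_x)
    have "E' t \<le> integral {a..b} (\<lambda>x. 8 * (cmod (gap 0 t x))\<^sup>2 + \<epsilon>\<^sup>2 + 2 * inner (gap 0 t x) (\<i> * gap 2 t x))"
      unfolding E'_def cbox_interval
      by (intro integral_le integrable_continuous_real continuous_intros c1 energy_integrand_le t)
    also have "\<dots> = integral {a..b} (\<lambda>x. 8 * (cmod (gap 0 t x))\<^sup>2 + \<epsilon>\<^sup>2) + integral {a..b} (\<lambda>x. 2 * inner (gap 0 t x) (\<i> * gap 2 t x))"
      by (intro Henstock_Kurzweil_Integration.integral_add integrable_continuous_real continuous_intros c1)
    also have "integral {a..b} (\<lambda>x. 2 * inner (gap 0 t x) (\<i> * gap 2 t x)) = 0"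
      using inner_i_xx_integral[OF t] by simp
    also have "integral {a..b} (\<lambda>x. 8 * (cmod (gap 0 t x))\<^sup>2 + \<epsilon>\<^sup>2) = 8 * gap_energy 0 t + \<epsilon>\<^sup>2 * (b - a)"
      using V.ab integrable_continuous_real[OF c1(1)]
      by (subst Henstock_Kurzweil_Integration.integral_add) (auto simp: gap_energy_def intro: integrable_on_cmult_left)
    finally show ?thesis by simp
  qed
  define q where "q = \<epsilon>\<^sup>2 * (b - a)"
  have q: "0 \<le> q" using V.ab by (simp add: q_def)
  \<comment> \<open>The shift by \<open>q\<close> absorbs the inhomogeneity, so that \<open>G\<close> is decreasing.\<close>
  define G where "G t = (gap_energy 0 t + q) * exp (- 8 * t)" for t
  have "G t \<le> G 0"
  proof (cases "t = 0")
    case False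
    show ?thesis
    proof (rule DERIV_nonpos_imp_decreasing_open[where f = G and a = 0 and b = t])
      show "0 \<le> t" using t by simp
      show "continuous_on {0..t} G"
        unfolding G_def using t by (intro continuous_intros continuous_on_subset[OF gap_energy_continuous]) auto
      fix s assume s: "0 < s" "s < t"
      have "(gap_energy 0 has_real_derivative E' s) (at s within {0..T})" using dE[of s] s t by auto
      then have d: "(gap_energy 0 has_real_derivative E' s) (at s)"
        using s t by (subst (asm) at_within_interior) auto
      have "(G has_real_derivative (E' s * exp (- 8 * s) + (gap_energy 0 s + q) * (exp (- 8 * s) * (- 8)))) (at s)"
        unfolding G_def by (rule derivative_eq_intros d refl | simp)+
      moreover have "E' s * exp (- 8 * s) + (gap_energy 0 s + q) * (exp (- 8 * s) * (- 8)) \<le> 0"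
      proof -
        have "E' s \<le> 8 * gap_energy 0 s + 8 * q" using E'_le[of s] s t q by (auto simp: q_def)
        then have "E' s * exp (- 8 * s) \<le> (8 * gap_energy 0 s + 8 * q) * exp (- 8 * s)" by (intro mult_right_mono) auto
        then show ?thesis by (simp add: algebra_simps)
      qed
      ultimately show "\<exists>y. (G has_real_derivative y) (at s) \<and> y \<le> 0" by blast
    qed
  qed simp
  moreover have "gap_energy 0 0 = 0"
  proof -
    have "gap_energy 0 0 = integral {a..b} (\<lambda>x. 0)"
      unfolding gap_energy_def by (rule Henstock_Kurzweil_Integration.integral_cong) (use same_init in \<open>auto simp: gap_def\<close>)
    then show ?thesis by simp
  qed
  ultimately have "(gap_energy 0 t + q) * exp (- 8 * t) \<le> q" by (simp add: G_def)
  then have "(gap_energy 0 t + q) * exp (- 8 * t) * exp (8 * t) \<le> q * exp (8 * t)" by (intro mult_right_mono) auto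
  then have "gap_energy 0 t + q \<le> q * exp (8 * t)" by (simp add: mult.assoc exp_add[symmetric])
  also have "\<dots> \<le> q * exp (8 * T)" using t q by (intro mult_left_mono) auto
  finally show ?thesis using q by (simp add: q_def)
qed

lemma gap_energy_1_le:
  assumes t: "t \<in> {0..T}"
  shows "(gap_energy 1 t) ^ 3 \<le> (gap_energy 0 t)\<^sup>2 * (4 * B\<^sup>2 * (b - a))"
proof -
  have "(gap_energy 1 t) ^ 3 \<le> (gap_energy 0 t)\<^sup>2 * gap_energy 3 t"
    unfolding gap_energy_def by (rule interpolation_inequality[OF V.ab]) (use t gap_bdry[OF t] in \<open>auto intro: gap_dx gap_cont\<close>)
  also have "gap_energy 3 t \<le> integral {a..b} (\<lambda>x. (2 * B)\<^sup>2)"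
    unfolding gap_energy_def by (intro integral_le integrable_continuous_real continuous_intros gap_cont power_mono gap_bound t) auto
  also have "\<dots> = 4 * B\<^sup>2 * (b - a)" using V.ab by (simp add: power_mult_distrib)
  finally show ?thesis by (simp add: mult_left_mono)
qed

end

section \<open>Discrete norms and grid restriction\<close>

lemma d_norm_L2_set: "0 \<le> h \<Longrightarrow> d_norm h M v = sqrt h * L2_set (\<lambda>j. cmod (v j)) {1..M-1}"
  by (simp add: d_norm_def L2_set_def real_sqrt_mult)

lemma d_seminorm_L2_set: "0 \<le> h \<Longrightarrow> d_seminorm_H1 h M v = sqrt h * L2_set (\<lambda>j. cmod (dx_plus h v j)) {..<M}"
  by (simp add: d_seminorm_H1_def L2_set_def real_sqrt_mult)

lemma d_norm_nonneg: "0 \<le> h \<Longrightarrow> 0 \<le> d_norm h M v"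
  by (simp add: d_norm_L2_set)

lemma d_seminorm_nonneg: "0 \<le> h \<Longrightarrow> 0 \<le> d_seminorm_H1 h M v"
  by (simp add: d_seminorm_L2_set)

lemma d_norm_cong: "(\<And>j. 1 \<le> j \<Longrightarrow> j < M \<Longrightarrow> v j = w j) \<Longrightarrow> d_norm h M v = d_norm h M w"
  unfolding d_norm_def by (intro arg_cong[where f = sqrt] arg_cong[where f = "(*) h"] sum.cong) auto

lemma d_seminorm_cong: "(\<And>j. j \<le> M \<Longrightarrow> v j = w j) \<Longrightarrow> d_seminorm_H1 h M v = d_seminorm_H1 h M w"
  unfolding d_seminorm_H1_def dx_plus_def by (intro arg_cong[where f = sqrt] arg_cong[where f = "(*) h"] sum.cong) auto

lemma d_norm_mono:
  assumes "0 \<le> h" "\<And>j. 1 \<le> j \<Longrightarrow> j < M \<Longrightarrow> cmod (v j) \<le> w j" 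
  shows "d_norm h M v \<le> sqrt h * L2_set w {1..M-1}"
  unfolding d_norm_L2_set[OF assms(1)] by (intro mult_left_mono L2_set_mono) (use assms in auto)

lemma d_seminorm_mono:
  assumes "0 \<le> h" "\<And>j. j < M \<Longrightarrow> cmod (dx_plus h v j) \<le> w j" 
  shows "d_seminorm_H1 h M v \<le> sqrt h * L2_set w {..<M}"
  unfolding d_seminorm_L2_set[OF assms(1)] by (intro mult_left_mono L2_set_mono) (use assms in auto)

lemma d_norm_triangle:
  assumes "0 \<le> h" shows "d_norm h M (\<lambda>j. v j + w j) \<le> d_norm h M v + d_norm h M w"
proof -
  have "d_norm h M (\<lambda>j. v j + w j) \<le> sqrt h * L2_set (\<lambda>j. cmod (v j) + cmod (w j)) {1..M-1}"
    by (rule d_norm_mono[OF assms]) (rule norm_triangle_ineq)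
  also have "\<dots> \<le> sqrt h * (L2_set (\<lambda>j. cmod (v j)) {1..M-1} + L2_set (\<lambda>j. cmod (w j)) {1..M-1})"
    using assms by (intro mult_left_mono L2_set_triangle_ineq) auto
  finally show ?thesis by (simp add: d_norm_L2_set assms distrib_left)
qed

lemma dx_plus_add: "dx_plus h (\<lambda>j. v j + w j) j = dx_plus h v j + dx_plus h w j"
  by (simp add: dx_plus_def algebra_simps)

lemma dx_plus_diff: "dx_plus h (\<lambda>j. v j - w j) j = dx_plus h v j - dx_plus h w j"
  by (simp add: dx_plus_def algebra_simps)

lemma dx_plus_scale: "dx_plus h (\<lambda>j. c * v j) j = c * dx_plus h v j"
  by (simp add: dx_plus_def algebra_simps)

lemma d_seminorm_triangle:
  assumes "0 \<le> h" shows "d_seminorm_H1 h M (\<lambda>j. v j + w j) \<le> d_seminorm_H1 h M v + d_seminorm_H1 h M w"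
proof -
  have "d_seminorm_H1 h M (\<lambda>j. v j + w j) \<le> sqrt h * L2_set (\<lambda>j. cmod (dx_plus h v j) + cmod (dx_plus h w j)) {..<M}"
    by (rule d_seminorm_mono[OF assms]) (simp add: dx_plus_add norm_triangle_ineq)
  also have "\<dots> \<le> sqrt h * (L2_set (\<lambda>j. cmod (dx_plus h v j)) {..<M} + L2_set (\<lambda>j. cmod (dx_plus h w j)) {..<M})"
    using assms by (intro mult_left_mono L2_set_triangle_ineq) auto
  finally show ?thesis by (simp add: d_seminorm_L2_set assms distrib_left)
qed

lemma d_norm_H1_le:
  assumes "0 \<le> h" shows "d_norm_H1 h M v \<le> d_norm h M v + d_seminorm_H1 h M v"
  unfolding d_norm_H1_def by (rule sqrt_sum_squares_le_sum) (use assms d_norm_nonneg d_seminorm_nonneg in auto)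

lemma d_norm_H1_triangle:
  assumes "0 \<le> h" shows "d_norm_H1 h M (\<lambda>j. v j + w j) \<le> d_norm_H1 h M v + d_norm_H1 h M w"
proof -
  have "d_norm_H1 h M (\<lambda>j. v j + w j) \<le> sqrt ((d_norm h M v + d_norm h M w)\<^sup>2 + (d_seminorm_H1 h M v + d_seminorm_H1 h M w)\<^sup>2)"
    unfolding d_norm_H1_def
    by (intro real_sqrt_le_mono add_mono power_mono d_norm_triangle d_seminorm_triangle assms d_norm_nonneg d_seminorm_nonneg)
  also have "\<dots> \<le> d_norm_H1 h M v + d_norm_H1 h M w"
    unfolding d_norm_H1_def by (rule real_sqrt_sum_squares_triangle_ineq)
  finally show ?thesis .
qed

lemma d_seminorm_le_sup:
  assumes "0 \<le> h" "0 \<le> c" "\<And>j. j < M \<Longrightarrow> cmod (dx_plus h v j) \<le> c"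
  shows "d_seminorm_H1 h M v \<le> sqrt (h * real M) * c"
proof -
  have "d_seminorm_H1 h M v \<le> sqrt h * L2_set (\<lambda>_. c) {..<M}" by (rule d_seminorm_mono) (use assms in auto)
  also have "\<dots> = sqrt (h * real M) * c" using assms by (simp add: L2_set_constant real_sqrt_mult)
  finally show ?thesis .
qed

lemma grid_sup_le_seminorm:
  assumes h: "0 < h" and v: "v 0 = 0" and j: "j \<le> M"
  shows "cmod (v j) \<le> sqrt (h * real M) * d_seminorm_H1 h M v"
proof -
  have "v j = (\<Sum>i<j. h *\<^sub>R dx_plus h v i)"
  proof (induction j)
    case (Suc j)
    then show ?case using h by (simp add: dx_plus_def)
  qed (simp add: v)
  then have "cmod (v j) \<le> (\<Sum>i<j. h * cmod (dx_plus h v i))"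
    using h by (auto intro!: order_trans[OF norm_sum] simp: )
  also have "\<dots> \<le> (\<Sum>i<M. h * cmod (dx_plus h v i))"
    using j h by (intro sum_mono2) auto
  also have "\<dots> = h * (\<Sum>i<M. \<bar>1\<bar> * \<bar>cmod (dx_plus h v i)\<bar>)" by (simp add: sum_distrib_left)
  also have "\<dots> \<le> h * (L2_set (\<lambda>_. 1) {..<M} * L2_set (\<lambda>j. cmod (dx_plus h v j)) {..<M})"
    using h by (intro mult_left_mono L2_set_mult_ineq) auto
  also have "\<dots> = (sqrt h * sqrt h) * (sqrt (real M) * L2_set (\<lambda>j. cmod (dx_plus h v j)) {..<M})"
    using h by (simp add: L2_set_constant)
  also have "\<dots> = sqrt (h * real M) * d_seminorm_H1 h M v"
    using h by (simp add: d_seminorm_L2_set real_sqrt_mult)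
  finally show ?thesis .
qed

lemma d_norm_le_seminorm:
  assumes h: "0 < h" and v: "v 0 = 0"
  shows "d_norm h M v \<le> h * real M * d_seminorm_H1 h M v"
proof -
  define c where "c = sqrt (h * real M) * d_seminorm_H1 h M v"
  have c: "0 \<le> c" using h d_seminorm_nonneg[of h] by (simp add: c_def)
  have "d_norm h M v \<le> sqrt h * L2_set (\<lambda>_. c) {1..M-1}"
    by (rule d_norm_mono) (use h grid_sup_le_seminorm[where v = v, OF h v] in \<open>auto simp: c_def\<close>)
  also have "\<dots> = sqrt h * (sqrt (real (M - 1)) * c)" using c by (simp add: L2_set_constant)
  also have "\<dots> \<le> sqrt h * (sqrt (real M) * c)"
    using h c by (intro mult_left_mono mult_right_mono) auto
  also have "\<dots> = sqrt (h * real M) * c" by (simp add: real_sqrt_mult)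
  also have "\<dots> = h * real M * d_seminorm_H1 h M v" using h by (simp add: c_def)
  finally show ?thesis .
qed

lemma sum_cells:
  fixes f :: "real \<Rightarrow> real"
  assumes ab: "a < b" and M: "0 < M" and f: "continuous_on {a..b} f"
  shows "(\<Sum>j<M. integral {node a b M j..node a b M (Suc j)} f) = integral {a..b} f"
proof -
  have "(\<Sum>j<k. integral {node a b M j..node a b M (Suc j)} f) = integral {a..node a b M k} f" if "k \<le> M" for k
    using that
  proof (induction k)
    case (Suc k)
    have "integral {a..node a b M k} f + integral {node a b M k..node a b M (Suc k)} f = integral {a..node a b M (Suc k)} f"
      using node_in[OF ab M, of k] node_in[OF ab M, of "Suc k"] node_mono[OF ab, of k "Suc k" M] Suc.prems
      by (intro Henstock_Kurzweil_Integration.integral_combine integrable_continuous_real continuous_on_subset[OF f]) auto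
    then show ?case using Suc by simp
  qed (simp add: node_0)
  from this[of M] show ?thesis using node_M[OF M] by simp
qed

lemma mesh_times_M: "0 < M \<Longrightarrow> mesh a b M * real M = b - a"
  by (simp add: mesh_def)

context solution_pair
begin

text \<open>
The divided difference is the mean of the derivative over the cell, so the discrete seminorm never exceeds
the continuous one.
\<close>

lemma cell_H1:
  assumes t: "t \<in> {0..T}" and j: "j < M"
  shows "mesh a b M * (cmod (dx_plus (mesh a b M) (\<lambda>j. gap 0 t (node a b M j)) j))\<^sup>2 \<le> integral {node a b M j..node a b M (Suc j)} (\<lambda>x. (cmod (gap 1 t x))\<^sup>2)"
proof -
  let ?h = "mesh a b M" and ?x = "node a b M"
  have h: "0 < ?h" using V.ab j by (intro mesh_pos) auto
  have x: "?x j \<in> {a..b}" "?x (Suc j) \<in> {a..b}" using node_in[OF V.ab] j by auto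
  have xs: "?x (Suc j) = ?x j + ?h" by (rule node_Suc)
  let ?I = "{?x j..?x (Suc j)}"
  define d where "d = gap 0 t (?x (Suc j)) - gap 0 t (?x j)"
  have sub: "?I \<subseteq> {a..b}" using x by auto
  have c1: "continuous_on ?I (gap 1 t)" by (rule continuous_on_subset[OF gap_cont sub]) (use t in auto)
  have "(gap 1 t has_integral d) ?I"
    unfolding d_def
  proof (rule fundamental_theorem_of_calculus)
    show "(gap 0 t has_vector_derivative gap 1 t z) (at z within ?I)" if "z \<in> ?I" for z
      using gap_dx[of 0 t z] t that sub by (intro has_vector_derivative_within_subset[OF _ sub]) auto
  qed (use h xs in auto)
  then have "((\<lambda>z. inner d (gap 1 t z)) has_integral inner d d) ?I"
    using has_integral_linear[OF _ bounded_linear_inner_right[of d]] by (force simp: o_def)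
  then have "(inner d d)\<^sup>2 = (integral ?I (\<lambda>z. inner d (gap 1 t z)))\<^sup>2" by (simp add: integral_unique)
  also have "\<dots> \<le> integral ?I (\<lambda>z. (cmod d)\<^sup>2) * integral ?I (\<lambda>z. (cmod (gap 1 t z))\<^sup>2)"
    by (rule integral_Cauchy_Schwarz[OF continuous_on_const c1])
  also have "integral ?I (\<lambda>z. (cmod d)\<^sup>2) = ?h * (cmod d)\<^sup>2" using h xs by simp
  finally have le: "(cmod d)\<^sup>2 * (cmod d)\<^sup>2 \<le> (cmod d)\<^sup>2 * (?h * integral ?I (\<lambda>z. (cmod (gap 1 t z))\<^sup>2))"
    by (simp add: power2_norm_eq_inner[symmetric] power2_eq_square mult_ac)
  have nn: "0 \<le> integral ?I (\<lambda>z. (cmod (gap 1 t z))\<^sup>2)"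
    by (intro Henstock_Kurzweil_Integration.integral_nonneg integrable_continuous_real continuous_intros c1) auto
  have "(cmod d)\<^sup>2 \<le> ?h * integral ?I (\<lambda>z. (cmod (gap 1 t z))\<^sup>2)"
  proof (cases "d = 0")
    case False
    then have "0 < (cmod d)\<^sup>2" by simp
    then show ?thesis using le mult_le_cancel_left_pos by blast
  qed (use nn h in simp)
  moreover have "dx_plus ?h (\<lambda>j. gap 0 t (?x j)) j = d /\<^sub>R ?h" by (simp add: dx_plus_def d_def)
  moreover have "?h * (cmod (d /\<^sub>R ?h))\<^sup>2 = (cmod d)\<^sup>2 / ?h"
  proof -
    have "cmod (d /\<^sub>R ?h) = cmod d / ?h" using h by (simp add: divide_inverse mult.commute)
    then show ?thesis using h by (simp add: power_divide power2_eq_square[of ?h])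
  qed
  ultimately show ?thesis using h by (simp add: pos_divide_le_eq mult.commute)
qed

lemma grid_seminorm_le:
  assumes t: "t \<in> {0..T}" and M: "0 < M"
  shows "d_seminorm_H1 (mesh a b M) M (\<lambda>j. gap 0 t (node a b M j)) \<le> sqrt (gap_energy 1 t)"
proof -
  have "mesh a b M * (\<Sum>j<M. (cmod (dx_plus (mesh a b M) (\<lambda>j. gap 0 t (node a b M j)) j))\<^sup>2)
     \<le> (\<Sum>j<M. integral {node a b M j..node a b M (Suc j)} (\<lambda>x. (cmod (gap 1 t x))\<^sup>2))"
    unfolding sum_distrib_left by (intro sum_mono cell_H1 t) auto
  also have "\<dots> = gap_energy 1 t"
    unfolding gap_energy_def by (intro sum_cells V.ab M continuous_intros gap_cont) (use t in auto)
  finally show ?thesis unfolding d_seminorm_H1_def by simp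
qed

text \<open>
Point values differ from values in the same cell by $O(h)$.  The resulting discrete $L^2$ bound has an
error of order $h$ only, which is harmless because $h$ is far smaller than $\<epsilon>$.
\<close>

lemma cell_L2:
  assumes t: "t \<in> {0..T}" and j: "j < M"
  shows "mesh a b M * (cmod (gap 0 t (node a b M j)))\<^sup>2 \<le> integral {node a b M j..node a b M (Suc j)} (\<lambda>x. 2 * (cmod (gap 0 t x))\<^sup>2 + 8 * (mesh a b M)\<^sup>2 * B\<^sup>2)"
proof -
  let ?h = "mesh a b M" and ?x = "node a b M"
  have h: "0 < ?h" using V.ab j by (intro mesh_pos) auto
  have x: "?x j \<in> {a..b}" "?x (Suc j) \<in> {a..b}" using node_in[OF V.ab] j by auto
  have xs: "?x (Suc j) = ?x j + ?h" by (rule node_Suc)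
  let ?I = "{?x j..?x (Suc j)}"
  have sub: "?I \<subseteq> {a..b}" using x by auto
  have c0: "continuous_on ?I (gap 0 t)" by (rule continuous_on_subset[OF gap_cont sub]) (use t in auto)
  have pt: "(cmod (gap 0 t (?x j)))\<^sup>2 \<le> 2 * (cmod (gap 0 t z))\<^sup>2 + 8 * ?h\<^sup>2 * B\<^sup>2" if z: "z \<in> ?I" for z
  proof -
    have zab: "z \<in> {a..b}" using sub z by blast
    have B0: "0 \<le> B" using gap_bound[of 0 t z] t zab norm_ge_zero[of "gap 0 t z"] by linarith
    have "cmod (gap 0 t (?x j) - gap 0 t z) \<le> 2 * B * \<bar>?x j - z\<bar>"
      by (rule vector_mvt[of a b "gap 0 t" "gap 1 t"]) (use t x zab gap_dx[of 0] gap_bound[of 1] in auto)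
    also have "\<dots> \<le> 2 * B * ?h" using B0 z xs by (intro mult_left_mono) auto
    finally have "cmod (gap 0 t (?x j)) \<le> cmod (gap 0 t z) + 2 * B * ?h"
      using norm_triangle_ineq2[of "gap 0 t (?x j)" "gap 0 t z"] by linarith
    then have "(cmod (gap 0 t (?x j)))\<^sup>2 \<le> (cmod (gap 0 t z) + 2 * B * ?h)\<^sup>2" by (intro power_mono) auto
    also have "\<dots> \<le> 2 * (cmod (gap 0 t z))\<^sup>2 + 8 * ?h\<^sup>2 * B\<^sup>2"
      using zero_le_power2[of "cmod (gap 0 t z) - 2 * B * ?h"] by (simp add: power2_eq_square algebra_simps)
    finally show ?thesis .
  qed
  have "?h * (cmod (gap 0 t (?x j)))\<^sup>2 = integral ?I (\<lambda>_. (cmod (gap 0 t (?x j)))\<^sup>2)" using h xs by simp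
  also have "\<dots> \<le> integral ?I (\<lambda>x. 2 * (cmod (gap 0 t x))\<^sup>2 + 8 * ?h\<^sup>2 * B\<^sup>2)"
    by (intro integral_le integrable_continuous_real continuous_intros c0 pt)
  finally show ?thesis .
qed

lemma grid_norm_le:
  assumes t: "t \<in> {0..T}" and M: "0 < M"
  shows "d_norm (mesh a b M) M (\<lambda>j. gap 0 t (node a b M j)) \<le> sqrt (2 * gap_energy 0 t + 8 * (mesh a b M)\<^sup>2 * B\<^sup>2 * (b - a))"
proof -
  have h: "0 < mesh a b M" by (rule mesh_pos[OF V.ab M])
  have i: "continuous_on {a..b} (\<lambda>x. (cmod (gap 0 t x))\<^sup>2)" by (intro continuous_intros gap_cont) (use t in auto)
  have "mesh a b M * (\<Sum>j=1..M-1. (cmod (gap 0 t (node a b M j)))\<^sup>2) \<le> mesh a b M * (\<Sum>j<M. (cmod (gap 0 t (node a b M j)))\<^sup>2)"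
    using h M by (intro mult_left_mono sum_mono2) auto
  also have "\<dots> \<le> (\<Sum>j<M. integral {node a b M j..node a b M (Suc j)} (\<lambda>x. 2 * (cmod (gap 0 t x))\<^sup>2 + 8 * (mesh a b M)\<^sup>2 * B\<^sup>2))"
    unfolding sum_distrib_left by (intro sum_mono cell_L2 t) auto
  also have "\<dots> = integral {a..b} (\<lambda>x. 2 * (cmod (gap 0 t x))\<^sup>2 + 8 * (mesh a b M)\<^sup>2 * B\<^sup>2)"
    by (intro sum_cells V.ab M continuous_intros i)
  also have "\<dots> = 2 * gap_energy 0 t + 8 * (mesh a b M)\<^sup>2 * B\<^sup>2 * (b - a)"
    using V.ab integrable_continuous_real[OF i]
    by (subst Henstock_Kurzweil_Integration.integral_add) (auto simp: gap_energy_def intro: integrable_on_cmult_left)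
  finally show ?thesis unfolding d_norm_def by simp
qed

end

lemma Linf_Sob_le:
  assumes G: "continuous_on {0..T} G" and eq: "\<And>t. t \<in> {0..T} \<Longrightarrow> Sob_norm a b m (v t) = G t"
    and le: "\<And>t. t \<in> {0..T} \<Longrightarrow> G t \<le> c"
  shows "Linf_Sob T a b m v \<le> ereal c"
  unfolding Linf_Sob_def
proof (rule esssup_I)
  have "G \<in> borel_measurable (Leb 0 T)"
    by (intro continuous_measurable_Leb continuous_on_subset[OF G]) auto
  then have "(\<lambda>t. ereal (G t)) \<in> borel_measurable (Leb 0 T)" by measurable
  then show "(\<lambda>t. ereal (Sob_norm a b m (v t))) \<in> borel_measurable (Leb 0 T)"
    by (rule measurable_cong[THEN iffD1, rotated]) (use eq in auto)
  show "AE t in Leb 0 T. ereal (Sob_norm a b m (v t)) \<le> ereal c"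
    by (rule AE_I2) (use eq le in auto)
qed

lemma L2_norm_eq_integral:
  assumes f: "f \<in> borel_measurable (Leb a b)" and F: "continuous_on {a..b} F" and eq: "AE x in Leb a b. f x = F x"
  shows "(L2_norm a b f)\<^sup>2 = integral {a..b} (\<lambda>x. (cmod (F x))\<^sup>2)"
proof -
  have "L2_norm a b f = L2_norm a b F"
    by (rule L2_norm_cong_AE[OF eq f L2_measurable[OF L2_continuous[OF F]]])
  then show ?thesis
    using LINT_Leb_eq_integral[of a b "\<lambda>x. (cmod (F x))\<^sup>2"] L2_continuous[OF F] by (simp add: L2_norm_power2 L2_def)
qed

context solution_pair
begin

lemma Linf_difference_le:
  assumes u: "\<And>t. t \<in> {0..T} \<Longrightarrow> Sob a b 4 (u t) \<and> (\<forall>n. W 0 n t = cont_der a b n (u t)) \<and> (\<forall>x\<in>{a..b}. W 0 0 t x = u t x)"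
    and v: "\<And>t. t \<in> {0..T} \<Longrightarrow> Sob a b 4 (v t) \<and> (\<forall>n. Z 0 n t = cont_der a b n (v t)) \<and> (\<forall>x\<in>{a..b}. Z 0 0 t x = v t x)"
    and c0: "\<And>t. t \<in> {0..T} \<Longrightarrow> sqrt (gap_energy 0 t) \<le> c0" and c1: "\<And>t. t \<in> {0..T} \<Longrightarrow> sqrt (gap_energy 0 t + gap_energy 1 t) \<le> c1"
  shows "Linf_Sob T a b 0 (\<lambda>t x. u t x - v t x) \<le> ereal c0" "Linf_Sob T a b 1 (\<lambda>t x. u t x - v t x) \<le> ereal c1"
proof -
  have key: "(L2_norm a b (weak_der a b n (\<lambda>x. u t x - v t x)))\<^sup>2 = gap_energy n t" if t: "t \<in> {0..T}" and n: "n \<le> 1" for n t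
  proof -
    have S: "Sob a b 4 (\<lambda>x. u t x - v t x)" using u[OF t] v[OF t] by (intro Sob_diff) auto
    have "(L2_norm a b (weak_der a b n (\<lambda>x. u t x - v t x)))\<^sup>2 = integral {a..b} (\<lambda>x. (cmod (cont_der a b n (\<lambda>x. u t x - v t x) x))\<^sup>2)"
      by (rule L2_norm_eq_integral[OF L2_measurable[OF L2_weak_der[OF S]] cont_der_continuous[OF V.ab S] cont_der_AE[OF V.ab S]]) (use n in auto)
    also have "\<dots> = gap_energy n t"
      unfolding gap_energy_def
    proof (rule Henstock_Kurzweil_Integration.integral_cong)
      fix x assume x: "x \<in> {a..b}"
      show "(cmod (cont_der a b n (\<lambda>x. u t x - v t x) x))\<^sup>2 = (cmod (gap n t x))\<^sup>2"
        using cont_der_diff[OF V.ab, of 4 "u t" "v t" n x] u[OF t] v[OF t] n x by (simp add: gap_def)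
    qed
    finally show ?thesis .
  qed
  show "Linf_Sob T a b 0 (\<lambda>t x. u t x - v t x) \<le> ereal c0"
  proof (rule Linf_Sob_le[of _ "\<lambda>t. sqrt (gap_energy 0 t)"])
    show "continuous_on {0..T} (\<lambda>t. sqrt (gap_energy 0 t))" by (intro continuous_intros gap_energy_continuous) auto
    fix t assume t: "t \<in> {0..T}"
    have "(Sob_norm a b 0 (\<lambda>x. u t x - v t x))\<^sup>2 = gap_energy 0 t" using key[OF t, of 0] by (simp add: Sob_norm_power2)
    then show "Sob_norm a b 0 (\<lambda>x. u t x - v t x) = sqrt (gap_energy 0 t)" by (metis real_sqrt_unique Sob_norm_nonneg)
  qed (rule c0)
  show "Linf_Sob T a b 1 (\<lambda>t x. u t x - v t x) \<le> ereal c1"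
  proof (rule Linf_Sob_le[of _ "\<lambda>t. sqrt (gap_energy 0 t + gap_energy 1 t)"])
    show "continuous_on {0..T} (\<lambda>t. sqrt (gap_energy 0 t + gap_energy 1 t))" by (intro continuous_intros gap_energy_continuous) auto
    fix t assume t: "t \<in> {0..T}"
    have "(Sob_norm a b 1 (\<lambda>x. u t x - v t x))\<^sup>2 = gap_energy 0 t + gap_energy 1 t"
      using key[OF t, of 0] key[OF t, of 1] by (simp add: Sob_norm_power2)
    then show "Sob_norm a b 1 (\<lambda>x. u t x - v t x) = sqrt (gap_energy 0 t + gap_energy 1 t)" by (metis real_sqrt_unique Sob_norm_nonneg)
  qed (rule c1)
qed

end

section \<open>Discrete energy, Ritz projection, and the nonlinearity\<close>

lemma dxx_eq:
  assumes "0 < h" "1 \<le> j"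
  shows "dxx h v j = (dx_plus h v j - dx_plus h v (j - 1)) /\<^sub>R h"
proof -
  have "(dx_plus h v j - dx_plus h v (j - 1)) /\<^sub>R h = ((v (j + 1) - v j) - (v j - v (j - 1))) /\<^sub>R h /\<^sub>R h"
    using assms by (simp only: dx_plus_def le_add_diff_inverse2 scaleR_diff_right[symmetric])
  also have "(v (j + 1) - v j) - (v j - v (j - 1)) = v (j + 1) - 2 * v j + v (j - 1)" by simp
  finally show ?thesis by (simp add: dxx_def power2_eq_square)
qed

lemma summation_by_parts:
  assumes h: "0 < h" and M: "0 < M" and g: "g 0 = 0" "g M = 0"
  shows "(\<Sum>j=1..M-1. inner (g j) (dxx h s j)) = - (\<Sum>j<M. inner (dx_plus h g j) (dx_plus h s j))"
proof -
  have "(\<Sum>j=1..m. inner (g j) (dxx h s j)) + (\<Sum>j<Suc m. inner (dx_plus h g j) (dx_plus h s j))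
     = (inner (g (Suc m)) (dx_plus h s m) - inner (g 0) (dx_plus h s 0)) / h" for m
  proof (induction m)
    case 0
    show ?case using h by (simp add: dx_plus_def[of h g] inner_diff_left divide_inverse mult.commute)
  next
    case (Suc m)
    have "inner (g (Suc m)) (dxx h s (Suc m)) = (inner (g (Suc m)) (dx_plus h s (Suc m)) - inner (g (Suc m)) (dx_plus h s m)) / h"
      using dxx_eq[OF h, of "Suc m" s] by (simp add: inner_diff_right divide_inverse mult.commute)
    moreover have "inner (dx_plus h g (Suc m)) (dx_plus h s (Suc m)) = (inner (g (Suc (Suc m))) (dx_plus h s (Suc m)) - inner (g (Suc m)) (dx_plus h s (Suc m))) / h"
      by (simp add: dx_plus_def[of h g] inner_diff_left divide_inverse mult.commute)
    ultimately show ?case using Suc.IH by (simp add: diff_divide_distrib)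
  qed
  from this[of "M - 1"] show ?thesis using M g by simp
qed

lemma sum_inner_le_L2_set:
  "(\<Sum>j\<in>A. inner (f j) (g j)) \<le> L2_set (\<lambda>j. norm (f j)) A * L2_set (\<lambda>j. norm (g j)) A"
proof -
  have "(\<Sum>j\<in>A. inner (f j) (g j)) \<le> (\<Sum>j\<in>A. \<bar>norm (f j)\<bar> * \<bar>norm (g j)\<bar>)"
    by (intro sum_mono) (simp add: norm_cauchy_schwarz)
  also have "\<dots> \<le> L2_set (\<lambda>j. norm (f j)) A * L2_set (\<lambda>j. norm (g j)) A" by (rule L2_set_mult_ineq)
  finally show ?thesis .
qed

text \<open>
Divides an energy identity by the sum of the two norms, so that no smallness of the time step
enters.
\<close>

lemma le_of_square_diff_le:
  assumes "0 \<le> X" "0 \<le> Y" "0 \<le> G" "X\<^sup>2 - Y\<^sup>2 \<le> c * G * (X + Y)" "0 \<le> (c::real)"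
  shows "X \<le> Y + c * G"
proof (cases "X + Y = 0")
  case False
  then have p: "0 < X + Y" using assms by simp
  have "(X + Y) * (X - Y) \<le> (X + Y) * (c * G)" using assms(4) by (simp add: power2_eq_square algebra_simps)
  then have "X - Y \<le> c * G" using p by simp
  then show ?thesis by simp
next
  case True
  then have "X = 0" "Y = 0" using assms(1,2) by auto
  then show ?thesis using mult_nonneg_nonneg[OF assms(5,3)] by simp
qed

text \<open>
Pair the equation with the sum $p + q$, respectively with its second difference, in the real inner
product.  The Laplacian drops out because multiplication by $i$ is skew, and the time difference
telescopes to $\|p\|^2 - \|q\|^2$.  Summation by parts moves one difference to the right-hand
side in the second case, which is why \<open>g\<close> has to vanish at the ends there.
\<close>

lemma
  assumes h: "0 < h" and M: "0 < M" and tau: "0 < \<tau>"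
    and p: "p 0 = 0" "p M = 0" and q: "q 0 = 0" "q M = 0"
    and eq: "\<And>j. 1 \<le> j \<Longrightarrow> j < M \<Longrightarrow> \<i> * ((p j - q j) /\<^sub>R (2 * \<tau>)) + (1/2) * dxx h (\<lambda>i. p i + q i) j = g j"
  shows energy_L2: "d_norm h M p \<le> d_norm h M q + 2 * \<tau> * d_norm h M g"
    and energy_H1: "g 0 = 0 \<Longrightarrow> g M = 0 \<Longrightarrow> d_seminorm_H1 h M p \<le> d_seminorm_H1 h M q + 2 * \<tau> * d_seminorm_H1 h M g"
proof -
  let ?s = "\<lambda>j. p j + q j" and ?I = "{1..M-1}"
  have d: "p j - q j = (2 * \<tau>) *\<^sub>R (- \<i> * g j) + \<tau> *\<^sub>R (\<i> * dxx h ?s j)" if "j \<in> ?I" for j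
  proof -
    have "1 \<le> j" "j < M" using that by auto
    have gen: "- \<i> * (\<i> * D + (1/2) * X) = D - (1/2) * (\<i> * X)" for D X :: complex
      by (simp add: algebra_simps)
    have "- \<i> * g j = (p j - q j) /\<^sub>R (2 * \<tau>) - (1/2) * (\<i> * dxx h ?s j)"
      by (simp only: eq[OF \<open>1 \<le> j\<close> \<open>j < M\<close>, symmetric] gen)
    then have "(2 * \<tau>) *\<^sub>R (- \<i> * g j) = (2 * \<tau>) *\<^sub>R ((p j - q j) /\<^sub>R (2 * \<tau>)) - (2 * \<tau>) *\<^sub>R ((1/2) * (\<i> * dxx h ?s j))"
      by (simp only: scaleR_diff_right)
    moreover have "(2 * \<tau>) *\<^sub>R ((p j - q j) /\<^sub>R (2 * \<tau>)) = p j - q j" using tau by simp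
    moreover have "(2 * \<tau>) *\<^sub>R ((1/2) * (\<i> * dxx h ?s j)) = \<tau> *\<^sub>R (\<i> * dxx h ?s j)"
      by (simp add: scaleR_conv_of_real)
    ultimately show ?thesis by simp
  qed
  have ii: "inner (\<i> * x) y = - inner x (\<i> * y)" for x y :: complex
    by (simp add: inner_complex_def)
  have s0: "(\<lambda>j. - \<i> * ?s j) 0 = 0" "(\<lambda>j. - \<i> * ?s j) M = 0" using p q by auto
  have z1: "(\<Sum>j\<in>?I. inner (\<i> * dxx h ?s j) (?s j)) = 0"
  proof -
    have "(\<Sum>j\<in>?I. inner (\<i> * dxx h ?s j) (?s j)) = (\<Sum>j\<in>?I. inner (- \<i> * ?s j) (dxx h ?s j))"
      by (intro sum.cong) (simp_all add: inner_complex_def algebra_simps)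
    also have "\<dots> = - (\<Sum>j<M. inner (dx_plus h (\<lambda>j. - \<i> * ?s j) j) (dx_plus h ?s j))"
      by (rule summation_by_parts[OF h M s0])
    also have "\<dots> = 0"
      unfolding dx_plus_scale by (simp add: inner_complex_def)
    finally show ?thesis .
  qed
  have nonneg: "0 \<le> h" using h by simp
  have ds: "(\<Sum>j\<in>?I. inner (p j - q j) (F j)) = 2 * \<tau> * (\<Sum>j\<in>?I. inner (- \<i> * g j) (F j)) + \<tau> * (\<Sum>j\<in>?I. inner (\<i> * dxx h ?s j) (F j))" for F
  proof -
    have "(\<Sum>j\<in>?I. inner (p j - q j) (F j)) = (\<Sum>j\<in>?I. 2 * \<tau> * inner (- \<i> * g j) (F j) + \<tau> * inner (\<i> * dxx h ?s j) (F j))"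
      by (intro sum.cong refl) (simp only: d inner_add_left inner_scaleR_left)
    then show ?thesis by (simp only: sum.distrib sum_distrib_left)
  qed
  have polar: "inner (x - y) (x + y) = (cmod x)\<^sup>2 - (cmod y)\<^sup>2" for x y :: complex
    unfolding cmod_power2 inner_complex_def by (simp add: power2_eq_square algebra_simps)
  let ?N = "\<lambda>v. L2_set (\<lambda>j. norm (v j)) ?I"
  have "d_norm h M p ^ 2 - d_norm h M q ^ 2 = h * (\<Sum>j\<in>?I. inner (p j - q j) (?s j))"
  proof -
    show ?thesis using nonneg by (simp add: polar d_norm_def sum_nonneg sum_subtractf right_diff_distrib)
  qed
  also have "(\<Sum>j\<in>?I. inner (p j - q j) (?s j)) = 2 * \<tau> * (\<Sum>j\<in>?I. inner (- \<i> * g j) (?s j)) + \<tau> * (\<Sum>j\<in>?I. inner (\<i> * dxx h ?s j) (?s j))"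
    by (rule ds)
  also have "\<dots> = 2 * \<tau> * (\<Sum>j\<in>?I. inner (- \<i> * g j) (?s j))" unfolding z1 by simp
  also have "h * (2 * \<tau> * (\<Sum>j\<in>?I. inner (- \<i> * g j) (?s j))) \<le> h * (2 * \<tau> * (L2_set (\<lambda>j. norm (- \<i> * g j)) ?I * ?N ?s))"
    using h tau by (intro mult_left_mono sum_inner_le_L2_set) auto
  also have "\<dots> = 2 * \<tau> * ((sqrt h * ?N g) * (sqrt h * ?N ?s))" using h by (simp add: norm_mult)
  also have "\<dots> = 2 * \<tau> * d_norm h M g * d_norm h M ?s" by (simp add: d_norm_L2_set nonneg)
  also have "\<dots> \<le> 2 * \<tau> * d_norm h M g * (d_norm h M p + d_norm h M q)"
    using tau nonneg by (intro mult_left_mono d_norm_triangle) (auto simp: d_norm_nonneg)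
  finally show "d_norm h M p \<le> d_norm h M q + 2 * \<tau> * d_norm h M g"
    using tau by (intro le_of_square_diff_le) (auto simp: d_norm_nonneg nonneg)
  assume g: "g 0 = 0" "g M = 0"
  let ?D = "dx_plus h"
  let ?S = "\<lambda>v. L2_set (\<lambda>j. norm (?D v j)) {..<M}"
  have "d_seminorm_H1 h M p ^ 2 - d_seminorm_H1 h M q ^ 2 = h * (\<Sum>j<M. inner (?D (\<lambda>j. p j - q j) j) (?D ?s j))"
  proof -
    have "inner (?D (\<lambda>j. p j - q j) j) (?D ?s j) = (cmod (?D p j))\<^sup>2 - (cmod (?D q j))\<^sup>2" for j
      unfolding dx_plus_diff dx_plus_add by (rule polar)
    then show ?thesis using nonneg by (simp add: d_seminorm_H1_def sum_nonneg sum_subtractf right_diff_distrib)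
  qed
  also have "(\<Sum>j<M. inner (?D (\<lambda>j. p j - q j) j) (?D ?s j)) = - (\<Sum>j\<in>?I. inner (p j - q j) (dxx h ?s j))"
    using summation_by_parts[OF h M, of "\<lambda>j. p j - q j" ?s] p q by simp
  also have "(\<Sum>j\<in>?I. inner (p j - q j) (dxx h ?s j)) = 2 * \<tau> * (\<Sum>j\<in>?I. inner (- \<i> * g j) (dxx h ?s j)) + \<tau> * (\<Sum>j\<in>?I. inner (\<i> * dxx h ?s j) (dxx h ?s j))"
    by (rule ds)
  also have "(\<Sum>j\<in>?I. inner (\<i> * dxx h ?s j) (dxx h ?s j)) = 0"
    by (simp add: inner_complex_def)
  also have "(\<Sum>j\<in>?I. inner (- \<i> * g j) (dxx h ?s j)) = - (\<Sum>j<M. inner (?D (\<lambda>j. - \<i> * g j) j) (?D ?s j))"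
    by (rule summation_by_parts[OF h M]) (use g in auto)
  also have "h * - (2 * \<tau> * - (\<Sum>j<M. inner (?D (\<lambda>j. - \<i> * g j) j) (?D ?s j)) + \<tau> * 0) = h * (2 * \<tau> * (\<Sum>j<M. inner (?D (\<lambda>j. - \<i> * g j) j) (?D ?s j)))"
    by simp
  also have "\<dots> \<le> h * (2 * \<tau> * (L2_set (\<lambda>j. norm (?D (\<lambda>j. - \<i> * g j) j)) {..<M} * ?S ?s))"
    using h tau by (intro mult_left_mono sum_inner_le_L2_set) auto
  also have "\<dots> = h * (2 * \<tau> * (?S g * ?S ?s))" unfolding dx_plus_scale by (simp add: norm_mult)
  also have "\<dots> = 2 * \<tau> * ((sqrt h * ?S g) * (sqrt h * ?S ?s))" using h by simp
  also have "\<dots> = 2 * \<tau> * d_seminorm_H1 h M g * d_seminorm_H1 h M ?s" by (simp add: d_seminorm_L2_set nonneg)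
  also have "\<dots> \<le> 2 * \<tau> * d_seminorm_H1 h M g * (d_seminorm_H1 h M p + d_seminorm_H1 h M q)"
    using tau nonneg by (intro mult_left_mono d_seminorm_triangle) (auto simp: d_seminorm_nonneg)
  finally show "d_seminorm_H1 h M p \<le> d_seminorm_H1 h M q + 2 * \<tau> * d_seminorm_H1 h M g"
    using tau by (intro le_of_square_diff_le) (auto simp: d_seminorm_nonneg nonneg)
qed

definition csum :: "real \<Rightarrow> (nat \<Rightarrow> complex) \<Rightarrow> nat \<Rightarrow> complex" where
  "csum h c i = h *\<^sub>R (\<Sum>l=1..i. c l)"

text \<open>
The grid function that vanishes at both ends and has the second differences \<open>c\<close>: sum twice, then subtract
a linear function.
\<close>

definition ritz :: "real \<Rightarrow> nat \<Rightarrow> (nat \<Rightarrow> complex) \<Rightarrow> nat \<Rightarrow> complex" where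
  "ritz h M c j = h *\<^sub>R (\<Sum>i<j. csum h c i) - (real j / real M) *\<^sub>R (h *\<^sub>R (\<Sum>i<M. csum h c i))"

lemma ritz_0: "ritz h M c 0 = 0" by (simp add: ritz_def)

lemma ritz_M: "0 < M \<Longrightarrow> ritz h M c M = 0" by (simp add: ritz_def)

lemma dx_plus_ritz:
  assumes "0 < h" "0 < M"
  shows "dx_plus h (ritz h M c) j = csum h c j - (\<Sum>i<M. csum h c i) /\<^sub>R real M"
proof -
  have "ritz h M c (j + 1) - ritz h M c j = h *\<^sub>R csum h c j - (h * (1 / real M)) *\<^sub>R (\<Sum>i<M. csum h c i)"
    by (simp add: ritz_def scaleR_add_right scaleR_add_left add_divide_distrib algebra_simps)
  also have "\<dots> = h *\<^sub>R (csum h c j - (\<Sum>i<M. csum h c i) /\<^sub>R real M)"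
    by (simp add: scaleR_diff_right divide_inverse)
  finally show ?thesis using assms by (simp add: dx_plus_def)
qed

lemma dxx_ritz:
  assumes "0 < h" "0 < M" "1 \<le> j" shows "dxx h (ritz h M c) j = c j"
proof -
  obtain i where j: "j = Suc i" using assms(3) by (cases j) auto
  show ?thesis using assms by (simp add: dxx_eq dx_plus_ritz j csum_def scaleR_add_right)
qed

text \<open>
The differences of the projection are determined up to an additive constant by the partial sums of
\<open>c\<close>, and the constant is fixed by the boundary values.  Therefore an approximation of \<open>dx_plus h v\<close> by
partial sums up to any constant \<open>\<kappa>\<close> is enough.
\<close>

lemma dx_plus_minus_ritz_le:
  assumes h: "0 < h" and M: "0 < M" and v: "v 0 = 0" "v M = 0"
    and r: "\<And>j. j < M \<Longrightarrow> cmod (dx_plus h v j - csum h c j - \<kappa>) \<le> r" and j: "j < M"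
  shows "cmod (dx_plus h (\<lambda>j. v j - ritz h M c j) j) \<le> 2 * r"
proof -
  define m where "m = (\<Sum>i<M. dx_plus h v i - csum h c i - \<kappa>) /\<^sub>R real M"
  have "(\<Sum>i<n. dx_plus h v i) = (v n - v 0) /\<^sub>R h" for n
    by (induction n) (simp_all add: dx_plus_def algebra_simps)
  then have sv: "(\<Sum>i<M. dx_plus h v i) = 0" using v by simp
  have "m = - ((\<Sum>i<M. csum h c i) /\<^sub>R real M) - \<kappa>"
    unfolding m_def using M sv by (simp add: sum_subtractf scaleR_diff_right scaleR_conv_of_real sum.distrib field_simps)
  then have eq: "dx_plus h (\<lambda>j. v j - ritz h M c j) j = (dx_plus h v j - csum h c j - \<kappa>) - m"
    by (simp add: dx_plus_diff dx_plus_ritz[OF h M])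
  have "cmod m \<le> (\<Sum>i<M. r) /\<^sub>R real M"
  proof -
    have "cmod (\<Sum>i<M. dx_plus h v i - csum h c i - \<kappa>) \<le> (\<Sum>i<M. r)" by (rule sum_norm_le) (simp add: r)
    then have "inverse (real M) * cmod (\<Sum>i<M. dx_plus h v i - csum h c i - \<kappa>) \<le> inverse (real M) * (\<Sum>i<M. r)"
      by (rule mult_left_mono) simp
    then show ?thesis by (simp add: m_def)
  qed
  also have "\<dots> = r" using M by simp
  finally have "cmod m \<le> r" .
  then show ?thesis unfolding eq using r[OF j] norm_triangle_ineq4[of "dx_plus h v j - csum h c j - \<kappa>" m] by linarith
qed

text \<open>
The real derivative of \<open>log_nl\<close> at \<open>z\<close> in direction \<open>w\<close>.  The convention \<open>sgn 0 = 0\<close> makes the formula valid at the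
origin.
\<close>

definition Dlog :: "real \<Rightarrow> complex \<Rightarrow> complex \<Rightarrow> complex" where
  "Dlog \<epsilon> z w = (2 * ln (\<epsilon> + cmod z)) *\<^sub>R w + (2 * inner (sgn z) w) *\<^sub>R (z /\<^sub>R (\<epsilon> + cmod z))"

lemma Dlog_diff: "Dlog \<epsilon> z (v - w) = Dlog \<epsilon> z v - Dlog \<epsilon> z w"
  by (simp add: Dlog_def inner_diff_right scaleR_diff_right scaleR_diff_left right_diff_distrib algebra_simps)

lemma bounded_linear_Dlog: "bounded_linear (Dlog \<epsilon> z)"
  unfolding Dlog_def[abs_def]
  by (intro bounded_linear_add bounded_linear_scaleR_right bounded_linear_scaleR_const bounded_linear_const_mult
       bounded_linear_inner_right bounded_linear_ident)

lemma log_nl_has_derivative: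
  assumes e: "0 < \<epsilon>"
  shows "(log_nl \<epsilon> has_derivative Dlog \<epsilon> z) (at z)"
proof -
  have f: "log_nl \<epsilon> = (\<lambda>z. (2 * ln (\<epsilon> + cmod z)) *\<^sub>R z)"
    using e by (auto simp: log_nl_eq scaleR_conv_of_real mult.commute)
  show ?thesis
  proof (cases "z = 0")
    case False
    have ez: "0 < \<epsilon> + cmod z" using e by (simp add: add_pos_nonneg)
    have "(cmod has_derivative (\<lambda>w. inner (sgn z) w)) (at z)"
      using has_derivative_norm[OF False] by (simp add: inner_commute)
    then have "((\<lambda>z. 2 * ln (\<epsilon> + cmod z)) has_derivative (\<lambda>w. 2 * (inner (sgn z) w / (\<epsilon> + cmod z)))) (at z)"
      using ez by (auto intro!: derivative_eq_intros simp: divide_inverse)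
    from has_derivative_scaleR[OF this has_derivative_ident[of "at z"]]
    show ?thesis unfolding f Dlog_def[abs_def] by (simp add: divide_inverse mult.assoc)
  next
    case True
    have "((\<lambda>w. 2 * \<bar>ln (\<epsilon> + cmod w) - ln \<epsilon>\<bar>) \<longlongrightarrow> 2 * \<bar>ln (\<epsilon> + cmod 0) - ln \<epsilon>\<bar>) (at (0::complex))"
      by (intro tendsto_intros) (use e in auto)
    then have lim: "((\<lambda>w. 2 * \<bar>ln (\<epsilon> + cmod w) - ln \<epsilon>\<bar>) \<longlongrightarrow> 0) (at (0::complex))" by simp
    have "((\<lambda>w. norm ((log_nl \<epsilon> (0 + w) - log_nl \<epsilon> 0 - Dlog \<epsilon> 0 w)) / norm w) \<longlongrightarrow> 0) (at 0)"
    proof (rule Lim_transform_eventually[OF lim], rule eventually_at_filter[THEN iffD2], rule always_eventually, intro allI impI)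
      fix w :: complex assume w: "w \<noteq> 0"
      have "log_nl \<epsilon> (0 + w) - log_nl \<epsilon> 0 - Dlog \<epsilon> 0 w = (2 * (ln (\<epsilon> + cmod w) - ln \<epsilon>)) *\<^sub>R w"
        by (simp add: f Dlog_def scaleR_diff_left right_diff_distrib)
      then have "norm (log_nl \<epsilon> (0 + w) - log_nl \<epsilon> 0 - Dlog \<epsilon> 0 w) = \<bar>2 * (ln (\<epsilon> + cmod w) - ln \<epsilon>)\<bar> * cmod w"
        by (simp only: norm_scaleR)
      then show "2 * \<bar>ln (\<epsilon> + cmod w) - ln \<epsilon>\<bar> = norm (log_nl \<epsilon> (0 + w) - log_nl \<epsilon> 0 - Dlog \<epsilon> 0 w) / norm w"
        using w unfolding abs_mult by simp
    qed
    then show ?thesis unfolding has_derivative_at True using bounded_linear_Dlog by blast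
  qed
qed

lemma Dlog_bound:
  assumes e: "0 < \<epsilon>" "\<epsilon> \<le> 1" and R: "cmod z \<le> R"
  shows "cmod (Dlog \<epsilon> z w) \<le> (2 * (\<bar>ln \<epsilon>\<bar> + ln (1 + R)) + 2) * cmod w"
proof -
  have R0: "0 \<le> R" using R norm_ge_zero order_trans by blast
  have ez: "0 < \<epsilon> + cmod z" using e by (simp add: add_pos_nonneg)
  have "ln \<epsilon> \<le> ln (\<epsilon> + cmod z)" using e ez by simp
  moreover have "ln (\<epsilon> + cmod z) \<le> ln (1 + R)" using e R ez by (subst ln_le_cancel_iff) auto
  moreover have "0 \<le> ln (1 + R)" using R0 by simp
  ultimately have l: "\<bar>ln (\<epsilon> + cmod z)\<bar> \<le> \<bar>ln \<epsilon>\<bar> + ln (1 + R)" by linarith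
  have "cmod (Dlog \<epsilon> z w) \<le> \<bar>2 * ln (\<epsilon> + cmod z)\<bar> * cmod w + \<bar>2 * inner (sgn z) w\<bar> * cmod (z /\<^sub>R (\<epsilon> + cmod z))"
    unfolding Dlog_def by (rule order_trans[OF norm_triangle_ineq]) (simp only: norm_scaleR order_refl)
  also have "\<bar>2 * inner (sgn z) w\<bar> * cmod (z /\<^sub>R (\<epsilon> + cmod z)) \<le> (2 * cmod w) * 1"
  proof (rule mult_mono)
    have "\<bar>inner (sgn z) w\<bar> \<le> cmod (sgn z) * cmod w" by (rule Cauchy_Schwarz_ineq2)
    also have "\<dots> \<le> 1 * cmod w" by (intro mult_right_mono) (auto simp: norm_sgn)
    finally show "\<bar>2 * inner (sgn z) w\<bar> \<le> 2 * cmod w" by simp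
    have "cmod z / (\<epsilon> + cmod z) \<le> 1" using e ez by (simp add: divide_le_eq)
    then show "cmod (z /\<^sub>R (\<epsilon> + cmod z)) \<le> 1" using ez by (simp add: divide_inverse mult.commute)
  qed auto
  also have "\<bar>2 * ln (\<epsilon> + cmod z)\<bar> * cmod w \<le> (2 * (\<bar>ln \<epsilon>\<bar> + ln (1 + R))) * cmod w"
    using l by (intro mult_right_mono) auto
  finally show ?thesis by (simp add: distrib_right)
qed

text \<open>
The direction $z/|z|$ is not Lipschitz continuous near the origin, but it occurs with the factor
$z/(\<epsilon> + |z|)$, and $|z| \, |z/|z| - z'/|z'|| \<le> 2 |z - z'|$.
\<close>

lemma Dlog_lipschitz:
  assumes e: "0 < \<epsilon>"
  shows "cmod (Dlog \<epsilon> z w - Dlog \<epsilon> z' w) \<le> 10 / \<epsilon> * cmod (z - z') * cmod w"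
proof -
  define d where "d = cmod (z - z')"
  have ez: "0 < \<epsilon> + cmod y" "\<epsilon> \<le> \<epsilon> + cmod y" for y :: complex using e by (auto simp: add_pos_nonneg)
  have dn: "\<bar>cmod z - cmod z'\<bar> \<le> d" unfolding d_def by (rule norm_triangle_ineq3)
  define \<beta> where "\<beta> y = y /\<^sub>R (\<epsilon> + cmod y)" for y :: complex
  have ln1: "ln (\<epsilon> + s) - ln (\<epsilon> + r) \<le> (s - r) / \<epsilon>" if "0 \<le> r" "r \<le> s" for r s
  proof -
    have "ln (\<epsilon> + s) - ln (\<epsilon> + r) = ln ((\<epsilon> + s) / (\<epsilon> + r))" using e that by (simp add: ln_div)
    also have "\<dots> \<le> (\<epsilon> + s) / (\<epsilon> + r) - 1" using e that by (intro ln_le_minus_one) (auto intro: divide_pos_pos)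
    also have "\<dots> = (s - r) / (\<epsilon> + r)" using e that by (simp add: field_simps)
    also have "\<dots> \<le> (s - r) / \<epsilon>" using e that by (intro divide_left_mono) auto
    finally show ?thesis .
  qed
  have lnd: "\<bar>ln (\<epsilon> + cmod z) - ln (\<epsilon> + cmod z')\<bar> \<le> d / \<epsilon>"
  proof -
    have "\<bar>ln (\<epsilon> + cmod z) - ln (\<epsilon> + cmod z')\<bar> \<le> \<bar>cmod z - cmod z'\<bar> / \<epsilon>"
    proof (cases "cmod z \<le> cmod z'")
      case True
      then have "ln (\<epsilon> + cmod z) \<le> ln (\<epsilon> + cmod z')" using ez[of z] ez[of z'] by simp
      then show ?thesis using ln1[OF norm_ge_zero True] True by simp
    next
      case False
      then have "ln (\<epsilon> + cmod z') \<le> ln (\<epsilon> + cmod z)" using ez[of z] ez[of z'] by simp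
      then show ?thesis using ln1[of "cmod z'" "cmod z"] False by simp
    qed
    also have "\<dots> \<le> d / \<epsilon>" using dn e by (intro divide_right_mono) auto
    finally show ?thesis .
  qed
  have sgnd: "cmod (sgn z - sgn z') * cmod z \<le> 2 * d"
  proof -
    have "cmod (sgn z - sgn z') * cmod z = cmod (cmod z *\<^sub>R sgn z - cmod z *\<^sub>R sgn z')"
      by (simp add: scaleR_diff_right[symmetric] mult.commute)
    also have "cmod z *\<^sub>R sgn z - cmod z *\<^sub>R sgn z' = (z - z') + (cmod z' - cmod z) *\<^sub>R sgn z'"
    proof -
      have "cmod y *\<^sub>R sgn y = y" for y :: complex by (cases "y = 0") (auto simp: sgn_div_norm)
      then show ?thesis by (simp add: scaleR_diff_left)
    qed
    also have "cmod \<dots> \<le> d + \<bar>cmod z' - cmod z\<bar> * cmod (sgn z')"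
      unfolding d_def by (rule order_trans[OF norm_triangle_ineq]) simp
    also have "\<dots> \<le> d + d * 1"
      using dn by (intro add_left_mono mult_mono) (auto simp: norm_sgn abs_minus_commute)
    finally show ?thesis by simp
  qed
  have bz: "cmod (\<beta> z) \<le> cmod z / \<epsilon>"
  proof -
    have "cmod (\<beta> z) = cmod z / (\<epsilon> + cmod z)" using ez(1)[of z] by (simp add: \<beta>_def divide_inverse mult.commute)
    also have "\<dots> \<le> cmod z / \<epsilon>" using e ez by (intro divide_left_mono mult_pos_pos) auto
    finally show ?thesis .
  qed
  have bd: "cmod (\<beta> z - \<beta> z') \<le> 2 * d / \<epsilon>"
  proof -
    have "\<beta> z - \<beta> z' = (z - z') /\<^sub>R (\<epsilon> + cmod z) + (inverse (\<epsilon> + cmod z) - inverse (\<epsilon> + cmod z')) *\<^sub>R z'"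
      by (simp add: \<beta>_def algebra_simps)
    also have "cmod \<dots> \<le> d / (\<epsilon> + cmod z) + \<bar>inverse (\<epsilon> + cmod z) - inverse (\<epsilon> + cmod z')\<bar> * cmod z'"
      unfolding d_def using ez[of z] by (intro order_trans[OF norm_triangle_ineq]) (simp add: divide_inverse mult.commute)
    also have "\<bar>inverse (\<epsilon> + cmod z) - inverse (\<epsilon> + cmod z')\<bar> * cmod z' \<le> d / (\<epsilon> + cmod z)"
    proof -
      have "inverse (\<epsilon> + cmod z) - inverse (\<epsilon> + cmod z') = (cmod z' - cmod z) / ((\<epsilon> + cmod z) * (\<epsilon> + cmod z'))"
        using ez[of z] ez[of z'] by (simp add: field_simps)
      then have "\<bar>inverse (\<epsilon> + cmod z) - inverse (\<epsilon> + cmod z')\<bar> * cmod z' = \<bar>cmod z' - cmod z\<bar> / (\<epsilon> + cmod z) * (cmod z' / (\<epsilon> + cmod z'))"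
        using ez[of z] ez[of z'] by (simp add: abs_mult)
      also have "\<dots> \<le> d / (\<epsilon> + cmod z) * 1"
        using ez[of z] ez[of z'] dn e by (intro mult_mono divide_right_mono) (auto simp: divide_le_eq abs_minus_commute ez(1) less_imp_le[OF ez(1)])
      finally show ?thesis by simp
    qed
    also have "d / (\<epsilon> + cmod z) + d / (\<epsilon> + cmod z) \<le> d / \<epsilon> + d / \<epsilon>"
      using e ez by (intro add_mono divide_left_mono mult_pos_pos) (auto simp: d_def)
    finally show ?thesis by simp
  qed
  have "Dlog \<epsilon> z w - Dlog \<epsilon> z' w = (2 * (ln (\<epsilon> + cmod z) - ln (\<epsilon> + cmod z'))) *\<^sub>R w
      + (2 * inner (sgn z - sgn z') w) *\<^sub>R \<beta> z + (2 * inner (sgn z') w) *\<^sub>R (\<beta> z - \<beta> z')"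
    by (simp add: Dlog_def \<beta>_def[symmetric] inner_diff_left right_diff_distrib scaleR_diff_left scaleR_diff_right)
  also have "cmod \<dots> \<le> \<bar>2 * (ln (\<epsilon> + cmod z) - ln (\<epsilon> + cmod z'))\<bar> * cmod w
      + \<bar>2 * inner (sgn z - sgn z') w\<bar> * cmod (\<beta> z) + \<bar>2 * inner (sgn z') w\<bar> * cmod (\<beta> z - \<beta> z')"
    unfolding norm_scaleR[symmetric] by (intro order_trans[OF norm_triangle_ineq] add_mono order_refl)
  also have "\<dots> \<le> 2 * (d / \<epsilon>) * cmod w + 2 * (2 * d / \<epsilon>) * cmod w + 2 * (2 * d / \<epsilon>) * cmod w"
  proof (intro add_mono)
    show "\<bar>2 * (ln (\<epsilon> + cmod z) - ln (\<epsilon> + cmod z'))\<bar> * cmod w \<le> 2 * (d / \<epsilon>) * cmod w"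
      using lnd by (intro mult_right_mono) (simp_all only: abs_mult, auto)
    have "\<bar>inner (sgn z - sgn z') w\<bar> * cmod (\<beta> z) \<le> (cmod (sgn z - sgn z') * cmod w) * (cmod z / \<epsilon>)"
      by (intro mult_mono Cauchy_Schwarz_ineq2 bz) auto
    also have "\<dots> = (cmod (sgn z - sgn z') * cmod z) * (cmod w / \<epsilon>)" by simp
    also have "\<dots> \<le> (2 * d) * (cmod w / \<epsilon>)" using e by (intro mult_right_mono sgnd) auto
    finally show "\<bar>2 * inner (sgn z - sgn z') w\<bar> * cmod (\<beta> z) \<le> 2 * (2 * d / \<epsilon>) * cmod w"
      by (simp add: abs_mult)
    have "\<bar>inner (sgn z') w\<bar> * cmod (\<beta> z - \<beta> z') \<le> (1 * cmod w) * (2 * d / \<epsilon>)"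
    proof (rule mult_mono[OF _ bd])
      have "\<bar>inner (sgn z') w\<bar> \<le> cmod (sgn z') * cmod w" by (rule Cauchy_Schwarz_ineq2)
      also have "\<dots> \<le> 1 * cmod w" by (intro mult_right_mono) (auto simp: norm_sgn)
      finally show "\<bar>inner (sgn z') w\<bar> \<le> 1 * cmod w" .
    qed auto
    then have "2 * (\<bar>inner (sgn z') w\<bar> * cmod (\<beta> z - \<beta> z')) \<le> 2 * ((1 * cmod w) * (2 * d / \<epsilon>))"
      by (rule mult_left_mono) simp
    then show "\<bar>2 * inner (sgn z') w\<bar> * cmod (\<beta> z - \<beta> z') \<le> 2 * (2 * d / \<epsilon>) * cmod w"
      by (simp only: abs_mult abs_numeral mult_1 mult.assoc mult.commute mult.left_commute)
  qed
  also have "\<dots> = 10 / \<epsilon> * d * cmod w" using e by (simp add: field_simps)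
  finally show ?thesis by (simp add: d_def)
qed

text \<open>
The discrete analogue of differentiating $f(u) - f(U)$ in space.  The paths run from \<open>q0\<close> to \<open>p0\<close> and
from \<open>q1\<close> to \<open>p1\<close>, that is, along the grid and not between the two functions; hence the large constant
$10/\<epsilon>$ multiplies differences of the smooth function, and no product of two errors appears.
\<close>

lemma log_nl_four_points:
  assumes e: "0 < \<epsilon>" "\<epsilon> \<le> 1" and R: "cmod p1 \<le> R" "cmod q1 \<le> R"
  shows "cmod ((log_nl \<epsilon> p0 - log_nl \<epsilon> p1) - (log_nl \<epsilon> q0 - log_nl \<epsilon> q1)) \<le>
     (2 * (\<bar>ln \<epsilon>\<bar> + ln (1 + R)) + 2) * cmod ((p0 - p1) - (q0 - q1)) + 10 / \<epsilon> * (cmod (p0 - p1) + cmod (q0 - q1)) * cmod (p0 - q0)"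
proof -
  define P Q where "P s = q0 + s *\<^sub>R (p0 - q0)" and "Q s = q1 + s *\<^sub>R (p1 - q1)" for s
  define F where "F s = log_nl \<epsilon> (P s) - log_nl \<epsilon> (Q s)" for s
  define F' where "F' s = Dlog \<epsilon> (P s) (p0 - q0) - Dlog \<epsilon> (Q s) (p1 - q1)" for s
  let ?K = "(2 * (\<bar>ln \<epsilon>\<bar> + ln (1 + R)) + 2) * cmod ((p0 - p1) - (q0 - q1)) + 10 / \<epsilon> * (cmod (p0 - p1) + cmod (q0 - q1)) * cmod (p0 - q0)"
  have line: "((\<lambda>s. log_nl \<epsilon> (x + s *\<^sub>R y)) has_vector_derivative Dlog \<epsilon> (x + s *\<^sub>R y) y) (at s within S)" for x y s S
  proof -
    have "((\<lambda>s. x + s *\<^sub>R y) has_vector_derivative y) (at s within S)"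
      by (auto intro!: derivative_eq_intros)
    from vector_derivative_diff_chain_within[OF this has_derivative_at_withinI[OF log_nl_has_derivative[OF e(1)]]]
    show ?thesis by (simp add: o_def)
  qed
  have "cmod (F 1 - F 0) \<le> ?K * \<bar>1 - 0\<bar>"
  proof (rule vector_mvt[of 0 1 F F'])
    fix s :: real assume s: "s \<in> {0..1}"
    show "(F has_vector_derivative F' s) (at s within {0..1})"
      unfolding F_def F'_def P_def Q_def by (intro has_vector_derivative_diff line)
    have conv: "cmod ((1 - s) *\<^sub>R x + s *\<^sub>R y) \<le> (1 - s) * cmod x + s * cmod y" for x y
      using s by (intro order_trans[OF norm_triangle_ineq]) auto
    have Q: "cmod (Q s) \<le> R"
    proof -
      have "Q s = (1 - s) *\<^sub>R q1 + s *\<^sub>R p1" by (simp add: Q_def algebra_simps)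
      then have "cmod (Q s) \<le> (1 - s) * cmod q1 + s * cmod p1" using conv by simp
      also have "\<dots> \<le> (1 - s) * R + s * R" using s R by (intro add_mono mult_left_mono) auto
      finally show ?thesis by (simp add: algebra_simps)
    qed
    have PQ: "cmod (P s - Q s) \<le> cmod (p0 - p1) + cmod (q0 - q1)"
    proof -
      have "P s - Q s = (1 - s) *\<^sub>R (q0 - q1) + s *\<^sub>R (p0 - p1)" by (simp add: P_def Q_def algebra_simps)
      then have "cmod (P s - Q s) \<le> (1 - s) * cmod (q0 - q1) + s * cmod (p0 - p1)" using conv by simp
      also have "\<dots> \<le> 1 * cmod (q0 - q1) + 1 * cmod (p0 - p1)" using s by (intro add_mono mult_right_mono) auto
      finally show ?thesis by simp
    qed
    have "F' s = Dlog \<epsilon> (Q s) ((p0 - p1) - (q0 - q1)) + (Dlog \<epsilon> (P s) (p0 - q0) - Dlog \<epsilon> (Q s) (p0 - q0))"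
      by (simp add: F'_def Dlog_diff)
    also have "cmod \<dots> \<le> (2 * (\<bar>ln \<epsilon>\<bar> + ln (1 + R)) + 2) * cmod ((p0 - p1) - (q0 - q1)) + 10 / \<epsilon> * cmod (P s - Q s) * cmod (p0 - q0)"
      by (intro order_trans[OF norm_triangle_ineq] add_mono Dlog_bound[OF e Q] Dlog_lipschitz[OF e(1)])
    also have "\<dots> \<le> ?K" using e by (intro add_left_mono mult_right_mono mult_left_mono PQ) auto
    finally show "cmod (F' s) \<le> ?K" .
  qed auto
  then show ?thesis by (simp add: F_def P_def Q_def)
qed

lemma log_nl_lipschitz:
  assumes e: "0 < \<epsilon>" "\<epsilon> \<le> 1" and R: "cmod z \<le> R" "cmod w \<le> R"
  shows "cmod (log_nl \<epsilon> w - log_nl \<epsilon> z) \<le> (2 * (\<bar>ln \<epsilon>\<bar> + ln (1 + R)) + 2) * cmod (w - z)"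
  using log_nl_four_points[OF e R, of 0 0] by (simp add: log_nl_def norm_minus_commute)

section \<open>Finite differences, Gronwall, and the weighted norm\<close>

lemma dx_plus_scaleR: "dx_plus h (\<lambda>j. c *\<^sub>R v j) j = c *\<^sub>R dx_plus h v j"
  by (simp add: dx_plus_def algebra_simps)

lemma dxx_add: "dxx h (\<lambda>j. v j + w j) j = dxx h v j + dxx h w j"
  by (simp add: dxx_def algebra_simps)

lemma dxx_diff: "dxx h (\<lambda>j. v j - w j) j = dxx h v j - dxx h w j"
  by (simp add: dxx_def algebra_simps)

lemma central_average_error:
  fixes f :: "real \<Rightarrow> complex"
  assumes tau: "0 \<le> \<tau>" and d1: "\<And>z. z \<in> {t-\<tau>..t+\<tau>} \<Longrightarrow> (f has_vector_derivative f' z) (at z within {t-\<tau>..t+\<tau>})"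
    and d2: "\<And>z. z \<in> {t-\<tau>..t+\<tau>} \<Longrightarrow> (f' has_vector_derivative f'' z) (at z within {t-\<tau>..t+\<tau>})"
    and B: "\<And>z. z \<in> {t-\<tau>..t+\<tau>} \<Longrightarrow> cmod (f'' z) \<le> B"
  shows "cmod ((1/2) * (f (t + \<tau>) + f (t - \<tau>)) - f t) \<le> B * \<tau>\<^sup>2"
proof -
  have t: "t \<in> {t-\<tau>..t+\<tau>}" using tau by simp
  have B0: "0 \<le> B" using B[OF t] norm_ge_zero order_trans by blast
  have osc: "cmod (f' z - f' t) \<le> B * \<tau>" if z: "z \<in> {t-\<tau>..t+\<tau>}" for z
  proof -
    have "cmod (f' z - f' t) \<le> B * \<bar>z - t\<bar>" using d2 B z t by (rule vector_mvt)
    also have "\<dots> \<le> B * \<tau>" using z B0 by (intro mult_left_mono) auto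
    finally show ?thesis .
  qed
  have 1: "cmod (f (t + \<tau>) - f t - \<tau> *\<^sub>R f' t) \<le> \<tau> * (B * \<tau>)"
    using taylor_oscillation_1[OF d1 osc t, of "t + \<tau>"] tau by simp
  have 2: "cmod (f (t - \<tau>) - f t + \<tau> *\<^sub>R f' t) \<le> \<tau> * (B * \<tau>)"
    using taylor_oscillation_1[OF d1 osc t, of "t - \<tau>"] tau by simp
  have "(1/2) * (f (t + \<tau>) + f (t - \<tau>)) - f t = (1/2) * ((f (t + \<tau>) - f t - \<tau> *\<^sub>R f' t) + (f (t - \<tau>) - f t + \<tau> *\<^sub>R f' t))"
    by (simp add: algebra_simps)
  also have "cmod \<dots> = (1/2) * cmod ((f (t + \<tau>) - f t - \<tau> *\<^sub>R f' t) + (f (t - \<tau>) - f t + \<tau> *\<^sub>R f' t))"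
    by (simp add: norm_mult)
  also have "\<dots> \<le> (1/2) * (\<tau> * (B * \<tau>) + \<tau> * (B * \<tau>))"
    by (intro mult_left_mono order_trans[OF norm_triangle_ineq] add_mono 1 2) auto
  finally show ?thesis by (simp add: power2_eq_square mult_ac)
qed

lemma central_difference_error:
  fixes f :: "real \<Rightarrow> complex"
  assumes tau: "0 < \<tau>" and d1: "\<And>z. z \<in> {t-\<tau>..t+\<tau>} \<Longrightarrow> (f has_vector_derivative f' z) (at z within {t-\<tau>..t+\<tau>})"
    and d2: "\<And>z. z \<in> {t-\<tau>..t+\<tau>} \<Longrightarrow> (f' has_vector_derivative f'' z) (at z within {t-\<tau>..t+\<tau>})"
    and d3: "\<And>z. z \<in> {t-\<tau>..t+\<tau>} \<Longrightarrow> (f'' has_vector_derivative f''' z) (at z within {t-\<tau>..t+\<tau>})"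
    and B: "\<And>z. z \<in> {t-\<tau>..t+\<tau>} \<Longrightarrow> cmod (f''' z) \<le> B"
  shows "cmod ((f (t + \<tau>) - f (t - \<tau>)) /\<^sub>R (2 * \<tau>) - f' t) \<le> B * \<tau>\<^sup>2"
proof -
  have t: "t \<in> {t-\<tau>..t+\<tau>}" using tau by simp
  have B0: "0 \<le> B" using B[OF t] norm_ge_zero order_trans by blast
  have osc: "cmod (f'' z - f'' t) \<le> B * \<tau>" if z: "z \<in> {t-\<tau>..t+\<tau>}" for z
  proof -
    have "cmod (f'' z - f'' t) \<le> B * \<bar>z - t\<bar>" using d3 B z t by (rule vector_mvt)
    also have "\<dots> \<le> B * \<tau>" using z B0 by (intro mult_left_mono) auto
    finally show ?thesis .
  qed
  define p q where "p = f (t + \<tau>) - f t - \<tau> *\<^sub>R f' t - (\<tau>\<^sup>2/2) *\<^sub>R f'' t" and "q = f (t - \<tau>) - f t + \<tau> *\<^sub>R f' t - (\<tau>\<^sup>2/2) *\<^sub>R f'' t"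
  have 1: "cmod p \<le> \<tau>\<^sup>2 * (B * \<tau>)"
    using taylor_oscillation_2[OF d1 d2 osc t, of "t + \<tau>"] tau by (simp add: p_def)
  have 2: "cmod q \<le> \<tau>\<^sup>2 * (B * \<tau>)"
    using taylor_oscillation_2[OF d1 d2 osc t, of "t - \<tau>"] tau by (simp add: q_def)
  have "(2 * \<tau>) *\<^sub>R f' t = \<tau> *\<^sub>R f' t + \<tau> *\<^sub>R f' t" by (simp add: scaleR_add_left[symmetric])
  then have "f (t + \<tau>) - f (t - \<tau>) = (2 * \<tau>) *\<^sub>R f' t + (p - q)"
    by (simp add: p_def q_def)
  then have "(f (t + \<tau>) - f (t - \<tau>)) /\<^sub>R (2 * \<tau>) - f' t = (p - q) /\<^sub>R (2 * \<tau>)"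
    using tau by (simp only: scaleR_add_right) simp
  also have "cmod \<dots> = inverse (2 * \<tau>) * cmod (p - q)" using tau by simp
  also have "\<dots> \<le> inverse (2 * \<tau>) * (\<tau>\<^sup>2 * (B * \<tau>) + \<tau>\<^sup>2 * (B * \<tau>))"
    using tau by (intro mult_left_mono order_trans[OF norm_triangle_ineq4] add_mono 1 2) auto
  also have "\<dots> = B * \<tau>\<^sup>2" using tau by (simp add: field_simps)
  finally show ?thesis .
qed

text \<open>
Apply Taylor's formula between \<open>t\<close> and the end of the interval that is farther away.
\<close>

lemma derivative_interpolation:
  fixes f :: "real \<Rightarrow> complex"
  assumes T: "0 < T" and d1: "\<And>z. z \<in> {0..T} \<Longrightarrow> (f has_vector_derivative f' z) (at z within {0..T})"
    and d2: "\<And>z. z \<in> {0..T} \<Longrightarrow> (f' has_vector_derivative f'' z) (at z within {0..T})"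
    and A: "\<And>z. z \<in> {0..T} \<Longrightarrow> cmod (f z) \<le> A" "\<And>z. z \<in> {0..T} \<Longrightarrow> cmod (f'' z) \<le> A" and t: "t \<in> {0..T}"
  shows "cmod (f' t) \<le> (4 / T + T) * A"
proof -
  have A0: "0 \<le> A" using A(1)[OF t] norm_ge_zero order_trans by blast
  have osc: "cmod (f' z - f' t) \<le> A * T" if z: "z \<in> {0..T}" for z
  proof -
    have "cmod (f' z - f' t) \<le> A * \<bar>z - t\<bar>" using d2 A(2) z t by (rule vector_mvt)
    also have "\<dots> \<le> A * T" using z t A0 by (intro mult_left_mono) auto
    finally show ?thesis .
  qed
  define s where "s = (if t \<ge> T / 2 then 0 else T)"
  have s: "s \<in> {0..T}" "\<bar>s - t\<bar> \<ge> T / 2" using T t by (auto simp: s_def)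
  have "cmod (f s - f t - (s - t) *\<^sub>R f' t) \<le> \<bar>s - t\<bar> * (A * T)"
    by (rule taylor_oscillation_1[OF d1 osc t s(1)])
  moreover have "cmod ((s - t) *\<^sub>R f' t) \<le> cmod (f s - f t - (s - t) *\<^sub>R f' t) + cmod (f s - f t)"
    using norm_triangle_ineq4[of "f s - f t" "f s - f t - (s - t) *\<^sub>R f' t"] by (simp add: algebra_simps)
  moreover have "cmod (f s - f t) \<le> 2 * A"
    using norm_triangle_ineq4[of "f s" "f t"] A(1)[OF s(1)] A(1)[OF t] by linarith
  ultimately have "\<bar>s - t\<bar> * cmod (f' t) \<le> 2 * A + \<bar>s - t\<bar> * (A * T)" by simp
  also have "2 * A \<le> \<bar>s - t\<bar> * (4 / T * A)"
  proof -
    have "2 * A = T / 2 * (4 / T * A)" using T by simp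
    also have "\<dots> \<le> \<bar>s - t\<bar> * (4 / T * A)" using s T A0 by (intro mult_right_mono) auto
    finally show ?thesis .
  qed
  finally have "\<bar>s - t\<bar> * cmod (f' t) \<le> \<bar>s - t\<bar> * ((4 / T + T) * A)" by (simp add: algebra_simps)
  moreover have "0 < \<bar>s - t\<bar>" using s T by linarith
  ultimately show ?thesis by simp
qed

text \<open>
The recursion may be assumed only as long as the claimed bound holds at the current level.  In the
application this bound keeps the numerical solution in the region where the nonlinearity is
Lipschitz continuous.
\<close>

lemma three_level_gronwall:
  fixes Y :: "nat \<Rightarrow> real"
  assumes y: "0 \<le> y" and q: "0 \<le> q" and "Y 0 \<le> y" "Y 1 \<le> y"
    and step: "\<And>k. 1 \<le> k \<Longrightarrow> k < N \<Longrightarrow> Y k \<le> y * (1 + q) ^ k \<Longrightarrow> Y (k + 1) \<le> Y (k - 1) + q * Y k"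
    and k: "k \<le> N"
  shows "Y k \<le> y * (1 + q) ^ k"
  using k
proof (induction k rule: less_induct)
  case (less k)
  show ?case
  proof (cases "k \<le> 1")
    case True
    have "y * 1 \<le> y * (1 + q) ^ k" using y q by (intro mult_left_mono) auto
    moreover have "Y k \<le> y" using assms(3,4) True by (cases k) auto
    ultimately show ?thesis by simp
  next
    case False
    then obtain l where l: "k = Suc l" "1 \<le> l" by (cases k) auto
    have Yl: "Y l \<le> y * (1 + q) ^ l" using less l by auto
    have Yl1: "Y (l - 1) \<le> y * (1 + q) ^ (l - 1)" using less l by auto
    have "y * (1 + q) ^ (l - 1) \<le> y * (1 + q) ^ l" using y q by (intro mult_left_mono power_increasing) auto
    then have "Y (l + 1) \<le> y * (1 + q) ^ l + q * (y * (1 + q) ^ l)"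
      using step[OF l(2) _ Yl] less.prems l Yl1 mult_left_mono[OF Yl q] by auto
    then show ?thesis by (simp add: l algebra_simps)
  qed
qed

text \<open>
The weight $1/\<epsilon>$ balances the Lipschitz constant of order $1/\<epsilon>$ of the derivative of the
nonlinearity.
\<close>

definition wnorm :: "real \<Rightarrow> real \<Rightarrow> nat \<Rightarrow> (nat \<Rightarrow> complex) \<Rightarrow> real" where
  "wnorm \<epsilon> h M v = d_seminorm_H1 h M v + d_norm h M v / \<epsilon>"

lemma wnorm_triangle:
  assumes "0 \<le> h" "0 < \<epsilon>" shows "wnorm \<epsilon> h M (\<lambda>j. v j + w j) \<le> wnorm \<epsilon> h M v + wnorm \<epsilon> h M w"
  unfolding wnorm_def
  using d_seminorm_triangle[OF assms(1), of M v w] divide_right_mono[OF d_norm_triangle[OF assms(1), of M v w], of \<epsilon>] assms(2)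
  by (simp add: add_divide_distrib)

lemma wnorm_cong: "(\<And>j. j \<le> M \<Longrightarrow> v j = w j) \<Longrightarrow> wnorm \<epsilon> h M v = wnorm \<epsilon> h M w"
  unfolding wnorm_def using d_seminorm_cong[of M v w h] d_norm_cong[of M v w h] by simp

lemma wnorm_le_sup:
  assumes h: "0 < h" and e: "0 < \<epsilon>" "\<epsilon> \<le> 1" and v: "v 0 = 0" and c: "\<And>j. j < M \<Longrightarrow> cmod (dx_plus h v j) \<le> c" "0 \<le> c"
  shows "wnorm \<epsilon> h M v \<le> (1 + h * real M) * sqrt (h * real M) / \<epsilon> * c"
proof -
  let ?L = "h * real M"
  have s: "d_seminorm_H1 h M v \<le> sqrt ?L * c" by (rule d_seminorm_le_sup) (use h c in auto)
  have "d_norm h M v \<le> ?L * d_seminorm_H1 h M v" by (rule d_norm_le_seminorm[where v = v, OF h v])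
  also have "\<dots> \<le> ?L * (sqrt ?L * c)" using h by (intro mult_left_mono s) auto
  finally have "d_norm h M v / \<epsilon> \<le> ?L * (sqrt ?L * c) / \<epsilon>" using e by (intro divide_right_mono) auto
  moreover have "sqrt ?L * c \<le> sqrt ?L * c / \<epsilon>"
    using e h c mult_left_mono[of 1 "inverse \<epsilon>" "sqrt ?L * c"] by (simp add: divide_inverse one_le_inverse)
  ultimately have "wnorm \<epsilon> h M v \<le> sqrt ?L * c / \<epsilon> + ?L * (sqrt ?L * c) / \<epsilon>" using s by (simp add: wnorm_def)
  also have "\<dots> = (1 + ?L) * sqrt ?L / \<epsilon> * c" using e by (simp add: field_simps)
  finally show ?thesis .
qed

lemma wnorm_energy:
  assumes h: "0 < h" and M: "0 < M" and tau: "0 < \<tau>" and e: "0 < \<epsilon>"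
    and p: "p 0 = 0" "p M = 0" and q: "q 0 = 0" "q M = 0" and g: "g 0 = 0" "g M = 0"
    and eq: "\<And>j. 1 \<le> j \<Longrightarrow> j < M \<Longrightarrow> \<i> * ((p j - q j) /\<^sub>R (2 * \<tau>)) + (1/2) * dxx h (\<lambda>i. p i + q i) j = g j"
  shows "wnorm \<epsilon> h M p \<le> wnorm \<epsilon> h M q + 2 * \<tau> * wnorm \<epsilon> h M g"
proof -
  have "d_norm h M p \<le> d_norm h M q + 2 * \<tau> * d_norm h M g"
    by (rule energy_L2[OF h M tau p q eq])
  then have "d_norm h M p / \<epsilon> \<le> (d_norm h M q + 2 * \<tau> * d_norm h M g) / \<epsilon>" using e by (intro divide_right_mono) auto
  moreover have "d_seminorm_H1 h M p \<le> d_seminorm_H1 h M q + 2 * \<tau> * d_seminorm_H1 h M g"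
    by (rule energy_H1[OF h M tau p q eq g])
  ultimately show ?thesis by (simp add: wnorm_def add_divide_distrib distrib_left)
qed

text \<open>
By the four-point inequality, the differences of the nonlinear terms are bounded by the differences
of the error, with a factor of order $|\ln \<epsilon>|$, plus $10 B/\<epsilon>$ times the error itself.  The weight in
\<open>wnorm\<close> turns the factor $1/\<epsilon>$ of the second part into a constant.
\<close>

lemma wnorm_nonlinearity:
  assumes h: "0 < h" and M: "0 < M" and e: "0 < \<epsilon>" "\<epsilon> \<le> 1"
    and R: "\<And>j. j \<le> M \<Longrightarrow> cmod (u j) \<le> R" "\<And>j. j \<le> M \<Longrightarrow> cmod (U j) \<le> R"
    and z: "u 0 = U 0" "u M = U M" and B: "\<And>j. j < M \<Longrightarrow> cmod (dx_plus h u j) \<le> B" "0 \<le> B"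
  shows "wnorm \<epsilon> h M (\<lambda>j. log_nl \<epsilon> (u j) - log_nl \<epsilon> (U j)) \<le> (2 * (\<bar>ln \<epsilon>\<bar> + ln (1 + R)) + 2 + 20 * B) * wnorm \<epsilon> h M (\<lambda>j. u j - U j)"
proof -
  define K where "K = 2 * (\<bar>ln \<epsilon>\<bar> + ln (1 + R)) + 2"
  have "0 \<le> R" using R(1)[of 0] norm_ge_zero order_trans by blast
  then have K: "0 \<le> K" by (simp add: K_def)
  let ?x = "\<lambda>j. log_nl \<epsilon> (u j) - log_nl \<epsilon> (U j)" and ?e = "\<lambda>j. u j - U j"
  define C where "C = 10 / \<epsilon> * B"
  have C: "0 \<le> C" using e B by (simp add: C_def)
  have h0: "0 \<le> h" using h by simp
  have s: "cmod (dx_plus h ?x j) \<le> K * cmod (dx_plus h ?e j) + C * (cmod (?e (j + 1)) + cmod (?e j))" if j: "j < M" for j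
  proof -
    have "cmod ((log_nl \<epsilon> (u (j+1)) - log_nl \<epsilon> (U (j+1))) - (log_nl \<epsilon> (u j) - log_nl \<epsilon> (U j)))
       \<le> K * cmod (?e (j+1) - ?e j) + 10 / \<epsilon> * (cmod (?e (j+1)) + cmod (?e j)) * cmod (u (j+1) - u j)"
      unfolding K_def by (rule log_nl_four_points[OF e]) (use R j in auto)
    also have "cmod (u (j+1) - u j) = h * cmod (dx_plus h u j)" using h by (simp add: dx_plus_def)
    also have "10 / \<epsilon> * (cmod (?e (j+1)) + cmod (?e j)) * (h * cmod (dx_plus h u j)) \<le> 10 / \<epsilon> * (cmod (?e (j+1)) + cmod (?e j)) * (h * B)"
      using e h B(1)[OF j] by (intro mult_left_mono) auto
    also have "\<dots> = h * (C * (cmod (?e (j+1)) + cmod (?e j)))" by (simp add: C_def)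
    also have "cmod (?e (j+1) - ?e j) = h * cmod (dx_plus h ?e j)" using h by (simp add: dx_plus_def)
    finally have "cmod ((log_nl \<epsilon> (u (j+1)) - log_nl \<epsilon> (U (j+1))) - (log_nl \<epsilon> (u j) - log_nl \<epsilon> (U j)))
       \<le> h * (K * cmod (dx_plus h ?e j) + C * (cmod (?e (j + 1)) + cmod (?e j)))"
      by (simp add: distrib_left mult.left_commute)
    moreover have "cmod (dx_plus h ?x j) = cmod ((log_nl \<epsilon> (u (j+1)) - log_nl \<epsilon> (U (j+1))) - (log_nl \<epsilon> (u j) - log_nl \<epsilon> (U j))) / h"
      using h by (simp add: dx_plus_def divide_inverse mult.commute)
    ultimately show ?thesis using h by (simp only: pos_divide_le_eq mult.commute)
  qed
  have shift: "sqrt h * L2_set (\<lambda>j. cmod (?e (j + 1))) {..<M} = d_norm h M ?e"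
  proof -
    have "(\<Sum>j<M. (cmod (?e (j + 1)))\<^sup>2) = (\<Sum>j=1..M. (cmod (?e j))\<^sup>2)"
      by (rule sum.reindex_bij_witness[of _ "\<lambda>j. j - 1" "\<lambda>j. j + 1"]) auto
    also have "\<dots> = (\<Sum>j=1..M-1. (cmod (?e j))\<^sup>2)"
      using M z by (cases M) auto
    finally show ?thesis by (simp add: d_norm_L2_set h0 L2_set_def)
  qed
  have noshift: "sqrt h * L2_set (\<lambda>j. cmod (?e j)) {..<M} = d_norm h M ?e"
  proof -
    have "{..<M} = insert 0 {1..M-1}" using M by auto
    then have "(\<Sum>j<M. (cmod (?e j))\<^sup>2) = (\<Sum>j=1..M-1. (cmod (?e j))\<^sup>2)" using z by simp
    then show ?thesis by (simp add: d_norm_L2_set h0 L2_set_def)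
  qed
  have "d_seminorm_H1 h M ?x \<le> sqrt h * L2_set (\<lambda>j. K * cmod (dx_plus h ?e j) + C * (cmod (?e (j + 1)) + cmod (?e j))) {..<M}"
    by (rule d_seminorm_mono[OF h0 s])
  also have "\<dots> \<le> sqrt h * (K * L2_set (\<lambda>j. cmod (dx_plus h ?e j)) {..<M} + C * (L2_set (\<lambda>j. cmod (?e (j + 1))) {..<M} + L2_set (\<lambda>j. cmod (?e j)) {..<M}))"
  proof (rule mult_left_mono)
    have "L2_set (\<lambda>j. K * cmod (dx_plus h ?e j) + C * (cmod (?e (j + 1)) + cmod (?e j))) {..<M}
       \<le> L2_set (\<lambda>j. K * cmod (dx_plus h ?e j)) {..<M} + L2_set (\<lambda>j. C * (cmod (?e (j + 1)) + cmod (?e j))) {..<M}"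
      by (rule L2_set_triangle_ineq)
    also have "\<dots> = K * L2_set (\<lambda>j. cmod (dx_plus h ?e j)) {..<M} + C * L2_set (\<lambda>j. cmod (?e (j + 1)) + cmod (?e j)) {..<M}"
      by (simp only: L2_set_right_distrib[OF K] L2_set_right_distrib[OF C])
    also have "\<dots> \<le> K * L2_set (\<lambda>j. cmod (dx_plus h ?e j)) {..<M} + C * (L2_set (\<lambda>j. cmod (?e (j + 1))) {..<M} + L2_set (\<lambda>j. cmod (?e j)) {..<M})"
      by (intro add_left_mono mult_left_mono L2_set_triangle_ineq C)
    finally show "L2_set (\<lambda>j. K * cmod (dx_plus h ?e j) + C * (cmod (?e (j + 1)) + cmod (?e j))) {..<M} \<le> \<dots>" .
  qed (use h in simp)
  also have "\<dots> = K * d_seminorm_H1 h M ?e + C * (d_norm h M ?e + d_norm h M ?e)"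
  proof -
    have gen: "r * (K * A + C * (S1 + S0)) = K * (r * A) + C * (r * S1 + r * S0)" for r A S1 S0 :: real
      by (simp add: algebra_simps)
    show ?thesis unfolding gen shift noshift d_seminorm_L2_set[OF h0] ..
  qed
  finally have 1: "d_seminorm_H1 h M ?x \<le> K * d_seminorm_H1 h M ?e + C * (d_norm h M ?e + d_norm h M ?e)" .
  have "d_norm h M ?x \<le> sqrt h * L2_set (\<lambda>j. K * cmod (?e j)) {1..M-1}"
    by (rule d_norm_mono[OF h0]) (use log_nl_lipschitz[OF e] R in \<open>auto simp: K_def\<close>)
  also have "\<dots> = K * d_norm h M ?e" by (simp add: d_norm_L2_set h0 L2_set_right_distrib[OF K, symmetric])
  finally have 2: "d_norm h M ?x / \<epsilon> \<le> K * d_norm h M ?e / \<epsilon>" using e by (intro divide_right_mono) auto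
  have "wnorm \<epsilon> h M ?x \<le> K * d_seminorm_H1 h M ?e + C * (d_norm h M ?e + d_norm h M ?e) + K * d_norm h M ?e / \<epsilon>"
    using 1 2 by (simp add: wnorm_def)
  also have "\<dots> = K * wnorm \<epsilon> h M ?e + 20 * B * (d_norm h M ?e / \<epsilon>)"
    by (simp add: wnorm_def C_def distrib_left)
  also have "\<dots> \<le> K * wnorm \<epsilon> h M ?e + 20 * B * wnorm \<epsilon> h M ?e"
    using B d_seminorm_nonneg[OF h0] by (intro add_left_mono mult_left_mono) (auto simp: wnorm_def)
  finally show ?thesis by (simp add: K_def distrib_right)
qed

section \<open>Consistency of the projected solution\<close>

lemma has_vector_derivative_const_scaleR:
  "(f has_vector_derivative f') F \<Longrightarrow> ((\<lambda>s. c *\<^sub>R f s) has_vector_derivative c *\<^sub>R f') F"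
  by (rule bounded_linear.has_vector_derivative[OF bounded_linear_scaleR_right])

lemma dx_plus_time_derivative:
  assumes "((\<lambda>s. v s j) has_vector_derivative v' j) F" "((\<lambda>s. v s (j + 1)) has_vector_derivative v' (j + 1)) F"
  shows "((\<lambda>s. dx_plus h (v s) j) has_vector_derivative dx_plus h v' j) F"
  unfolding dx_plus_def by (intro has_vector_derivative_const_scaleR has_vector_derivative_diff assms)

lemma ritz_time_derivative:
  assumes "\<And>l. l < M \<Longrightarrow> 1 \<le> l \<Longrightarrow> ((\<lambda>s. c s l) has_vector_derivative c' l) F" "j \<le> M"
  shows "((\<lambda>s. ritz h M (c s) j) has_vector_derivative ritz h M c' j) F"
  unfolding ritz_def csum_def
  by (intro has_vector_derivative_const_scaleR has_vector_derivative_diff has_vector_derivative_sum assms(1))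
     (use assms(2) in auto)

lemma dx_plus_node_le:
  assumes ab: "a < b" and d: "\<And>x. x \<in> {a..b} \<Longrightarrow> (f has_vector_derivative f' x) (at x within {a..b})"
    and B: "\<And>x. x \<in> {a..b} \<Longrightarrow> cmod (f' x) \<le> B" and j: "j < M"
  shows "cmod (dx_plus (mesh a b M) (\<lambda>j. f (node a b M j)) j) \<le> B"
proof -
  have h: "0 < mesh a b M" using ab j by (intro mesh_pos) auto
  have "cmod (f (node a b M (Suc j)) - f (node a b M j)) \<le> B * \<bar>node a b M (Suc j) - node a b M j\<bar>"
    using d B by (rule vector_mvt) (use node_in[OF ab] j in auto)
  also have "\<dots> = B * mesh a b M" using h by (simp add: node_Suc)
  finally have "cmod (f (node a b M (Suc j)) - f (node a b M j)) / mesh a b M \<le> B"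
    using h by (simp add: pos_divide_le_eq)
  then show ?thesis using h by (simp add: dx_plus_def divide_inverse mult.commute)
qed

lemma midpoint_error:
  assumes ab: "a < b" and d1: "\<And>x. x \<in> {a..b} \<Longrightarrow> (f has_vector_derivative f1 x) (at x within {a..b})"
    and d2: "\<And>x. x \<in> {a..b} \<Longrightarrow> (f1 has_vector_derivative f2 x) (at x within {a..b})"
    and d3: "\<And>x. x \<in> {a..b} \<Longrightarrow> (f2 has_vector_derivative f3 x) (at x within {a..b})"
    and B: "\<And>x. x \<in> {a..b} \<Longrightarrow> cmod (f3 x) \<le> B" and j: "j < M"
  shows "cmod (dx_plus (mesh a b M) (\<lambda>j. f (node a b M j)) j - f1 (node a b M j + mesh a b M / 2)) \<le> B * (mesh a b M)\<^sup>2"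
proof -
  define h where "h = mesh a b M"
  define \<tau> y where "\<tau> = h / 2" and "y = node a b M j + h / 2"
  have h: "0 < h" unfolding h_def using ab j by (intro mesh_pos) auto
  have y: "y - \<tau> = node a b M j" "y + \<tau> = node a b M (Suc j)" by (auto simp: y_def \<tau>_def node_Suc h_def)
  have sub: "{y-\<tau>..y+\<tau>} \<subseteq> {a..b}"
    unfolding y using node_in[OF ab, of M j] node_in[OF ab, of M "Suc j"] j by auto
  have "cmod ((f (y + \<tau>) - f (y - \<tau>)) /\<^sub>R (2 * \<tau>) - f1 y) \<le> B * \<tau>\<^sup>2"
  proof (rule central_difference_error[where f = f and f' = f1 and f'' = f2 and f''' = f3])
    show "0 < \<tau>" using h by (simp add: \<tau>_def)
  qed (use d1 d2 d3 B sub in \<open>auto intro: has_vector_derivative_within_subset[OF _ sub]\<close>)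
  also have "B * \<tau>\<^sup>2 \<le> B * h\<^sup>2"
  proof (rule mult_left_mono)
    show "\<tau>\<^sup>2 \<le> h\<^sup>2" unfolding \<tau>_def using h by (intro power_mono) auto
    show "0 \<le> B" using B[of a] ab norm_ge_zero[of "f3 a"] by (meson atLeastAtMost_iff less_imp_le order_refl order_trans)
  qed
  finally show ?thesis unfolding y by (simp add: dx_plus_def h_def[symmetric] \<tau>_def y_def)
qed

lemma defect_telescope:
  "g1 (node a b M j + mesh a b M / 2) - g1 (node a b M 0 + mesh a b M / 2) - csum (mesh a b M) (\<lambda>l. g2 (node a b M l)) j
    = defect a b M j g1 g2"
proof (induction j)
  case (Suc j)
  have "node a b M (Suc j) - mesh a b M / 2 = node a b M j + mesh a b M / 2" by (simp add: node_Suc)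
  then show ?case using Suc by (simp add: defect_def csum_def scaleR_add_right algebra_simps)
qed (simp add: defect_def csum_def)

context classical_solution
begin

text \<open>
The deviation of a time derivative of the solution from its Ritz projection.
\<close>

definition ritz_err :: "nat \<Rightarrow> nat \<Rightarrow> real \<Rightarrow> nat \<Rightarrow> complex" where
  "ritz_err M i t j = W i 0 t (node a b M j) - ritz (mesh a b M) M (\<lambda>l. W i 2 t (node a b M l)) j"

lemma B_nonneg: "0 \<le> B"
  using order_trans[OF norm_ge_zero bound[of 0 0 0 a]] ab T by simp

lemma ritz_err_bdry: "0 < M \<Longrightarrow> i \<le> 2 \<Longrightarrow> t \<in> {0..T} \<Longrightarrow> ritz_err M i t 0 = 0 \<and> ritz_err M i t M = 0"
  using bdry_time[of i t] by (simp add: ritz_err_def ritz_0 ritz_M node_0 node_M)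

text \<open>
Both the divided difference and the partial sums of the second derivative approximate the
first derivative at the midpoints of the cells, the latter with the error \<open>defect\<close>.
\<close>

lemma ritz_err_le:
  assumes i: "i \<in> {0, 2}" and t: "t \<in> {0..T}" and j: "j < M"
  shows "cmod (dx_plus (mesh a b M) (ritz_err M i t) j) \<le> 4 * B * (mesh a b M)\<^sup>2"
proof -
  let ?h = "mesh a b M" and ?x = "node a b M"
  have M: "0 < M" using j by simp
  have h: "0 < ?h" using ab M by (rule mesh_pos)
  have i2: "i \<le> 2" using i by auto
  have "cmod (dx_plus ?h (\<lambda>j. W i 0 t (?x j) - ritz ?h M (\<lambda>l. W i 2 t (?x l)) j) j) \<le> 2 * (2 * B * ?h\<^sup>2)"
    \<comment> \<open>The constant is the first derivative at the first midpoint, where the partial sums start.\<close>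
  proof (rule dx_plus_minus_ritz_le[OF h M _ _ _ j, where \<kappa> = "W i 1 t (?x 0 + ?h / 2)"])
    show "W i 0 t (?x 0) = 0" "W i 0 t (?x M) = 0" using bdry_time[OF i2 t] M by (auto simp: node_0 node_M)
    fix j assume j: "j < M"
    have dW: "(W i n t has_vector_derivative W i (Suc n) t x) (at x within {a..b})" if "n < 3" "x \<in> {a..b}" for n x
      by (rule dx[OF i2 that(1) t that(2)])
    have E: "dx_plus ?h (\<lambda>j. W i 0 t (?x j)) j - csum ?h (\<lambda>l. W i 2 t (?x l)) j - W i 1 t (?x 0 + ?h / 2)
       = (dx_plus ?h (\<lambda>j. W i 0 t (?x j)) j - W i 1 t (?x j + ?h / 2)) + defect a b M j (W i 1 t) (W i 2 t)"
      unfolding defect_telescope[symmetric] by simp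
    have "cmod (dx_plus ?h (\<lambda>j. W i 0 t (?x j)) j - W i 1 t (?x j + ?h / 2)) \<le> B * ?h\<^sup>2"
      by (rule midpoint_error[OF ab, of "W i 0 t" "W i 1 t" "W i 2 t" "W i 3 t"])
         (use dW[of 0] dW[of 1] dW[of 2] bound[OF i, of 3 t] t j in \<open>auto simp: numeral_eq_Suc\<close>)
    moreover have "cmod (defect a b M j (W i 1 t) (W i 2 t)) \<le> ?h\<^sup>2 * B" by (rule defect_le[OF i j t])
    moreover have "cmod ((dx_plus ?h (\<lambda>j. W i 0 t (?x j)) j - W i 1 t (?x j + ?h / 2)) + defect a b M j (W i 1 t) (W i 2 t))
       \<le> cmod (dx_plus ?h (\<lambda>j. W i 0 t (?x j)) j - W i 1 t (?x j + ?h / 2)) + cmod (defect a b M j (W i 1 t) (W i 2 t))"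
      by (rule norm_triangle_ineq)
    moreover have "B * ?h\<^sup>2 + ?h\<^sup>2 * B = 2 * B * ?h\<^sup>2" by simp
    ultimately show "cmod (dx_plus ?h (\<lambda>j. W i 0 t (?x j)) j - csum ?h (\<lambda>l. W i 2 t (?x l)) j - W i 1 t (?x 0 + ?h / 2)) \<le> 2 * B * ?h\<^sup>2"
      unfolding E by linarith
  qed
  then show ?thesis by (simp add: ritz_err_def[abs_def])
qed

lemma W_dt:
  assumes "i < 2 \<and> n \<le> 3 \<or> i = 2 \<and> n \<le> 1" "t \<in> {0..T}" "x \<in> {a..b}"
  shows "((\<lambda>s. W i n s x) has_vector_derivative W (Suc i) n t x) (at t within {0..T})"
  using assms dt[of i n t x] dt2[of n t x] by (auto simp: numeral_3_eq_3)

lemma node_dt: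
  assumes "i < 2 \<and> n \<le> 3 \<or> i = 2 \<and> n \<le> 1" "t \<in> {0..T}" "j < M"
  shows "((\<lambda>s. dx_plus (mesh a b M) (\<lambda>j. W i n s (node a b M j)) j) has_vector_derivative
     dx_plus (mesh a b M) (\<lambda>j. W (Suc i) n t (node a b M j)) j) (at t within {0..T})"
  by (rule dx_plus_time_derivative; rule W_dt[OF assms(1,2)]) (use node_in[OF ab, of M] assms(3) in auto)

lemma ritz_err_dt:
  assumes i: "i < 2" and t: "t \<in> {0..T}" and j: "j < M"
  shows "((\<lambda>s. dx_plus (mesh a b M) (ritz_err M i s) j) has_vector_derivative dx_plus (mesh a b M) (ritz_err M (Suc i) t) j) (at t within {0..T})"
proof (rule dx_plus_time_derivative)
  have "((\<lambda>s. ritz_err M i s l) has_vector_derivative ritz_err M (Suc i) t l) (at t within {0..T})" if "l \<le> M" for l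
    unfolding ritz_err_def
  proof (intro has_vector_derivative_diff ritz_time_derivative that)
    show "((\<lambda>s. W i 0 s (node a b M l)) has_vector_derivative W (Suc i) 0 t (node a b M l)) (at t within {0..T})"
      by (rule W_dt) (use i t node_in[OF ab, of M l] that j in auto)
    show "((\<lambda>s. W i 2 s (node a b M l)) has_vector_derivative W (Suc i) 2 t (node a b M l)) (at t within {0..T})"
      if "l < M" for l
      by (rule W_dt) (use i t node_in[OF ab, of M l] that j in auto)
  qed
  then show "((\<lambda>s. ritz_err M i s j) has_vector_derivative ritz_err M (Suc i) t j) (at t within {0..T})"
     "((\<lambda>s. ritz_err M i s (j + 1)) has_vector_derivative ritz_err M (Suc i) t (j + 1)) (at t within {0..T})"
    using j by auto
qed

lemma ritz_err_difference_le:
  assumes j: "j < M" and tau: "0 < \<tau>" and t: "0 \<le> t - \<tau>" "t + \<tau> \<le> T"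
  shows "cmod ((dx_plus (mesh a b M) (ritz_err M 0 (t + \<tau>)) j - dx_plus (mesh a b M) (ritz_err M 0 (t - \<tau>)) j) /\<^sub>R (2 * \<tau>))
    \<le> (4 / T + T) * (4 * B * (mesh a b M)\<^sup>2)"
proof -
  let ?K = "(4 / T + T) * (4 * B * (mesh a b M)\<^sup>2)"
  let ?f = "\<lambda>i s. dx_plus (mesh a b M) (ritz_err M i s) j"
  have D0: "(?f 0 has_vector_derivative ?f 1 z) (at z within {0..T})" if "z \<in> {0..T}" for z
    using ritz_err_dt[of 0 z j M] that j by simp
  have D1: "(?f 1 has_vector_derivative ?f 2 z) (at z within {0..T})" if "z \<in> {0..T}" for z
    using ritz_err_dt[of 1 z j M] that j by (simp add: numeral_2_eq_2)
  have A: "cmod (?f 0 z) \<le> 4 * B * (mesh a b M)\<^sup>2" "cmod (?f 2 z) \<le> 4 * B * (mesh a b M)\<^sup>2" if "z \<in> {0..T}" for z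
    using ritz_err_le[of 0 z j M] ritz_err_le[of 2 z j M] that j by auto
  have d: "cmod (?f 1 s) \<le> ?K" if s: "s \<in> {0..T}" for s
    by (rule derivative_interpolation[where f = "?f 0" and f' = "?f 1" and f'' = "?f 2", OF T D0 D1 A s])
  have in0: "t + \<tau> \<in> {0..T}" "t - \<tau> \<in> {0..T}" using t tau by auto
  have "cmod (?f 0 (t + \<tau>) - ?f 0 (t - \<tau>)) \<le> ?K * \<bar>(t + \<tau>) - (t - \<tau>)\<bar>"
    by (rule vector_mvt[where f = "?f 0" and f' = "?f 1", OF D0 d in0])
  then have "cmod (dx_plus (mesh a b M) (ritz_err M 0 (t + \<tau>)) j - dx_plus (mesh a b M) (ritz_err M 0 (t - \<tau>)) j) / (2 * \<tau>) \<le> ?K"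
    using tau by (simp add: pos_divide_le_eq)
  moreover have "cmod (x /\<^sub>R (2 * \<tau>)) = cmod x / (2 * \<tau>)" for x :: complex
  proof -
    have "\<bar>inverse (2 * \<tau>)\<bar> = inverse (2 * \<tau>)" using tau by simp
    then have "cmod (x /\<^sub>R (2 * \<tau>)) = inverse (2 * \<tau>) * cmod x" by (simp only: norm_scaleR)
    then show ?thesis by (metis divide_inverse mult.commute)
  qed
  ultimately show ?thesis by (simp only:)
qed

text \<open>
The residual of the Ritz projection in the scheme, after the equation has been used to express the
nonlinearity.  The three parts are the error of the central time difference, the time difference
of the projection error, and the error of averaging in time.
\<close>

definition consistency :: "nat \<Rightarrow> real \<Rightarrow> real \<Rightarrow> nat \<Rightarrow> complex" where
  "consistency M \<tau> t j = \<i> * ((W 0 0 (t + \<tau>) (node a b M j) - W 0 0 (t - \<tau>) (node a b M j)) /\<^sub>R (2 * \<tau>) - W 1 0 t (node a b M j))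
     - \<i> * ((ritz_err M 0 (t + \<tau>) j - ritz_err M 0 (t - \<tau>) j) /\<^sub>R (2 * \<tau>))
     + ((1/2) * (W 0 2 (t + \<tau>) (node a b M j) + W 0 2 (t - \<tau>) (node a b M j)) - W 0 2 t (node a b M j))"

definition consist_const :: real where "consist_const = 4 * B + 4 * B * (4 / T + T)"

lemma consist_const_ge: "4 * B \<le> consist_const" "0 \<le> consist_const"
  using B_nonneg T by (auto simp: consist_const_def)

lemma consistency_bdry:
  assumes "0 < M" "0 < \<tau>" "0 \<le> t - \<tau>" "t + \<tau> \<le> T"
  shows "consistency M \<tau> t 0 = 0" "consistency M \<tau> t M = 0"
  using assms bdry_time[of 0 "t + \<tau>"] bdry_time[of 0 "t - \<tau>"] bdry_time[of 1 t] bdry_xx[of "t + \<tau>"] bdry_xx[of "t - \<tau>"] bdry_xx[of t]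
    ritz_err_bdry[of M 0 "t + \<tau>"] ritz_err_bdry[of M 0 "t - \<tau>"]
  by (auto simp: consistency_def node_0 node_M)

text \<open>
All three parts are linear in the solution, so space differences commute with the time
differences, and the one-dimensional estimates apply to the space difference at a fixed cell.
\<close>

lemma consistency_le:
  assumes j: "j < M" and tau: "0 < \<tau>" and t: "0 \<le> t - \<tau>" "t + \<tau> \<le> T"
  shows "cmod (dx_plus (mesh a b M) (consistency M \<tau> t) j) \<le> consist_const * ((mesh a b M)\<^sup>2 + \<tau>\<^sup>2)"
proof -
  let ?D = "\<lambda>v. dx_plus (mesh a b M) v j" and ?x = "node a b M"
  have I: "{t-\<tau>..t+\<tau>} \<subseteq> {0..T}" using t by auto
  have dtI: "((\<lambda>s. ?D (\<lambda>j. W i n s (?x j))) has_vector_derivative ?D (\<lambda>j. W (Suc i) n z (?x j))) (at z within {t-\<tau>..t+\<tau>})"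
    if "i < 2 \<and> n \<le> 3 \<or> i = 2 \<and> n \<le> 1" "z \<in> {t-\<tau>..t+\<tau>}" for i n z
    by (rule has_vector_derivative_within_subset[OF node_dt[OF that(1) _ j] I]) (use that I in auto)
  have W3: "cmod (?D (\<lambda>j. W 3 0 z (?x j))) \<le> B" if "z \<in> {t-\<tau>..t+\<tau>}" for z
    by (rule dx_plus_node_le[OF ab dx3 bound3 j]) (use that I in auto)
  have W22: "cmod (?D (\<lambda>j. W 2 2 z (?x j))) \<le> B" if "z \<in> {t-\<tau>..t+\<tau>}" for z
    by (rule dx_plus_node_le[OF ab _ _ j, of _ "W 2 3 z"]) (use that I dx[of 2 2 z] bound[of 2 3 z] in \<open>auto simp: numeral_3_eq_3\<close>)
  have 1: "cmod ((?D (\<lambda>j. W 0 0 (t + \<tau>) (?x j)) - ?D (\<lambda>j. W 0 0 (t - \<tau>) (?x j))) /\<^sub>R (2 * \<tau>) - ?D (\<lambda>j. W 1 0 t (?x j))) \<le> B * \<tau>\<^sup>2"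
    by (rule central_difference_error[OF tau, of t "\<lambda>s. ?D (\<lambda>j. W 0 0 s (?x j))" "\<lambda>s. ?D (\<lambda>j. W 1 0 s (?x j))" "\<lambda>s. ?D (\<lambda>j. W 2 0 s (?x j))" "\<lambda>s. ?D (\<lambda>j. W 3 0 s (?x j))"])
       (use dtI[of 0 0] dtI[of 1 0] dtI[of 2 0] W3 in \<open>auto simp: numeral_eq_Suc\<close>)
  have 2: "cmod ((1/2) * (?D (\<lambda>j. W 0 2 (t + \<tau>) (?x j)) + ?D (\<lambda>j. W 0 2 (t - \<tau>) (?x j))) - ?D (\<lambda>j. W 0 2 t (?x j))) \<le> B * \<tau>\<^sup>2"
    by (rule central_average_error[of \<tau> t "\<lambda>s. ?D (\<lambda>j. W 0 2 s (?x j))" "\<lambda>s. ?D (\<lambda>j. W 1 2 s (?x j))" "\<lambda>s. ?D (\<lambda>j. W 2 2 s (?x j))"])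
       (use dtI[of 0 2] dtI[of 1 2] W22 tau in \<open>auto simp: numeral_2_eq_2\<close>)
  have 3: "cmod ((?D (ritz_err M 0 (t + \<tau>)) - ?D (ritz_err M 0 (t - \<tau>))) /\<^sub>R (2 * \<tau>)) \<le> (4 / T + T) * (4 * B * (mesh a b M)\<^sup>2)"
    by (rule ritz_err_difference_le[OF j tau t])
  define p q r where "p = (?D (\<lambda>j. W 0 0 (t + \<tau>) (?x j)) - ?D (\<lambda>j. W 0 0 (t - \<tau>) (?x j))) /\<^sub>R (2 * \<tau>) - ?D (\<lambda>j. W 1 0 t (?x j))"
    and "q = (1/2) * (?D (\<lambda>j. W 0 2 (t + \<tau>) (?x j)) + ?D (\<lambda>j. W 0 2 (t - \<tau>) (?x j))) - ?D (\<lambda>j. W 0 2 t (?x j))"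
    and "r = (?D (ritz_err M 0 (t + \<tau>)) - ?D (ritz_err M 0 (t - \<tau>))) /\<^sub>R (2 * \<tau>)"
  have "?D (consistency M \<tau> t) = \<i> * p - \<i> * r + q"
    unfolding consistency_def[abs_def] p_def q_def r_def dx_plus_add dx_plus_diff dx_plus_scale dx_plus_scaleR ..
  also have "cmod \<dots> \<le> cmod p + cmod r + cmod q"
    using norm_triangle_ineq[of "\<i> * p - \<i> * r" q] norm_triangle_ineq4[of "\<i> * p" "\<i> * r"] by (simp add: norm_mult)
  also have "\<dots> \<le> B * \<tau>\<^sup>2 + (4 / T + T) * (4 * B * (mesh a b M)\<^sup>2) + B * \<tau>\<^sup>2"
    using 1 2 3 by (simp add: p_def q_def r_def)
  also have "\<dots> \<le> consist_const * ((mesh a b M)\<^sup>2 + \<tau>\<^sup>2)"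
  proof -
    have nn: "0 \<le> 2 * B * \<tau>\<^sup>2 + 4 * B * (mesh a b M)\<^sup>2 + (4 * B * (4 / T + T)) * \<tau>\<^sup>2" using B_nonneg T by simp
    have "consist_const * ((mesh a b M)\<^sup>2 + \<tau>\<^sup>2) = B * \<tau>\<^sup>2 + (4 / T + T) * (4 * B * (mesh a b M)\<^sup>2) + B * \<tau>\<^sup>2
       + (2 * B * \<tau>\<^sup>2 + 4 * B * (mesh a b M)\<^sup>2 + (4 * B * (4 / T + T)) * \<tau>\<^sup>2)"
      unfolding consist_const_def by (simp add: algebra_simps)
    then show ?thesis using nn by linarith
  qed
  finally show ?thesis .
qed

lemma first_step_le:
  assumes j: "j < M" and tau: "0 < \<tau>" "\<tau> \<le> T"
  shows "cmod (dx_plus (mesh a b M) (\<lambda>j. W 0 0 \<tau> (node a b M j) - W 0 0 0 (node a b M j) - \<tau> *\<^sub>R W 1 0 0 (node a b M j)) j) \<le> B * \<tau>\<^sup>2"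
proof -
  let ?D = "\<lambda>v. dx_plus (mesh a b M) v j" and ?x = "node a b M"
  have I: "{0..\<tau>} \<subseteq> {0..T}" using tau by auto
  have dtI: "((\<lambda>s. ?D (\<lambda>j. W i 0 s (?x j))) has_vector_derivative ?D (\<lambda>j. W (Suc i) 0 z (?x j))) (at z within {0..\<tau>})"
    if "i < 2" "z \<in> {0..\<tau>}" for i z
    by (rule has_vector_derivative_within_subset[OF node_dt[OF _ _ j] I]) (use that I in auto)
  have W2: "cmod (?D (\<lambda>j. W 2 0 z (?x j))) \<le> B" if "z \<in> {0..\<tau>}" for z
    by (rule dx_plus_node_le[OF ab _ _ j, of _ "W 2 1 z"]) (use that I dx[of 2 0 z] bound[of 2 1 z] in auto)
  have osc: "cmod (?D (\<lambda>j. W 1 0 z (?x j)) - ?D (\<lambda>j. W 1 0 0 (?x j))) \<le> B * \<tau>" if z: "z \<in> {0..\<tau>}" for z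
  proof -
    have "cmod (?D (\<lambda>j. W 1 0 z (?x j)) - ?D (\<lambda>j. W 1 0 0 (?x j))) \<le> B * \<bar>z - 0\<bar>"
      by (rule vector_mvt[of 0 \<tau> "\<lambda>s. ?D (\<lambda>j. W 1 0 s (?x j))" "\<lambda>s. ?D (\<lambda>j. W 2 0 s (?x j))"])
         (use dtI[of 1] W2 z tau in \<open>auto simp: numeral_2_eq_2\<close>)
    also have "\<dots> \<le> B * \<tau>" using z B_nonneg by (intro mult_left_mono) auto
    finally show ?thesis .
  qed
  have "cmod (?D (\<lambda>j. W 0 0 \<tau> (?x j)) - ?D (\<lambda>j. W 0 0 0 (?x j)) - (\<tau> - 0) *\<^sub>R ?D (\<lambda>j. W 1 0 0 (?x j))) \<le> \<bar>\<tau> - 0\<bar> * (B * \<tau>)"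
    by (rule taylor_oscillation_1[of 0 \<tau> "\<lambda>s. ?D (\<lambda>j. W 0 0 s (?x j))" "\<lambda>s. ?D (\<lambda>j. W 1 0 s (?x j))"])
       (use dtI[of 0] osc tau in auto)
  then show ?thesis using tau by (simp add: dx_plus_diff dx_plus_scaleR power2_eq_square mult_ac)
qed

end

section \<open>Convergence of the scheme\<close>

lemma vector_derivative_within_interval:
  assumes "a < b" "x \<in> {a..b}" "(f has_vector_derivative f') (at x within {a..b})"
  shows "vector_derivative f (at x within {a..b}) = f'"
proof (rule vector_derivative_within[OF _ assms(3)])
  show "at x within {a..b} \<noteq> bot" using assms(1,2) by (simp add: trivial_limit_within islimpt_Icc)
qed

lemma one_plus_power_le_exp:
  assumes "0 \<le> q" shows "(1 + q) ^ k \<le> exp (real k * q)"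
proof -
  have "(1 + q) ^ k \<le> (exp q) ^ k" using assms by (intro power_mono exp_ge_add_one_self) auto
  then show ?thesis by (simp add: exp_of_nat_mult)
qed

context classical_solution
begin

lemma u_one_eq:
  assumes u0: "\<And>x. x \<in> {a..b} \<Longrightarrow> u0 x = W 0 0 0 x" and x: "x \<in> {a..b}"
  shows "u_one a b \<epsilon> u0 x = W 1 0 0 x"
proof -
  have t: "(0::real) \<in> {0..T}" using T by simp
  have 1: "vector_derivative u0 (at y within {a..b}) = W 0 1 0 y" if y: "y \<in> {a..b}" for y
  proof (rule vector_derivative_within_interval[OF ab y])
    show "(u0 has_vector_derivative W 0 1 0 y) (at y within {a..b})"
      by (rule has_vector_derivative_transform[OF y]) (use dx[of 0 0 0 y] t y u0 in auto)
  qed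
  have "vector_derivative (\<lambda>y. vector_derivative u0 (at y within {a..b})) (at x within {a..b}) = W 0 2 0 x"
  proof (rule vector_derivative_within_interval[OF ab x])
    show "((\<lambda>y. vector_derivative u0 (at y within {a..b})) has_vector_derivative W 0 2 0 x) (at x within {a..b})"
      by (rule has_vector_derivative_transform[OF x]) (use dx[of 0 1 0 x] t x 1 in \<open>auto simp: numeral_2_eq_2\<close>)
  qed
  moreover have "W 0 2 0 x = log_nl \<epsilon> (u0 x) - \<i> * W 1 0 0 x"
    using pde[OF t x] u0[OF x] by (simp add: algebra_simps)
  ultimately show ?thesis by (simp add: u_one_def)
qed

text \<open>
The Lipschitz constant of the nonlinearity with respect to \<open>wnorm\<close> on values bounded by \<open>1 + B\<close>.
\<close>

definition \<Lambda> :: real where "\<Lambda> = 2 * (\<bar>ln \<epsilon>\<bar> + ln (2 + B)) + 2 + 20 * B"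

lemma Lambda_ge_1: "1 \<le> \<Lambda>"
  using B_nonneg by (simp add: \<Lambda>_def)

text \<open>
Let \<open>\<eta>\<close> be the difference of the Ritz projection and the numerical solution.  It satisfies the linear
scheme with the right-hand side \<open>consistency\<close> plus the difference of the nonlinear terms.  The quantity
$Y_k = \|\<eta>^k\| + 2 r$ obeys $Y_{k+1} \<le> Y_{k-1} + 2 \<tau> \<Lambda> Y_k$, because $r$ bounds the residual as well as the
projection error and $\<Lambda> \<ge> 1$.
\<close>

lemma scheme_error:
  assumes e: "0 < \<epsilon>" "\<epsilon> \<le> 1" and M: "0 < M" and tau: "0 < \<tau>" and NT: "T = real N * \<tau>"
    and scheme: "\<And>k j. 1 \<le> k \<Longrightarrow> 1 \<le> j \<Longrightarrow> j < M \<Longrightarrow>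
      \<i> * dt_c \<tau> U k j = - (1/2) * dxx (mesh a b M) (\<lambda>i. U (k + 1) i + U (k - 1) i) j + log_nl \<epsilon> (U k j)"
    and U_bdry: "\<And>k. U k 0 = 0 \<and> U k M = 0"
    and U0: "\<And>j. j \<le> M \<Longrightarrow> U 0 j = W 0 0 0 (node a b M j)"
    and U1: "\<And>j. j \<le> M \<Longrightarrow> U 1 j = U 0 j + of_real \<tau> * W 1 0 0 (node a b M j)"
    and r_def: "r = (1 + (b - a)) * sqrt (b - a) / \<epsilon> * (consist_const * ((mesh a b M)\<^sup>2 + \<tau>\<^sup>2))"
    and small: "sqrt (b - a) * (3 * r * exp (2 * T * \<Lambda>)) \<le> 1"
    and k: "k \<le> N"
  shows "wnorm \<epsilon> (mesh a b M) M (\<lambda>j. W 0 0 (real k * \<tau>) (node a b M j) - U k j) \<le> 3 * r * exp (2 * T * \<Lambda>)"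
proof -
  define h where "h = mesh a b M"
  define x where "x = node a b M"
  define t where "t k = real k * \<tau>" for k
  define \<eta> where "\<eta> k j = ritz h M (\<lambda>l. W 0 2 (t k) (x l)) j - U k j" for k j
  define w where "w k = ritz_err M 0 (t k)" for k
  define err where "err k j = W 0 0 (t k) (x j) - U k j" for k j
  define D where "D = h\<^sup>2 + \<tau>\<^sup>2"
  have h: "0 < h" unfolding h_def by (rule mesh_pos[OF ab M])
  have h0: "0 \<le> h" using h by simp
  have L: "h * real M = b - a" unfolding h_def by (rule mesh_times_M[OF M])
  have tk: "t k \<in> {0..T}" if "k \<le> N" for k
    using that tau by (auto simp: t_def NT intro: mult_right_mono)
  have N0: "0 < N" using NT T by (cases N) auto
  have r_eq: "r = (1 + h * real M) * sqrt (h * real M) / \<epsilon> * (consist_const * D)" by (simp only: r_def D_def L h_def[symmetric])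
  have sup: "wnorm \<epsilon> h M v \<le> r" if "v 0 = 0" "\<And>j. j < M \<Longrightarrow> cmod (dx_plus h v j) \<le> consist_const * D" for v
    unfolding r_eq by (rule wnorm_le_sup[where v = v, OF h e that]) (use consist_const_ge in \<open>auto simp: D_def\<close>)
  have D0: "0 \<le> D" by (simp add: D_def)
  have r0: "0 \<le> r" unfolding r_eq using h e consist_const_ge D0 by (intro mult_nonneg_nonneg divide_nonneg_pos) auto
  have BD: "4 * B * h\<^sup>2 \<le> consist_const * D" "B * \<tau>\<^sup>2 + 4 * B * h\<^sup>2 \<le> consist_const * D"
  proof -
    have "4 * B * D \<le> consist_const * D" using consist_const_ge D0 by (intro mult_right_mono) auto
    moreover have "0 \<le> B * \<tau>\<^sup>2" "0 \<le> B * h\<^sup>2" using B_nonneg by auto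
    ultimately show "4 * B * h\<^sup>2 \<le> consist_const * D" "B * \<tau>\<^sup>2 + 4 * B * h\<^sup>2 \<le> consist_const * D"
      by (simp_all add: D_def algebra_simps)
  qed
  have err_eq: "err k j = \<eta> k j + w k j" for k j
    by (simp add: err_def \<eta>_def w_def ritz_err_def x_def h_def)
  have w_le: "cmod (dx_plus h (w k) j) \<le> 4 * B * h\<^sup>2" if "k \<le> N" "j < M" for k j
    unfolding w_def h_def by (rule ritz_err_le) (use tk that in auto)
  have w_bdry: "w k 0 = 0" "w k M = 0" if "k \<le> N" for k
    using ritz_err_bdry[OF M, of 0 "t k"] tk[OF that] by (auto simp: w_def)
  have w_norm: "wnorm \<epsilon> h M (w k) \<le> r" if "k \<le> N" for k
    by (rule sup) (use w_bdry[OF that] w_le[OF that] BD in \<open>auto intro: order_trans\<close>)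
  have eta_bdry: "\<eta> k 0 = 0" "\<eta> k M = 0" for k
    using U_bdry[of k] M by (auto simp: \<eta>_def ritz_0 ritz_M)
  define Y where "Y k = wnorm \<epsilon> h M (\<eta> k) + 2 * r" for k
  have err_le: "wnorm \<epsilon> h M (err k) \<le> wnorm \<epsilon> h M (\<eta> k) + r" if "k \<le> N" for k
  proof -
    have "wnorm \<epsilon> h M (err k) = wnorm \<epsilon> h M (\<lambda>j. \<eta> k j + w k j)" by (rule wnorm_cong) (simp add: err_eq)
    also have "\<dots> \<le> wnorm \<epsilon> h M (\<eta> k) + wnorm \<epsilon> h M (w k)" by (rule wnorm_triangle[OF h0 e(1)])
    finally show ?thesis using w_norm[OF that] by linarith
  qed
  have Y0: "Y 0 \<le> 3 * r"
  proof -
    have "\<eta> 0 j = (-1) * w 0 j" if "j \<le> M" for j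
      using err_eq[of 0 j] U0[OF that] by (simp add: err_def t_def x_def add_eq_0_iff)
    then have "wnorm \<epsilon> h M (\<eta> 0) = wnorm \<epsilon> h M (\<lambda>j. (-1) * w 0 j)" by (rule wnorm_cong)
    also have "\<dots> \<le> r"
      by (rule sup) (use w_bdry[of 0] w_le[of 0] BD in \<open>auto simp only: dx_plus_scale norm_mult norm_minus_cancel norm_one mult_1 mult_zero_right intro: order_trans\<close>)
    finally show ?thesis by (simp add: Y_def)
  qed
  have Y1: "Y 1 \<le> 3 * r"
  proof -
    define f where "f j = W 0 0 \<tau> (x j) - W 0 0 0 (x j) - \<tau> *\<^sub>R W 1 0 0 (x j)" for j
    have "\<eta> 1 j = f j - w 1 j" if "j \<le> M" for j
      using err_eq[of 1 j] U0[OF that] U1[OF that] by (simp add: err_def t_def x_def f_def scaleR_conv_of_real algebra_simps)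
    then have "wnorm \<epsilon> h M (\<eta> 1) = wnorm \<epsilon> h M (\<lambda>j. f j - w 1 j)" by (rule wnorm_cong)
    also have "\<dots> \<le> r"
    proof (rule sup)
      have "T \<ge> \<tau>" using tk[of 1] N0 by (simp add: t_def)
      then have "f 0 = 0"
        using bdry_time[of 0 \<tau>] bdry_time[of 0 0] bdry_time[of 1 0] T tau by (simp add: f_def x_def node_0)
      then show "f 0 - w 1 0 = 0" using w_bdry[of 1] N0 by simp
      fix j assume j: "j < M"
      have "cmod (dx_plus h f j) \<le> B * \<tau>\<^sup>2"
        unfolding f_def[abs_def] h_def x_def by (rule first_step_le) (use j tau \<open>T \<ge> \<tau>\<close> in auto)
      then show "cmod (dx_plus h (\<lambda>j. f j - w 1 j) j) \<le> consist_const * D"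
        using w_le[of 1 j] j N0 BD(2) norm_triangle_ineq4[of "dx_plus h f j" "dx_plus h (w 1) j"]
        by (simp add: dx_plus_diff)
    qed
    finally show ?thesis by (simp add: Y_def)
  qed
  define q where "q = 2 * \<tau> * \<Lambda>"
  have q0: "0 \<le> q" using tau Lambda_ge_1 by (simp add: q_def)
  have pow: "3 * r * (1 + q) ^ k \<le> 3 * r * exp (2 * T * \<Lambda>)" if "k \<le> N" for k
  proof (rule mult_left_mono)
    have "(1 + q) ^ k \<le> exp (real k * q)" by (rule one_plus_power_le_exp[OF q0])
    also have "\<dots> \<le> exp (2 * T * \<Lambda>)"
      using tk[OF that] Lambda_ge_1 by (simp add: q_def t_def)
    finally show "(1 + q) ^ k \<le> exp (2 * T * \<Lambda>)" .
  qed (use r0 in simp)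
  have step: "Y (k + 1) \<le> Y (k - 1) + q * Y k" if k: "1 \<le> k" "k < N" and Yk: "Y k \<le> 3 * r * (1 + q) ^ k" for k
  proof -
    have kN: "k \<le> N" "k + 1 \<le> N" "k - 1 \<le> N" using k by auto
    have tp: "t (k + 1) = t k + \<tau>" and tm: "t (k - 1) = t k - \<tau>"
      using k by (auto simp: t_def algebra_simps of_nat_diff)
    have tt: "0 \<le> t k - \<tau>" "t k + \<tau> \<le> T" using tk[OF kN(2)] tk[OF kN(3)] tp tm by auto
    have xj: "x j \<in> {a..b}" if "j \<le> M" for j using node_in[OF ab M that] by (simp add: x_def)
    have u_le: "cmod (W 0 0 (t k) (x j)) \<le> B" if "j \<le> M" for j
      by (rule bound) (use tk[OF kN(1)] xj[OF that] in auto)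
    have err_bdry: "err k 0 = 0" "err k M = 0"
      using err_eq[of k] eta_bdry w_bdry[OF kN(1)] by auto
    \<comment> \<open>The induction hypothesis and the discrete Sobolev inequality bound the numerical solution.\<close>
    have e_le: "cmod (err k j) \<le> 1" if "j \<le> M" for j
    proof -
      have "cmod (err k j) \<le> sqrt (h * real M) * d_seminorm_H1 h M (err k)"
        by (rule grid_sup_le_seminorm[where v = "err k", OF h err_bdry(1) that])
      also have "\<dots> \<le> sqrt (h * real M) * wnorm \<epsilon> h M (err k)"
        using h e d_norm_nonneg[OF h0] by (intro mult_left_mono) (auto simp: wnorm_def)
      also have "\<dots> \<le> sqrt (h * real M) * (3 * r * exp (2 * T * \<Lambda>))"
        using err_le[OF kN(1)] Yk pow[OF kN(1)] r0 h by (intro mult_left_mono) (auto simp: Y_def)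
      finally show ?thesis using small by (simp add: L)
    qed
    have U_le: "cmod (U k j) \<le> 1 + B" if "j \<le> M" for j
      using e_le[OF that] u_le[OF that] norm_triangle_ineq4[of "W 0 0 (t k) (x j)" "err k j"] by (simp add: err_def)
    define nlin where "nlin j = log_nl \<epsilon> (W 0 0 (t k) (x j)) - log_nl \<epsilon> (U k j)" for j
    define g where "g j = consistency M \<tau> (t k) j + nlin j" for j
    have u_bdry: "W 0 0 (t k) (x 0) = 0" "W 0 0 (t k) (x M) = 0"
      using bdry[OF tk[OF kN(1)]] M by (auto simp: x_def node_0 node_M)
    have chi_bdry: "nlin 0 = 0" "nlin M = 0" using u_bdry U_bdry[of k] by (auto simp: nlin_def)
    have chi_le: "wnorm \<epsilon> h M nlin \<le> \<Lambda> * wnorm \<epsilon> h M (err k)"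
    proof -
      have dxu: "cmod (dx_plus h (\<lambda>j. W 0 0 (t k) (x j)) j) \<le> B" if "j < M" for j
        unfolding h_def x_def
        by (rule dx_plus_node_le[OF ab, of "W 0 0 (t k)" "W 0 1 (t k)"])
           (use tk[OF kN(1)] that dx[of 0 0 "t k"] bound[of 0 1 "t k"] in auto)
      have "wnorm \<epsilon> h M (\<lambda>j. log_nl \<epsilon> (W 0 0 (t k) (x j)) - log_nl \<epsilon> (U k j)) \<le>
         (2 * (\<bar>ln \<epsilon>\<bar> + ln (1 + (1 + B))) + 2 + 20 * B) * wnorm \<epsilon> h M (\<lambda>j. W 0 0 (t k) (x j) - U k j)"
        by (rule wnorm_nonlinearity[OF h M e]) (use order_trans[OF u_le, of _ "1 + B"] U_le u_bdry U_bdry[of k] dxu B_nonneg in auto)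
      then show ?thesis by (simp add: nlin_def[abs_def] err_def[abs_def] \<Lambda>_def)
    qed
    have cons_le: "wnorm \<epsilon> h M (consistency M \<tau> (t k)) \<le> r"
      by (rule sup) (use consistency_bdry[OF M tau tt] consistency_le[OF _ tau tt] in \<open>auto simp: h_def D_def\<close>)
    have "wnorm \<epsilon> h M (\<eta> (k + 1)) \<le> wnorm \<epsilon> h M (\<eta> (k - 1)) + 2 * \<tau> * wnorm \<epsilon> h M g"
    proof (rule wnorm_energy[OF h M tau e(1) eta_bdry eta_bdry])
      show "g 0 = 0" "g M = 0" using consistency_bdry[OF M tau tt] chi_bdry by (auto simp: g_def)
      fix j assume j: "1 \<le> j" "j < M"
      define u u' Wp Wm X where "u = W 0 0 (t k) (x j)" and "u' = W 1 0 (t k) (x j)" and "Wp = W 0 2 (t k + \<tau>) (x j)"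
        and "Wm = W 0 2 (t k - \<tau>) (x j)" and "X = dxx h (\<lambda>i. U (k + 1) i + U (k - 1) i) j"
      have "dxx h (\<lambda>i. \<eta> (k + 1) i + \<eta> (k - 1) i) j =
         dxx h (\<lambda>i. ritz h M (\<lambda>l. W 0 2 (t (k+1)) (x l)) i + ritz h M (\<lambda>l. W 0 2 (t (k-1)) (x l)) i - (U (k + 1) i + U (k - 1) i)) j"
        by (simp add: \<eta>_def algebra_simps)
      also have "\<dots> = Wp + Wm - X"
        unfolding dxx_diff dxx_add X_def by (simp add: dxx_ritz[OF h M j(1)] tp[simplified] tm[simplified] Wp_def Wm_def)
      finally have dxx_eta: "dxx h (\<lambda>i. \<eta> (k + 1) i + \<eta> (k - 1) i) j = Wp + Wm - X" .
      have sch: "\<i> * ((U (k + 1) j - U (k - 1) j) /\<^sub>R (2 * \<tau>)) = - (1/2) * X + log_nl \<epsilon> (U k j)"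
        using scheme[OF k(1) j] by (simp add: dt_c_def X_def h_def)
      have pd: "\<i> * u' + W 0 2 (t k) (x j) = log_nl \<epsilon> u"
        unfolding u'_def u_def by (rule pde[OF tk[OF kN(1)] xj]) (use j in simp)
      have "\<eta> (k + 1) j - \<eta> (k - 1) j = (W 0 0 (t k + \<tau>) (x j) - W 0 0 (t k - \<tau>) (x j)) - (ritz_err M 0 (t k + \<tau>) j - ritz_err M 0 (t k - \<tau>) j)
          - (U (k + 1) j - U (k - 1) j)"
        by (simp add: \<eta>_def ritz_err_def h_def x_def tp[simplified] tm[simplified])
      then have "(\<eta> (k + 1) j - \<eta> (k - 1) j) /\<^sub>R (2 * \<tau>) = (W 0 0 (t k + \<tau>) (x j) - W 0 0 (t k - \<tau>) (x j)) /\<^sub>R (2 * \<tau>)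
          - (ritz_err M 0 (t k + \<tau>) j - ritz_err M 0 (t k - \<tau>) j) /\<^sub>R (2 * \<tau>) - (U (k + 1) j - U (k - 1) j) /\<^sub>R (2 * \<tau>)"
        by (simp only: scaleR_diff_right)
      then have "\<i> * ((\<eta> (k + 1) j - \<eta> (k - 1) j) /\<^sub>R (2 * \<tau>)) = \<i> * ((W 0 0 (t k + \<tau>) (x j) - W 0 0 (t k - \<tau>) (x j)) /\<^sub>R (2 * \<tau>))
          - \<i> * ((ritz_err M 0 (t k + \<tau>) j - ritz_err M 0 (t k - \<tau>) j) /\<^sub>R (2 * \<tau>)) - (- (1/2) * X + log_nl \<epsilon> (U k j))"
        by (simp only: right_diff_distrib sch)
      then show "\<i> * ((\<eta> (k + 1) j - \<eta> (k - 1) j) /\<^sub>R (2 * \<tau>)) + 1/2 * dxx h (\<lambda>i. \<eta> (k + 1) i + \<eta> (k - 1) i) j = g j"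
        unfolding g_def nlin_def consistency_def dxx_eta x_def[symmetric] u_def[symmetric] u'_def[symmetric] Wp_def[symmetric] Wm_def[symmetric] pd[symmetric]
        by (simp only: right_diff_distrib) (simp add: field_simps)
    qed
    also have "wnorm \<epsilon> h M g \<le> r + \<Lambda> * wnorm \<epsilon> h M (err k)"
      unfolding g_def using wnorm_triangle[OF h0 e(1), of M "consistency M \<tau> (t k)" nlin] cons_le chi_le by linarith
    also have "\<dots> \<le> r + \<Lambda> * (wnorm \<epsilon> h M (\<eta> k) + r)"
      using err_le[OF kN(1)] Lambda_ge_1 by (intro add_left_mono mult_left_mono) auto
    also have "\<dots> \<le> \<Lambda> * r + \<Lambda> * (wnorm \<epsilon> h M (\<eta> k) + r)"
      using mult_right_mono[OF Lambda_ge_1 r0] by simp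
    also have "\<dots> = \<Lambda> * Y k" by (simp add: Y_def algebra_simps)
    finally show ?thesis using tau by (simp add: Y_def q_def mult.assoc)
  qed
  have "Y k \<le> 3 * r * (1 + q) ^ k"
    by (rule three_level_gronwall[OF _ q0 Y0 Y1 step k]) (use r0 in auto)
  then have "wnorm \<epsilon> h M (err k) \<le> 3 * r * exp (2 * T * \<Lambda>)"
    using err_le[OF k] pow[OF k] r0 by (simp add: Y_def)
  then show ?thesis by (simp add: err_def[abs_def] t_def h_def x_def)
qed

end

section \<open>Choice of constants\<close>

context solution_pair
begin

lemma sqrt_gap_energy_0_le:
  assumes "t \<in> {0..T}" shows "sqrt (gap_energy 0 t) \<le> \<epsilon> * (sqrt (b - a) * exp (4 * T))"
proof (rule real_le_lsqrt)
  have "(\<epsilon> * (sqrt (b - a) * exp (4 * T)))\<^sup>2 = \<epsilon>\<^sup>2 * (b - a) * exp (8 * T)"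
    using V.ab by (simp add: power_mult_distrib exp_double[symmetric])
  then show "gap_energy 0 t \<le> (\<epsilon> * (sqrt (b - a) * exp (4 * T)))\<^sup>2" using gap_energy_0_le[OF assms] by simp
qed (use V.eps V.ab in auto)

lemma sqrt_gap_energy_1_le:
  assumes t: "t \<in> {0..T}" and e: "\<epsilon> * (4 * B\<^sup>2 * (b - a) ^ 3 * exp (16 * T)) \<le> 1"
  shows "sqrt (gap_energy 1 t) \<le> sqrt \<epsilon>"
proof -
  have "gap_energy 1 t ^ 3 \<le> (gap_energy 0 t)\<^sup>2 * (4 * B\<^sup>2 * (b - a))" by (rule gap_energy_1_le[OF t])
  also have "\<dots> \<le> (\<epsilon>\<^sup>2 * (b - a) * exp (8 * T))\<^sup>2 * (4 * B\<^sup>2 * (b - a))"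
    using V.ab by (intro mult_right_mono power_mono gap_energy_0_le t gap_energy_nonneg) auto
  also have "\<dots> = \<epsilon> ^ 3 * (\<epsilon> * (4 * B\<^sup>2 * (b - a) ^ 3 * exp (16 * T)))"
  proof -
    have "exp (8 * T) * exp (8 * T) = exp (16 * T)" by (simp add: exp_add[symmetric])
    then show ?thesis by (simp add: power2_eq_square power3_eq_cube)
  qed
  also have "\<dots> \<le> \<epsilon> ^ 3 * 1" using V.eps by (intro mult_left_mono e) auto
  finally have "gap_energy 1 t ^ 3 \<le> \<epsilon> ^ 3" by simp
  then have "gap_energy 1 t ^ Suc 2 \<le> \<epsilon> ^ Suc 2" by (simp only: Suc_numeral add_num_simps)
  then have "gap_energy 1 t \<le> \<epsilon>" by (rule power_le_imp_le_base[OF _ V.eps])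
  then show ?thesis by simp
qed

end

text \<open>
The problem-dependent factor in the error bound.  Its last exponential is the price for
replacing $\exp((4T+1)|\ln\<epsilon>|)$ by $\exp(T|\ln\<epsilon>|^2)$.
\<close>

definition scheme_const :: "real \<Rightarrow> real \<Rightarrow> real \<Rightarrow> real" where
  "scheme_const L T B = 3 * (1 + L) * sqrt L * (4 * B + 4 * B * (4 / T + T)) * exp (2 * T * (2 * ln (2 + B) + 2 + 20 * B)) * exp ((4 * T + 1)\<^sup>2 / (4 * T)) + 1"

lemma linear_le_quadratic:
  assumes "0 < T" shows "c * l \<le> T * l\<^sup>2 + c\<^sup>2 / (4 * (T::real))"
proof -
  have "0 \<le> (2 * T * l - c)\<^sup>2 / (4 * T)" using assms by simp
  also have "\<dots> = T * l\<^sup>2 - c * l + c\<^sup>2 / (4 * T)"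
    using assms by (simp add: power2_eq_square field_simps)
  finally show ?thesis by simp
qed

lemma exp_abs_ln: "0 < \<epsilon> \<Longrightarrow> \<epsilon> \<le> 1 \<Longrightarrow> exp \<bar>ln \<epsilon>\<bar> = 1 / (\<epsilon>::real)"
  by (simp add: exp_minus divide_inverse)

context classical_solution
begin

lemma scheme_const_ge_1: "1 \<le> scheme_const (b - a) T B"
  using ab T B_nonneg by (simp add: scheme_const_def)

lemma scheme_constant_le:
  assumes e: "0 < \<epsilon>" "\<epsilon> \<le> 1" and D: "0 \<le> D"
  shows "3 * ((1 + (b - a)) * sqrt (b - a) / \<epsilon> * (consist_const * D)) * exp (2 * T * \<Lambda>) \<le> scheme_const (b - a) T B * exp (T * \<bar>ln \<epsilon>\<bar>\<^sup>2) * D"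
proof -
  define l where "l = \<bar>ln \<epsilon>\<bar>"
  define P where "P = 3 * (1 + (b - a)) * sqrt (b - a) * consist_const"
  define Q where "Q = exp (2 * T * (2 * ln (2 + B) + 2 + 20 * B))"
  have P: "0 \<le> P" using ab consist_const_ge by (simp add: P_def)
  have "2 * T * \<Lambda> = 4 * T * l + 2 * T * (2 * ln (2 + B) + 2 + 20 * B)"
    by (simp add: \<Lambda>_def l_def algebra_simps)
  then have "exp (2 * T * \<Lambda>) = exp (4 * T * l) * Q" by (simp add: exp_add Q_def)
  then have "3 * ((1 + (b - a)) * sqrt (b - a) / \<epsilon> * (consist_const * D)) * exp (2 * T * \<Lambda>) = P * Q * ((1 / \<epsilon>) * exp (4 * T * l)) * D"
    by (simp add: P_def)
  also have "(1 / \<epsilon>) * exp (4 * T * l) = exp ((4 * T + 1) * l)"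
  proof -
    have "(4 * T + 1) * l = l + 4 * T * l" by (simp add: algebra_simps)
    then have "exp ((4 * T + 1) * l) = exp l * exp (4 * T * l)" by (simp only: exp_add)
    then show ?thesis using exp_abs_ln[OF e] by (simp add: l_def)
  qed
  also have "P * Q * exp ((4 * T + 1) * l) * D \<le> P * Q * (exp ((4 * T + 1)\<^sup>2 / (4 * T)) * exp (T * l\<^sup>2)) * D"
    using linear_le_quadratic[OF T, of "4 * T + 1" l] P D
    by (intro mult_right_mono mult_left_mono) (auto simp: exp_add[symmetric] Q_def)
  also have "\<dots> = (P * Q * exp ((4 * T + 1)\<^sup>2 / (4 * T))) * exp (T * l\<^sup>2) * D" by simp
  also have "\<dots> \<le> scheme_const (b - a) T B * exp (T * l\<^sup>2) * D"
    using D by (intro mult_right_mono) (auto simp: scheme_const_def P_def Q_def consist_const_def)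
  finally show ?thesis by (simp add: l_def)
qed

end

text \<open>
The two summands next to 1 ensure, respectively, that the error stays below 1 in the maximum norm and that the passage from
the continuous to the discrete $L^2$ norm costs at most $\<epsilon>$.
\<close>

definition step_const :: "real \<Rightarrow> real \<Rightarrow> real \<Rightarrow> real" where
  "step_const L T B = 1 / (1 + 2 * sqrt L * scheme_const L T B + exp (1 / (16 * T)) * (B * sqrt (8 * L)))"

text \<open>
Twice the constant of the continuous $L^2$ estimate plus room for the passage to the grid; the modulus
and the summand 2 keep it positive for all arguments.
\<close>

definition gap_const :: "real \<Rightarrow> real \<Rightarrow> real" where
  "gap_const T L = (2 + 2 * sqrt \<bar>L\<bar>) * exp (4 * T)"

lemma gap_const_ge: "0 < gap_const T L" "0 < T \<Longrightarrow> 0 < L \<Longrightarrow> 2 * (sqrt L * exp (4 * T)) + 2 \<le> gap_const T L"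
proof -
  show "0 < gap_const T L" by (auto simp: gap_const_def intro!: mult_pos_pos add_pos_nonneg)
  show "2 * (sqrt L * exp (4 * T)) + 2 \<le> gap_const T L" if "0 < T" "0 < L"
  proof -
    have "2 * 1 \<le> 2 * exp (4 * T)" using that by (intro mult_left_mono) auto
    then show ?thesis using that by (simp add: gap_const_def distrib_right)
  qed
qed

text \<open>
Since $\sqrt\<epsilon> = \exp(-|\ln\<epsilon>|/2)$, this is the comparison of a linear with a quadratic exponent.
\<close>

lemma exp_neg_quadratic_le:
  assumes T: "0 < T" and e: "0 < \<epsilon>" "\<epsilon> \<le> 1"
  shows "exp (- (T * \<bar>ln \<epsilon>\<bar>\<^sup>2)) \<le> exp (1 / (16 * T)) * sqrt \<epsilon>"
proof -
  have "(1/2) * \<bar>ln \<epsilon>\<bar> \<le> T * \<bar>ln \<epsilon>\<bar>\<^sup>2 + (1/2)\<^sup>2 / (4 * T)" by (rule linear_le_quadratic[OF T])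
  then have "- (T * \<bar>ln \<epsilon>\<bar>\<^sup>2) \<le> 1 / (16 * T) + ln (sqrt \<epsilon>)"
    using e by (simp add: ln_sqrt power2_eq_square)
  then have "exp (- (T * \<bar>ln \<epsilon>\<bar>\<^sup>2)) \<le> exp (1 / (16 * T) + ln (sqrt \<epsilon>))" by simp
  then show ?thesis using e by (simp add: exp_add)
qed

lemma step_size_consequences:
  assumes L: "0 < L" and T: "0 < T" and B: "0 \<le> B" and K: "1 \<le> scheme_const L T B" and e: "0 < \<epsilon>" "\<epsilon> \<le> 1"
    and h: "0 \<le> h" "h \<le> step_const L T B * (sqrt \<epsilon> * exp (- (T * \<bar>ln \<epsilon>\<bar>\<^sup>2)))"
    and tau: "0 \<le> \<tau>" "\<tau> \<le> step_const L T B * (sqrt \<epsilon> * exp (- (T * \<bar>ln \<epsilon>\<bar>\<^sup>2)))"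
  shows "sqrt L * (scheme_const L T B * exp (T * \<bar>ln \<epsilon>\<bar>\<^sup>2) * (h\<^sup>2 + \<tau>\<^sup>2)) \<le> 1"
    and "h * (B * sqrt (8 * L)) \<le> \<epsilon>"
proof -
  define c G where "c = step_const L T B" and "G = exp (- (T * \<bar>ln \<epsilon>\<bar>\<^sup>2))"
  define p q where "p = 2 * sqrt L * scheme_const L T B" and "q = exp (1 / (16 * T)) * (B * sqrt (8 * L))"
  have pq: "0 \<le> p" "0 \<le> q" using L B K by (auto simp: p_def q_def)
  have c: "c = 1 / (1 + p + q)" by (simp add: c_def step_const_def p_def q_def)
  have c0: "0 < c" "c \<le> 1" "c * p \<le> 1" "c * q \<le> 1" unfolding c using pq by (auto simp: divide_le_eq)
  have G: "0 < G" "G \<le> 1" using T by (auto simp: G_def)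
  have s: "sqrt \<epsilon> \<le> 1" "0 < sqrt \<epsilon>" using e by auto
  have hG: "h\<^sup>2 \<le> c * G" "\<tau>\<^sup>2 \<le> c * G"
  proof -
    have *: "y\<^sup>2 \<le> c * G" if y: "0 \<le> y" "y \<le> c * (sqrt \<epsilon> * G)" for y
    proof -
      have cG: "0 \<le> c * G" "c * G \<le> 1" using c0 G mult_mono[of c 1 G 1] by auto
      have "c * (sqrt \<epsilon> * G) = sqrt \<epsilon> * (c * G)" by simp
      also have "\<dots> \<le> 1 * (c * G)" using s cG by (intro mult_right_mono) auto
      finally have yc: "y \<le> c * G" using y by simp
      then have "y * y \<le> 1 * (c * G)" using y cG by (intro mult_mono) auto
      then show ?thesis by (simp add: power2_eq_square)
    qed
    show "h\<^sup>2 \<le> c * G" "\<tau>\<^sup>2 \<le> c * G" using * h tau by (auto simp: c_def G_def)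
  qed
  have GG: "exp (T * \<bar>ln \<epsilon>\<bar>\<^sup>2) * G = 1" by (simp add: G_def exp_add[symmetric])
  have "sqrt L * (scheme_const L T B * exp (T * \<bar>ln \<epsilon>\<bar>\<^sup>2) * (h\<^sup>2 + \<tau>\<^sup>2)) \<le> sqrt L * (scheme_const L T B * exp (T * \<bar>ln \<epsilon>\<bar>\<^sup>2) * (c * G + c * G))"
    using hG K L by (intro mult_left_mono add_mono) auto
  also have "\<dots> = c * p * (exp (T * \<bar>ln \<epsilon>\<bar>\<^sup>2) * G)" by (simp add: p_def)
  also have "\<dots> \<le> 1" unfolding GG using c0 by simp
  finally show "sqrt L * (scheme_const L T B * exp (T * \<bar>ln \<epsilon>\<bar>\<^sup>2) * (h\<^sup>2 + \<tau>\<^sup>2)) \<le> 1" .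
  have "h * (B * sqrt (8 * L)) \<le> c * (sqrt \<epsilon> * G) * (B * sqrt (8 * L))"
    using h B L by (intro mult_right_mono) (auto simp: c_def G_def)
  also have "\<dots> \<le> c * (sqrt \<epsilon> * (exp (1 / (16 * T)) * sqrt \<epsilon>)) * (B * sqrt (8 * L))"
    using exp_neg_quadratic_le[OF T e] c0 s B L by (intro mult_right_mono mult_left_mono) (auto simp: G_def)
  also have "\<dots> = c * q * (sqrt \<epsilon> * sqrt \<epsilon>)" by (simp add: q_def)
  also have "\<dots> = c * q * \<epsilon>" using e by simp
  also have "\<dots> \<le> 1 * \<epsilon>" using e by (intro mult_right_mono c0) auto
  finally show "h * (B * sqrt (8 * L)) \<le> \<epsilon>" by simp
qed

lemma error_estimates:
  assumes ab: "a < b" and T: "0 < T" and C0: "0 < C0" and e: "0 < \<epsilon>" "\<epsilon> \<le> 1"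
    and sol: "solves a b \<epsilon> u0 u S" "ereal T < S" "regular a b T C0 u"
    and sol0: "solves a b 0 u0 v S'" "ereal T < S'" "regular a b T C0 v"
    and B: "B = embed_const (b - a) * C0" and small: "\<epsilon> * (4 * B\<^sup>2 * (b - a) ^ 3 * exp (16 * T)) \<le> 1"
  shows "Linf_Sob T a b 0 (\<lambda>t x. u t x - v t x) \<le> ereal (gap_const T (b - a) * \<epsilon>)"
    and "Linf_Sob T a b 1 (\<lambda>t x. u t x - v t x) \<le> ereal ((1 + gap_const T (b - a)) * \<epsilon> powr (1/2))"
    and "0 < M \<Longrightarrow> h = mesh a b M \<Longrightarrow> h \<le> step_const (b - a) T B * (sqrt \<epsilon> * exp (- (T * \<bar>ln \<epsilon>\<bar>\<^sup>2))) \<Longrightarrow>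
      0 < \<tau> \<Longrightarrow> T = real N * \<tau> \<Longrightarrow> \<tau> \<le> step_const (b - a) T B * (sqrt \<epsilon> * exp (- (T * \<bar>ln \<epsilon>\<bar>\<^sup>2))) \<Longrightarrow>
      fd_scheme a b \<epsilon> u0 M \<tau> U \<Longrightarrow> k \<le> N \<Longrightarrow>
      d_norm h M (grid_err a b M \<tau> u U k) \<le> scheme_const (b - a) T B * exp (T * \<bar>ln \<epsilon>\<bar>\<^sup>2) * (h\<^sup>2 + \<tau>\<^sup>2) \<and>
      d_norm_H1 h M (grid_err a b M \<tau> u U k) \<le> 2 * scheme_const (b - a) T B * (1 / \<epsilon> * exp (T * \<bar>ln \<epsilon>\<bar>\<^sup>2)) * (h\<^sup>2 + \<tau>\<^sup>2) \<and>
      d_norm h M (grid_err a b M \<tau> v U k) \<le> gap_const T (b - a) * \<epsilon> + scheme_const (b - a) T B * exp (T * \<bar>ln \<epsilon>\<bar>\<^sup>2) * (h\<^sup>2 + \<tau>\<^sup>2) \<and>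
      d_norm_H1 h M (grid_err a b M \<tau> v U k) \<le> (1 + gap_const T (b - a)) * \<epsilon> powr (1/2) + 2 * scheme_const (b - a) T B * (1 / \<epsilon> * exp (T * \<bar>ln \<epsilon>\<bar>\<^sup>2)) * (h\<^sup>2 + \<tau>\<^sup>2)"
proof -
  let ?L = "b - a"
  have e0: "0 \<le> \<epsilon>" using e by simp
  obtain W where W: "classical_solution a b T \<epsilon> B W"
     "\<And>t. t \<in> {0..T} \<Longrightarrow> Sob a b 4 (u t) \<and> (\<forall>n. W 0 n t = cont_der a b n (u t)) \<and> (\<forall>x\<in>{a..b}. W 0 0 t x = u t x)"
     "\<forall>x\<in>{a..b}. u 0 x = u0 x"
    using regular_imp_classical[OF ab T e0 C0 sol] unfolding B by blast
  obtain Z where Z: "classical_solution a b T 0 B Z"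
     "\<And>t. t \<in> {0..T} \<Longrightarrow> Sob a b 4 (v t) \<and> (\<forall>n. Z 0 n t = cont_der a b n (v t)) \<and> (\<forall>x\<in>{a..b}. Z 0 0 t x = v t x)"
     "\<forall>x\<in>{a..b}. v 0 x = u0 x"
    using regular_imp_classical[OF ab T order_refl C0 sol0] unfolding B by blast
  have Wu: "W 0 0 t x = u t x" and Zv: "Z 0 0 t x = v t x" if "t \<in> {0..T}" "x \<in> {a..b}" for t x
    using W(2)[OF that(1)] Z(2)[OF that(1)] that(2) by blast+
  interpret V: classical_solution a b T \<epsilon> B W by (rule W(1))
  interpret Z: classical_solution a b T 0 B Z by (rule Z(1))
  interpret solution_pair a b T \<epsilon> B W Z
  proof
    fix x assume "x \<in> {a..b}"
    then show "W 0 0 0 x = Z 0 0 0 x" using Wu[of 0] Zv[of 0] W(3) Z(3) T by auto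
  qed
  define A where "A = gap_const T ?L"
  have L: "0 < ?L" using ab by simp
  have A: "0 < A" "2 * (sqrt ?L * exp (4 * T)) + 2 \<le> A" using gap_const_ge[of T ?L] T L by (auto simp: A_def)
  have pw: "\<epsilon> powr (1/2) = sqrt \<epsilon>" using e by (simp add: powr_half_sqrt)
  have es: "\<epsilon> \<le> sqrt \<epsilon>"
  proof -
    have "sqrt \<epsilon> * sqrt \<epsilon> \<le> 1 * sqrt \<epsilon>" using e by (intro mult_right_mono) auto
    then show ?thesis using e by simp
  qed
  have s0: "sqrt (gap_energy 0 t) \<le> A * \<epsilon>" if t: "t \<in> {0..T}" for t
  proof -
    have "sqrt (gap_energy 0 t) \<le> \<epsilon> * (sqrt ?L * exp (4 * T))" by (rule sqrt_gap_energy_0_le[OF t])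
    also have "\<dots> \<le> \<epsilon> * A" using A(2) e L by (intro mult_left_mono) (auto intro: order_trans[rotated])
    finally show ?thesis by (simp add: mult.commute)
  qed
  have s1: "sqrt (gap_energy 1 t) \<le> sqrt \<epsilon>" if "t \<in> {0..T}" for t by (rule sqrt_gap_energy_1_le[OF that small])
  have s01: "sqrt (gap_energy 0 t + gap_energy 1 t) \<le> (1 + A) * sqrt \<epsilon>" if t: "t \<in> {0..T}" for t
  proof -
    have "sqrt (gap_energy 0 t + gap_energy 1 t) \<le> sqrt (gap_energy 0 t) + sqrt (gap_energy 1 t)" by (rule sqrt_add_le_add_sqrt) (auto intro: gap_energy_nonneg t)
    also have "\<dots> \<le> A * sqrt \<epsilon> + sqrt \<epsilon>"
      using s0[OF t] s1[OF t] mult_left_mono[OF es, of A] A by linarith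
    finally show ?thesis by (simp add: algebra_simps)
  qed
  show "Linf_Sob T a b 0 (\<lambda>t x. u t x - v t x) \<le> ereal (gap_const T ?L * \<epsilon>)"
    using Linf_difference_le(1)[OF W(2) Z(2) s0 s01] by (simp add: A_def)
  show "Linf_Sob T a b 1 (\<lambda>t x. u t x - v t x) \<le> ereal ((1 + gap_const T ?L) * \<epsilon> powr (1/2))"
    using Linf_difference_le(2)[OF W(2) Z(2) s0 s01] by (simp add: A_def pw)
  assume M: "0 < M" and h_eq: "h = mesh a b M" and h_le: "h \<le> step_const ?L T B * (sqrt \<epsilon> * exp (- (T * \<bar>ln \<epsilon>\<bar>\<^sup>2)))"
    and tau: "0 < \<tau>" and NT: "T = real N * \<tau>" and tau_le: "\<tau> \<le> step_const ?L T B * (sqrt \<epsilon> * exp (- (T * \<bar>ln \<epsilon>\<bar>\<^sup>2)))"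
    and fd: "fd_scheme a b \<epsilon> u0 M \<tau> U" and k: "k \<le> N"
  define E where "E = scheme_const ?L T B * exp (T * \<bar>ln \<epsilon>\<bar>\<^sup>2) * (h\<^sup>2 + \<tau>\<^sup>2)"
  have h: "0 < h" unfolding h_eq by (rule mesh_pos[OF ab M])
  have h0: "0 \<le> h" using h by simp
  have cons: "sqrt ?L * E \<le> 1" "h * (B * sqrt (8 * ?L)) \<le> \<epsilon>"
    using step_size_consequences[OF L T V.B_nonneg V.scheme_const_ge_1 e h0 h_le _ tau_le] tau by (auto simp: E_def)
  define r where "r = (1 + ?L) * sqrt ?L / \<epsilon> * (V.consist_const * ((mesh a b M)\<^sup>2 + \<tau>\<^sup>2))"
  have rE: "3 * r * exp (2 * T * V.\<Lambda>) \<le> E"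
    using V.scheme_constant_le[OF e, of "h\<^sup>2 + \<tau>\<^sup>2"] by (simp add: r_def E_def h_eq)
  have small': "sqrt ?L * (3 * r * exp (2 * T * V.\<Lambda>)) \<le> 1"
    by (rule order_trans[OF mult_left_mono[OF rE] cons(1)]) (use L in simp)
  have u0W: "u0 x = W 0 0 0 x" if "x \<in> {a..b}" for x using Wu[of 0] W(3) T that by auto
  have nodes: "node a b M j \<in> {a..b}" if "j \<le> M" for j by (rule node_in[OF ab M that])
  have t: "real k * \<tau> \<in> {0..T}" using k tau by (auto simp: NT intro: mult_right_mono)
  have "wnorm \<epsilon> h M (\<lambda>j. W 0 0 (real k * \<tau>) (node a b M j) - U k j) \<le> 3 * r * exp (2 * T * V.\<Lambda>)"
    unfolding h_eq
  proof (rule V.scheme_error[OF e M tau NT _ _ _ _ r_def small' k])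
    fix k j :: nat assume kj: "1 \<le> k" "1 \<le> j" "j < M"
    then have "j \<in> {1..M-1}" by auto
    then show "\<i> * dt_c \<tau> U k j = - (1/2) * dxx (mesh a b M) (\<lambda>i. U (k + 1) i + U (k - 1) i) j + log_nl \<epsilon> (U k j)"
      using fd kj(1) unfolding fd_scheme_def by blast
  next
    show "\<And>k. U k 0 = 0 \<and> U k M = 0" using fd by (simp add: fd_scheme_def)
    show "\<And>j. j \<le> M \<Longrightarrow> U 0 j = W 0 0 0 (node a b M j)" using fd u0W nodes by (simp add: fd_scheme_def)
    show "\<And>j. j \<le> M \<Longrightarrow> U 1 j = U 0 j + complex_of_real \<tau> * W 1 0 0 (node a b M j)"
      using fd V.u_one_eq[OF u0W nodes] by (simp add: fd_scheme_def)
  qed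
  moreover have ge: "grid_err a b M \<tau> u U k j = W 0 0 (real k * \<tau>) (node a b M j) - U k j" if "j \<le> M" for j
    using Wu[OF t nodes[OF that]] by (simp add: grid_err_def)
  ultimately have wE: "wnorm \<epsilon> h M (grid_err a b M \<tau> u U k) \<le> E"
    using rE wnorm_cong[of M "grid_err a b M \<tau> u U k" "\<lambda>j. W 0 0 (real k * \<tau>) (node a b M j) - U k j" \<epsilon> h] by simp
  have dn0: "0 \<le> d_norm h M (grid_err a b M \<tau> u U k)" "0 \<le> d_seminorm_H1 h M (grid_err a b M \<tau> u U k)"
    using d_norm_nonneg[OF h0] d_seminorm_nonneg[OF h0] by auto
  have "d_norm h M (grid_err a b M \<tau> u U k) * 1 \<le> d_norm h M (grid_err a b M \<tau> u U k) * (1 / \<epsilon>)"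
    using dn0 e by (intro mult_left_mono) auto
  then have n1: "d_norm h M (grid_err a b M \<tau> u U k) \<le> E" and n2: "d_seminorm_H1 h M (grid_err a b M \<tau> u U k) \<le> E"
    using wE dn0 e by (auto simp: wnorm_def intro: order_trans[rotated])
  have E0: "0 \<le> E" using n1 dn0 by linarith
  define F where "F = 2 * scheme_const ?L T B * (1 / \<epsilon> * exp (T * \<bar>ln \<epsilon>\<bar>\<^sup>2)) * (h\<^sup>2 + \<tau>\<^sup>2)"
  have EF: "2 * E \<le> F"
  proof -
    have "2 * E * 1 \<le> 2 * E * (1 / \<epsilon>)" using E0 e by (intro mult_left_mono) auto
    then show ?thesis by (simp add: E_def F_def)
  qed
  have H1: "d_norm_H1 h M (grid_err a b M \<tau> u U k) \<le> F"
    using d_norm_H1_le[OF h0, of M "grid_err a b M \<tau> u U k"] n1 n2 EF by linarith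
  let ?d = "\<lambda>j. gap 0 (real k * \<tau>) (node a b M j)"
  have split: "grid_err a b M \<tau> v U k j = grid_err a b M \<tau> u U k j + (-1) * ?d j" if "j \<le> M" for j
    using Wu[OF t nodes[OF that]] Zv[OF t nodes[OF that]] by (simp add: grid_err_def gap_def)
  have neg: "d_norm h M (\<lambda>j. (-1) * ?d j) = d_norm h M ?d" "d_seminorm_H1 h M (\<lambda>j. (-1) * ?d j) = d_seminorm_H1 h M ?d"
    unfolding d_norm_def d_seminorm_H1_def dx_plus_scale by (simp_all add: norm_mult)
  have dd: "d_norm h M ?d \<le> A * \<epsilon>"
  proof -
    have "d_norm h M ?d \<le> sqrt (2 * gap_energy 0 (real k * \<tau>) + 8 * h\<^sup>2 * B\<^sup>2 * ?L)"
      unfolding h_eq by (rule grid_norm_le[OF t M])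
    also have "\<dots> \<le> sqrt (2 * gap_energy 0 (real k * \<tau>)) + sqrt (8 * h\<^sup>2 * B\<^sup>2 * ?L)"
      using ab by (intro sqrt_add_le_add_sqrt) (auto intro: gap_energy_nonneg t)
    also have "sqrt (8 * h\<^sup>2 * B\<^sup>2 * ?L) = h * (B * sqrt (8 * ?L))"
    proof -
      have "8 * h\<^sup>2 * B\<^sup>2 * ?L = (h * B)\<^sup>2 * (8 * ?L)" by (simp add: power_mult_distrib)
      then have "sqrt (8 * h\<^sup>2 * B\<^sup>2 * ?L) = sqrt ((h * B)\<^sup>2) * sqrt (8 * ?L)" by (simp only: real_sqrt_mult)
      also have "sqrt ((h * B)\<^sup>2) = h * B" using h V.B_nonneg by simp
      finally show ?thesis by (simp only: mult.assoc)
    qed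
    also have "sqrt (2 * gap_energy 0 (real k * \<tau>)) \<le> 2 * (\<epsilon> * (sqrt ?L * exp (4 * T)))"
    proof -
      have "sqrt (2 * gap_energy 0 (real k * \<tau>)) = sqrt 2 * sqrt (gap_energy 0 (real k * \<tau>))" by (simp add: real_sqrt_mult)
      also have "\<dots> \<le> 2 * (\<epsilon> * (sqrt ?L * exp (4 * T)))"
        using e L by (intro mult_mono sqrt_gap_energy_0_le t real_le_lsqrt) (auto intro: gap_energy_nonneg[OF _ t])
      finally show ?thesis .
    qed
    finally have "d_norm h M ?d \<le> 2 * (\<epsilon> * (sqrt ?L * exp (4 * T))) + \<epsilon>" using cons(2) by linarith
    also have "\<dots> \<le> (2 * (sqrt ?L * exp (4 * T)) + 2) * \<epsilon>" using e by (simp add: algebra_simps)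
    also have "\<dots> \<le> A * \<epsilon>" using A(2) e by (intro mult_right_mono) auto
    finally show ?thesis .
  qed
  have ds: "d_seminorm_H1 h M ?d \<le> sqrt \<epsilon>"
    using grid_seminorm_le[OF t M] s1[OF t] unfolding h_eq by (rule order_trans)
  have v1: "d_norm h M (grid_err a b M \<tau> v U k) \<le> A * \<epsilon> + E"
  proof -
    have "d_norm h M (grid_err a b M \<tau> v U k) = d_norm h M (\<lambda>j. grid_err a b M \<tau> u U k j + (-1) * ?d j)"
      by (rule d_norm_cong) (use split in auto)
    also have "\<dots> \<le> d_norm h M (grid_err a b M \<tau> u U k) + d_norm h M (\<lambda>j. (-1) * ?d j)"
      by (rule d_norm_triangle[OF h0])
    finally show ?thesis using n1 dd by (simp only: neg)
  qed
  have v2: "d_norm_H1 h M (grid_err a b M \<tau> v U k) \<le> (1 + A) * sqrt \<epsilon> + F"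
  proof -
    have "d_norm_H1 h M (grid_err a b M \<tau> v U k) = d_norm_H1 h M (\<lambda>j. grid_err a b M \<tau> u U k j + (-1) * ?d j)"
      unfolding d_norm_H1_def
      using d_norm_cong[of M "grid_err a b M \<tau> v U k" "\<lambda>j. grid_err a b M \<tau> u U k j + (-1) * ?d j" h]
        d_seminorm_cong[of M "grid_err a b M \<tau> v U k" "\<lambda>j. grid_err a b M \<tau> u U k j + (-1) * ?d j" h] split by simp
    also have "\<dots> \<le> d_norm_H1 h M (grid_err a b M \<tau> u U k) + d_norm_H1 h M (\<lambda>j. (-1) * ?d j)"
      by (rule d_norm_H1_triangle[OF h0])
    also have "d_norm_H1 h M (\<lambda>j. (-1) * ?d j) \<le> d_norm h M ?d + d_seminorm_H1 h M ?d"
      using d_norm_H1_le[OF h0, of M "\<lambda>j. (-1) * ?d j"] by (simp only: neg)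
    also have "\<dots> \<le> A * sqrt \<epsilon> + sqrt \<epsilon>"
      using dd ds mult_left_mono[OF es, of A] A by linarith
    finally show ?thesis using H1 by (simp add: algebra_simps)
  qed
  show "d_norm h M (grid_err a b M \<tau> u U k) \<le> scheme_const (b - a) T B * exp (T * \<bar>ln \<epsilon>\<bar>\<^sup>2) * (h\<^sup>2 + \<tau>\<^sup>2) \<and>
      d_norm_H1 h M (grid_err a b M \<tau> u U k) \<le> 2 * scheme_const (b - a) T B * (1 / \<epsilon> * exp (T * \<bar>ln \<epsilon>\<bar>\<^sup>2)) * (h\<^sup>2 + \<tau>\<^sup>2) \<and>
      d_norm h M (grid_err a b M \<tau> v U k) \<le> gap_const T (b - a) * \<epsilon> + scheme_const (b - a) T B * exp (T * \<bar>ln \<epsilon>\<bar>\<^sup>2) * (h\<^sup>2 + \<tau>\<^sup>2) \<and>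
      d_norm_H1 h M (grid_err a b M \<tau> v U k) \<le> (1 + gap_const T (b - a)) * \<epsilon> powr (1/2) + 2 * scheme_const (b - a) T B * (1 / \<epsilon> * exp (T * \<bar>ln \<epsilon>\<bar>\<^sup>2)) * (h\<^sup>2 + \<tau>\<^sup>2)"
    using n1 H1 v1 v2 by (simp only: E_def F_def A_def pw simp_thms)
qed

lemma comparable_on_scale: "0 < c \<Longrightarrow> comparable_on S (\<lambda>\<epsilon>. c * g \<epsilon>) g"
  unfolding comparable_on_def by (intro exI[of _ c]) auto

theorem corollary3p2:
  shows "\<exists>(C1 :: real \<Rightarrow> real \<Rightarrow> real) (C2 :: real \<Rightarrow> real \<Rightarrow> real \<Rightarrow> real) (C :: real \<Rightarrow> real).
    (\<forall>T L. 0 < C1 T L) \<and> (\<forall>T L r. 0 < C2 T L r) \<and> (\<forall>r. 0 < C r) \<and>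
    (\<forall>(a::real) (b::real) (T::real) (\<epsilon>0::real) (C0::real)
       (u0 :: real \<Rightarrow> complex) (u :: real \<Rightarrow> real \<Rightarrow> real \<Rightarrow> complex).
      a < b \<and> 0 < T \<and> 0 < \<epsilon>0 \<and> 0 < C0 \<and> Sob a b 2 u0 \<and> H10 a b u0 \<and>
      (\<forall>\<epsilon>\<in>{0..\<epsilon>0}. solves a b \<epsilon> u0 (u \<epsilon>) (T_max a b \<epsilon> u0) \<and> ereal T < T_max a b \<epsilon> u0 \<and>
          regular a b T C0 (u \<epsilon>))
      \<longrightarrow>
      (\<exists>\<epsilon>1\<in>{0<..\<epsilon>0}. \<exists>(h0 :: real \<Rightarrow> real) (\<tau>0 :: real \<Rightarrow> real)
          (C1T :: real \<Rightarrow> real) (C2T :: real \<Rightarrow> real).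
        comparable_on {0<..\<epsilon>1} h0 (\<lambda>\<epsilon>. sqrt \<epsilon> * exp (- (C C0 * T * \<bar>ln \<epsilon>\<bar>\<^sup>2))) \<and>
        comparable_on {0<..\<epsilon>1} \<tau>0 (\<lambda>\<epsilon>. sqrt \<epsilon> * exp (- (C C0 * T * \<bar>ln \<epsilon>\<bar>\<^sup>2))) \<and>
        comparable_on {0<..\<epsilon>1} C1T (\<lambda>\<epsilon>. exp (C C0 * T * \<bar>ln \<epsilon>\<bar>\<^sup>2)) \<and>
        comparable_on {0<..\<epsilon>1} C2T (\<lambda>\<epsilon>. 1 / \<epsilon> * exp (C C0 * T * \<bar>ln \<epsilon>\<bar>\<^sup>2)) \<and>
        (\<forall>\<epsilon>\<in>{0<..\<epsilon>1}.
          Linf_Sob T a b 0 (\<lambda>t x. u \<epsilon> t x - u 0 t x) \<le> ereal (C1 T (b - a) * \<epsilon>) \<and>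
          Linf_Sob T a b 1 (\<lambda>t x. u \<epsilon> t x - u 0 t x)
            \<le> ereal (C2 T (b - a) (Sob_norm a b 2 u0) * \<epsilon> powr (1/2)) \<and>
          (\<forall>(M::nat) (N::nat) (h::real) (\<tau>::real) (U :: nat \<Rightarrow> nat \<Rightarrow> complex).
            0 < M \<and> h = mesh a b M \<and> h \<le> h0 \<epsilon> \<and>
            0 < \<tau> \<and> T = real N * \<tau> \<and> \<tau> \<le> \<tau>0 \<epsilon> \<and>
            fd_scheme a b \<epsilon> u0 M \<tau> U \<and> stability \<epsilon> M \<tau> N U
            \<longrightarrow>
            (\<forall>k\<le>N.
              d_norm h M (grid_err a b M \<tau> (u \<epsilon>) U k) \<le> C1T \<epsilon> * (h\<^sup>2 + \<tau>\<^sup>2) \<and>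
              d_norm_H1 h M (grid_err a b M \<tau> (u \<epsilon>) U k) \<le> C2T \<epsilon> * (h\<^sup>2 + \<tau>\<^sup>2) \<and>
              d_norm h M (grid_err a b M \<tau> (u 0) U k)
                \<le> C1 T (b - a) * \<epsilon> + C1T \<epsilon> * (h\<^sup>2 + \<tau>\<^sup>2) \<and>
              d_norm_H1 h M (grid_err a b M \<tau> (u 0) U k)
                \<le> C2 T (b - a) (Sob_norm a b 2 u0) * \<epsilon> powr (1/2)
                  + C2T \<epsilon> * (h\<^sup>2 + \<tau>\<^sup>2))))))"
proof (rule exI[of _ gap_const], rule exI[of _ "\<lambda>T L r. 1 + gap_const T L"], rule exI[of _ "\<lambda>r. 1"],
    intro conjI allI impI, goal_cases)
  case (1 T L)
  show ?case by (rule gap_const_ge(1))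
next
  case (2 T L r)
  show ?case using gap_const_ge(1)[of T L] by linarith
next
  case (3 r)
  show ?case by simp
next
  case (4 a b T \<epsilon>0 C0 u0 u)
  then have ab: "a < b" and T: "0 < T" and \<epsilon>0: "0 < \<epsilon>0" and C0: "0 < C0" by auto
  have sol: "solves a b \<epsilon> u0 (u \<epsilon>) (T_max a b \<epsilon> u0)" "ereal T < T_max a b \<epsilon> u0" "regular a b T C0 (u \<epsilon>)"
    if "0 \<le> \<epsilon>" "\<epsilon> \<le> \<epsilon>0" for \<epsilon>
    using 4 that by auto
  define L B where "L = b - a" and "B = embed_const (b - a) * C0"
  have L: "0 < L" using ab by (simp add: L_def)
  have B: "0 < B" using ab C0 by (auto simp: B_def embed_const_def intro!: mult_pos_pos add_pos_pos)
  define K where "K = 4 * B\<^sup>2 * L ^ 3 * exp (16 * T)"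
  have K: "0 \<le> K" using L by (simp add: K_def)
  \<comment> \<open>This threshold makes the interpolation inequality give \<open>sqrt \<epsilon>\<close> without a constant.\<close>
  define \<epsilon>1 where "\<epsilon>1 = min \<epsilon>0 (1 / (1 + K))"
  have \<epsilon>1: "\<epsilon>1 \<in> {0<..\<epsilon>0}" using \<epsilon>0 K by (auto simp: \<epsilon>1_def)
  have Ks: "1 \<le> scheme_const L T B" using L T B by (simp add: scheme_const_def)
  have Kst: "0 < step_const L T B"
    unfolding step_const_def using L B Ks by (intro divide_pos_pos add_pos_nonneg mult_nonneg_nonneg) auto
  have small: "\<epsilon> \<le> 1" "\<epsilon> * K \<le> 1" "\<epsilon> \<le> \<epsilon>0" if "\<epsilon> \<in> {0<..\<epsilon>1}" for \<epsilon>
  proof -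
    have e: "0 < \<epsilon>" "\<epsilon> \<le> 1 / (1 + K)" "\<epsilon> \<le> \<epsilon>0" using that by (auto simp: \<epsilon>1_def)
    then have "\<epsilon> * (1 + K) \<le> 1" using K by (simp add: pos_le_divide_eq)
    moreover have "0 \<le> \<epsilon> * K" using e K by simp
    ultimately show "\<epsilon> \<le> 1" "\<epsilon> * K \<le> 1" "\<epsilon> \<le> \<epsilon>0" using e by (auto simp: distrib_left)
  qed
  have est: "0 < \<epsilon>" "\<epsilon> \<le> 1" "\<epsilon> * (4 * B\<^sup>2 * (b - a) ^ 3 * exp (16 * T)) \<le> 1" "0 \<le> \<epsilon>" "\<epsilon> \<le> \<epsilon>0"
    if "\<epsilon> \<in> {0<..\<epsilon>1}" for \<epsilon>
    using small[OF that] that by (simp_all add: K_def L_def)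
  have z: "0 \<le> (0::real)" "0 \<le> \<epsilon>0" using \<epsilon>0 by auto
  note est' = error_estimates[OF ab T C0 est(1,2) sol[OF est(4,5)] sol[OF z] B_def est(3), folded L_def]
  show ?case
    unfolding mult_1 L_def[symmetric]
  proof (rule bexI[OF _ \<epsilon>1],
      rule exI[of _ "\<lambda>\<epsilon>. step_const L T B * (sqrt \<epsilon> * exp (- (T * \<bar>ln \<epsilon>\<bar>\<^sup>2)))"],
      rule exI[of _ "\<lambda>\<epsilon>. step_const L T B * (sqrt \<epsilon> * exp (- (T * \<bar>ln \<epsilon>\<bar>\<^sup>2)))"],
      rule exI[of _ "\<lambda>\<epsilon>. scheme_const L T B * exp (T * \<bar>ln \<epsilon>\<bar>\<^sup>2)"],
      rule exI[of _ "\<lambda>\<epsilon>. 2 * scheme_const L T B * (1 / \<epsilon> * exp (T * \<bar>ln \<epsilon>\<bar>\<^sup>2))"], intro conjI ballI, goal_cases)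
    case 1
    show ?case by (rule comparable_on_scale[OF Kst])
  next
    case 2
    show ?case by (rule comparable_on_scale[OF Kst])
  next
    case 3
    show ?case by (rule comparable_on_scale) (use Ks in simp)
  next
    case 4
    show ?case by (rule comparable_on_scale) (use Ks in simp)
  next
    case (5 \<epsilon>)
    then show ?case by - (rule est'(1))
  next
    case (6 \<epsilon>)
    then show ?case by - (rule est'(2))
  next
    case (7 \<epsilon>)
    then show ?case by - (intro allI impI; elim conjE; rule est'(3); assumption)
  qed
qed

end
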